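(* Let $d\ge2$, $Q>0$ and $m>0$. For every $\alpha\in(0,d-1)$, $$\inf_{|E|=m}\mathcal F_{\alpha,Q}(E)=\inf_{|E|=m}\mathcal G_{\alpha,Q}(E)=\min_{|E|=m}P(E)=\left(\frac{m}{\omega_d}\right)^{\frac{d-1}{d}}P(B),$$ where the first two infima are over open sets $E\subset\mathbb R^d$ with $|E|=m$. In particular, neither of the problems $$\inf_{|E|=m,\ E\subset\mathbb R^d}\mathcal F_{\alpha,Q}(E),\qquad \inf_{|E|=m,\ E\subset\mathbb R^d}\mathcal G_{\alpha,Q}(E)$$ admits a minimizer.
   Context: $|E|$ is Lebesgue measure in $\mathbb R^d$; $B$ is the open unit ball and $\omega_d=|B|$. $P(E)$ is the perimeter of $E$ in $\mathbb R^d$ in the sense of De Giorgi (equal to $\mathcal H^{d-1}(\partial E)$ when $E$ has smooth boundary). For a Borel set $A\subset\mathbb R^d$, $$\mathcal I_\alpha(A)=\inf\left\{\int_{\mathbb R^d\times\mathbb R^d}\frac{d\mu(x)\,d\mu(y)}{|x-y|^\alpha}:\ \mu \text{ non-negative Borel measure on }\mathbb R^d,\ \mu(A)=1\right\}.$$ For $Q>0$ and every open set $E\subset\mathbb R^d$, $\mathcal F_{\alpha,Q}(E)=P(E)+Q^2\mathcal I_\alpha(E)$ and $\mathcal G_{\alpha,Q}(E)=P(E)+Q^2\mathcal I_\alpha(\partial E)$. *)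

theory Defs
  imports "HOL-Analysis.Analysis"
begin

definition C1_compact_support :: "('a::euclidean_space \<Rightarrow> 'a) \<Rightarrow> bool" where
  "C1_compact_support \<phi> \<longleftrightarrow>
     \<phi> differentiable_on UNIV \<and>
     (\<forall>v. continuous_on UNIV (\<lambda>x. frechet_derivative \<phi> (at x) v)) \<and>
     compact (closure {x. \<phi> x \<noteq> 0})"

definition divergence :: "('a::euclidean_space \<Rightarrow> 'a) \<Rightarrow> 'a \<Rightarrow> real" where
  "divergence \<phi> x = (\<Sum>b\<in>Basis. frechet_derivative \<phi> (at x) b \<bullet> b)"

(* De Giorgi's perimeter, meant for Lebesgue measurable E.  The map ennreal sends negative
   integrals to 0, which does not change the supremum because \<phi> = 0 is a competitor. *)
definition perimeter :: "'a::euclidean_space set \<Rightarrow> ennreal" where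
  "perimeter E =
     (SUP \<phi>\<in>{\<phi>. C1_compact_support \<phi> \<and> (\<forall>x. norm (\<phi> x) \<le> 1)}.
        ennreal (set_lebesgue_integral lebesgue E (divergence \<phi>)))"

(* The quotient is taken in ennreal, so the kernel is \<infinity> on the diagonal; in real it would be 0.
   The measures are not assumed \<sigma>-finite, so the double integral is written as an iterated one
   (by Tonelli it is the integral over the product measure if \<mu> is \<sigma>-finite).  Restricting \<mu>
   to A keeps \<mu>(A) = 1 and does not increase the energy, so finite measures give the same
   infimum. *)
definition riesz_energy :: "real \<Rightarrow> 'a::euclidean_space set \<Rightarrow> ennreal" where
  "riesz_energy \<alpha> A =
     (INF \<mu>\<in>{\<mu>. sets \<mu> = sets borel \<and> emeasure \<mu> A = 1}.
        (\<integral>\<^sup>+ x. (\<integral>\<^sup>+ y. 1 / ennreal (norm (x - y) powr \<alpha>) \<partial>\<mu>) \<partial>\<mu>))"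

definition energy_F :: "real \<Rightarrow> real \<Rightarrow> 'a::euclidean_space set \<Rightarrow> ennreal" where
  "energy_F \<alpha> Q E = perimeter E + ennreal (Q\<^sup>2) * riesz_energy \<alpha> E"

definition energy_G :: "real \<Rightarrow> real \<Rightarrow> 'a::euclidean_space set \<Rightarrow> ennreal" where
  "energy_G \<alpha> Q E = perimeter E + ennreal (Q\<^sup>2) * riesz_energy \<alpha> (frontier E)"

end

theory Submission
  imports Defs "HOL-Probability.Distribution_Functions" "HOL-Probability.Probability_Mass_Function"
begin

text \<open>
  Lower bound: both energies dominate the perimeter, so everything rests on the sharp isoperimetric
  inequality for De Giorgi's perimeter. Applying Brunn-Minkowski to the superlevel sets of a smooth
  \<open>g\<close> and their \<open>\<epsilon>\<close>-neighbourhoods bounds \<open>\<integral>\<bar>\<nabla>g\<bar>\<close> from below as \<open>\<epsilon> \<rightarrow> 0\<close>; testing the perimeter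
  with \<open>- G / sqrt (\<delta>\<^sup>2 + \<bar>G\<bar>\<^sup>2)\<close>, where \<open>G\<close> is the gradient of a mollified and truncated indicator
  function, bounds it from above.

  Upper bound: a ball of almost full mass plus \<open>N\<close> far apart balls of radius \<open>r = N powr (-\<beta>)\<close> with
  \<open>1 / (d - 1) < \<beta> < 1 / \<alpha>\<close>. Their perimeter \<open>N r\<^sup>d\<^sup>-\<^sup>1\<close> and the energy \<open>1 / (N r powr \<alpha>)\<close> of a charge
  shared among them both vanish. Each small ball is cut by a hyperplane, which changes neither volume
  nor perimeter but puts a flat disc into the boundary; it carries a charge of finite
  energy because \<open>\<alpha> < d - 1\<close>.

  Non-existence: the Riesz energy of a minimiser would vanish, so the minimiser would be unbounded and
  optimal for the perimeter. Cutting along slabs yields \<open>V (t + w) powr ((d - 1) / d) \<le> C / w * V t\<close> for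
  the volume \<open>V t\<close> beyond a hyperplane, which by De Giorgi's iteration vanishes for large \<open>t\<close>.
\<close>

section \<open>The Brunn-Minkowski inequality\<close>

text \<open>De Giorgi's perimeter is a supremum over smooth fields, so a sharp cut of a set by a
  hyperplane is replaced by a smooth cut-off across a slab. This is why the isoperimetric inequality
  is proved for functions \<open>u\<close> with values in \<open>[0, 1]\<close> that equal 1 on
  \<open>A\<close>, with a bound \<open>M\<close> on all tested integrals in place of the perimeter:
  an indicator times a cut-off stays in this class, and the two halves of a slab cut are two such
  functions. The cut through the small balls produces boundary charges without a surface measure:
  uniform charge on a ball, pushed forward by the orthogonal projection onto the hyperplane, sits on
  the flat disc, and its energy is a Lebesgue integral over the ball. As the projection shortens
  distances, the same number \<open>J\<close> also bounds the energy of the uniform charge on the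
  solid ball, so one computation serves both functionals. The window for \<beta> is forced: the
  perimeter needs \<open>\<beta> (d - 1) > 1\<close>, the self-energy needs
  \<open>\<alpha> \<beta> < 1\<close>, and \<open>\<alpha> < d - 1\<close> makes both
  possible.\<close>

abbreviation sumset :: "'a::real_normed_vector set \<Rightarrow> 'a set \<Rightarrow> 'a set" where
  "sumset A B \<equiv> \<Union>x\<in>A. \<Union>y\<in>B. {x + y}"

text \<open>The d-th power is kept on the left so that both sides are volumes: when the sets are
  cut, the inequalities for the pieces can be added.\<close>

definition BM_ineq :: "'a::euclidean_space set \<Rightarrow> 'a set \<Rightarrow> bool" where
  "BM_ineq A B \<longleftrightarrow> (measure lborel A powr (1 / DIM('a)) + measure lborel B powr (1 / DIM('a))) powr DIM('a) \<le> measure lborel (sumset A B)"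

lemma sumset_commute: "sumset A B = sumset B A"
  by (auto simp: add.commute)

lemma bounded_sumset:
  fixes A B :: "'a::euclidean_space set"
  assumes "bounded A" "bounded B"
  shows "bounded (sumset A B)"
proof -
  have "sumset A B = {x + y |x y. x \<in> A \<and> y \<in> B}" by auto
  then show ?thesis using bounded_sums[OF assms] by simp
qed

lemma emeasure_bounded_open:
  fixes A :: "'a::euclidean_space set"
  assumes "open A" "bounded A"
  shows "emeasure lborel A = ennreal (measure lborel A)" "emeasure lborel A < \<infinity>"
proof -
  show *: "emeasure lborel A < \<infinity>" using assms(2) emeasure_bounded_finite by blast
  then show "emeasure lborel A = ennreal (measure lborel A)" by (simp add: emeasure_eq_ennreal_measure)
qed

lemma content_mono_bounded:
  fixes A :: "'a::euclidean_space set"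
  assumes "A \<subseteq> B" "A \<in> sets borel" "B \<in> sets borel" "bounded B"
  shows "measure lborel A \<le> measure lborel B"
  using assms emeasure_bounded_finite[OF assms(4)] by (intro measure_mono_fmeasurable) (auto simp: fmeasurable_def)

lemma null_hyperplane_Basis:
  assumes "i \<in> Basis"
  shows "{x::'a::euclidean_space. x \<bullet> i = c} \<in> null_sets lborel"
proof -
  have "negligible {x::'a. i \<bullet> x = c}"
    using assms by (intro negligible_hyperplane) auto
  moreover have "{x::'a. i \<bullet> x = c} = {x. x \<bullet> i = c}" by (auto simp: inner_commute)
  moreover have "{x::'a. x \<bullet> i = c} \<in> sets lborel" by simp
  ultimately show ?thesis by (simp add: negligible_iff_null_sets null_sets_completion_iff)
qed

lemma halfspace_split_content:
  fixes A :: "'a::euclidean_space set"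
  assumes "open A" "bounded A" "i \<in> Basis"
  shows "measure lborel A = measure lborel (A \<inter> {x. x \<bullet> i < c}) + measure lborel (A \<inter> {x. x \<bullet> i > c})"
proof -
  have fm: "A \<in> fmeasurable lborel"
    using assms emeasure_bounded_open[of A] by (auto simp: fmeasurable_def)
  have "measure lborel A = measure lborel (A - {x. x \<bullet> i = c})"
    using null_hyperplane_Basis[OF assms(3)] fm
    by (intro measure_Diff_null_set[symmetric]) auto
  also have "A - {x. x \<bullet> i = c} = (A \<inter> {x. x \<bullet> i < c}) \<union> (A \<inter> {x. x \<bullet> i > c})" by auto
  also have "measure lborel \<dots> = measure lborel (A \<inter> {x. x \<bullet> i < c}) + measure lborel (A \<inter> {x. x \<bullet> i > c})"
    using fm by (intro measure_Un_AE) (auto intro!: fmeasurable_Int_fmeasurable borel_measurable_inner simp: fmeasurableD)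
  finally show ?thesis .
qed

text \<open>Intermediate value theorem for the distribution function of \<open>x \<bullet> i\<close>
  under Lebesgue measure on \<open>B\<close>; it is continuous because hyperplanes are null
  sets.\<close>

lemma halfspace_fraction:
  fixes B :: "'a::euclidean_space set"
  assumes B: "open B" "bounded B" and i: "i \<in> Basis" and \<theta>: "0 < \<theta>" "\<theta> < 1" and pos: "measure lborel B > 0"
  obtains c where "measure lborel (B \<inter> {x. x \<bullet> i < c}) = \<theta> * measure lborel B"
    "measure lborel (B \<inter> {x. x \<bullet> i > c}) = (1 - \<theta>) * measure lborel B"
proof -
  define M where "M = distr (restrict_space lborel B) borel (\<lambda>x. x \<bullet> i)"
  have Bs: "B \<in> sets borel" using B by simp
  have em: "emeasure M S = emeasure lborel (B \<inter> {x. x \<bullet> i \<in> S})" if "S \<in> sets borel" for S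
  proof -
    have meas: "(\<lambda>x. x \<bullet> i) \<in> borel_measurable (restrict_space lborel B)"
      by (intro measurable_restrict_space1) simp
    have "emeasure M S = emeasure (restrict_space lborel B) ((\<lambda>x. x \<bullet> i) -` S \<inter> B)"
      unfolding M_def by (subst emeasure_distr[OF meas that]) (simp add: space_restrict_space)
    also have "\<dots> = emeasure lborel ((\<lambda>x. x \<bullet> i) -` S \<inter> B)"
      using Bs by (intro emeasure_restrict_space) auto
    also have "(\<lambda>x. x \<bullet> i) -` S \<inter> B = B \<inter> {x. x \<bullet> i \<in> S}" by auto
    finally show ?thesis .
  qed
  have sp: "space M = UNIV" by (simp add: M_def)
  have fin: "emeasure M (space M) \<noteq> \<infinity>"
    using em[of UNIV] emeasure_bounded_open(2)[OF B] by (simp add: sp less_top)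
  have setsM: "sets M = sets borel" by (simp add: M_def)
  interpret finite_borel_measure M
    by (intro finite_borel_measure.intro finite_measureI fin) (simp add: finite_borel_measure_axioms_def setsM)
  have cont: "isCont (cdf M) x" for x
  proof -
    have "emeasure lborel (B \<inter> {y. y \<bullet> i = x}) = 0"
      using null_set_Int1[OF null_hyperplane_Basis[OF i, of x], of B] Bs by auto
    then show ?thesis using em[of "{x}"] by (simp add: isCont_cdf measure_def)
  qed
  have tot: "measure M (space M) = measure lborel B" using em[of UNIV] by (simp add: sp measure_def)
  have "eventually (\<lambda>x. cdf M x < \<theta> * measure lborel B) at_bot"
    using cdf_lim_at_bot pos \<theta> by (intro order_tendstoD(2)) auto
  then obtain a where a: "cdf M a < \<theta> * measure lborel B"
    by (auto simp: eventually_at_bot_linorder)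
  have "eventually (\<lambda>x. cdf M x > \<theta> * measure lborel B) at_top"
    using cdf_lim_at_top pos \<theta> unfolding tot by (intro order_tendstoD(1)) auto
  then obtain b where b: "cdf M b > \<theta> * measure lborel B"
    by (auto simp: eventually_at_top_linorder)
  have "a \<le> b" using a b cdf_nondecreasing[of b a] by linarith
  then obtain c where c: "cdf M c = \<theta> * measure lborel B"
    using IVT[of "cdf M" a "\<theta> * measure lborel B" b] a b cont by fastforce
  have "measure lborel (B \<inter> {x. x \<bullet> i < c}) = measure lborel (B \<inter> {x. x \<bullet> i \<le> c})"
  proof -
    have "measure lborel (B \<inter> {x. x \<bullet> i \<le> c}) = measure lborel ((B \<inter> {x. x \<bullet> i \<le> c}) - {x. x \<bullet> i = c})"
      using null_hyperplane_Basis[OF i] Bs by (subst measure_Diff_null_set) auto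
    also have "(B \<inter> {x. x \<bullet> i \<le> c}) - {x. x \<bullet> i = c} = B \<inter> {x. x \<bullet> i < c}" by auto
    finally show ?thesis by simp
  qed
  also have "\<dots> = cdf M c" using em[of "{..c}"] by (simp add: cdf_def measure_def)
  finally have 1: "measure lborel (B \<inter> {x. x \<bullet> i < c}) = \<theta> * measure lborel B" using c by simp
  moreover have "measure lborel (B \<inter> {x. x \<bullet> i > c}) = (1 - \<theta>) * measure lborel B"
    using halfspace_split_content[OF B i, of c] 1 by (simp add: algebra_simps)
  ultimately show ?thesis using that by blast
qed

text \<open>The Brunn-Minkowski expression is homogeneous of degree one in the two volumes. Cutting
  both sets in the same ratio \<theta> therefore splits it into the shares \<theta> and
  \<open>1 - \<theta>\<close>.\<close>

lemma powr_scaled_sum: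
  fixes a b t N :: real
  assumes "a \<ge> 0" "b \<ge> 0" "t \<ge> 0" "N > 0"
  shows "((t * a) powr (1/N) + (t * b) powr (1/N)) powr N = t * (a powr (1/N) + b powr (1/N)) powr N"
proof -
  have "(t * a) powr (1/N) + (t * b) powr (1/N) = t powr (1/N) * (a powr (1/N) + b powr (1/N))"
    using assms by (simp add: powr_mult algebra_simps)
  then show ?thesis using assms by (simp add: powr_mult powr_powr)
qed

text \<open>Hadwiger and Ohmann's induction step: the second set is cut in the same ratio as the first.\<close>

lemma BM_split:
  fixes A B :: "'a::euclidean_space set"
  assumes A: "open A" "bounded A" and B: "open B" "bounded B" and i: "i \<in> Basis"
    and posA: "measure lborel (A \<inter> {x. x \<bullet> i < c}) > 0" "measure lborel (A \<inter> {x. x \<bullet> i > c}) > 0"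
    and posB: "measure lborel B > 0"
    and IH: "\<And>c'. \<lbrakk>measure lborel (B \<inter> {x. x \<bullet> i < c'}) > 0; measure lborel (B \<inter> {x. x \<bullet> i > c'}) > 0\<rbrakk> \<Longrightarrow>
       BM_ineq (A \<inter> {x. x \<bullet> i < c}) (B \<inter> {x. x \<bullet> i < c'}) \<and> BM_ineq (A \<inter> {x. x \<bullet> i > c}) (B \<inter> {x. x \<bullet> i > c'})"
  shows "BM_ineq A B"
proof -
  define A1 A2 where A12: "A1 = A \<inter> {x. x \<bullet> i < c}" "A2 = A \<inter> {x. x \<bullet> i > c}"
  define \<theta> where "\<theta> = measure lborel A1 / measure lborel A"
  have sum: "measure lborel A = measure lborel A1 + measure lborel A2" and pos: "measure lborel A1 > 0" "measure lborel A2 > 0"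
    using halfspace_split_content[OF A i, of c] posA by (auto simp: A12)
  then have th: "0 < \<theta>" "\<theta> < 1" by (auto simp: \<theta>_def)
  have a1: "measure lborel A1 = \<theta> * measure lborel A" using sum pos by (simp add: \<theta>_def)
  have a2: "measure lborel A2 = (1 - \<theta>) * measure lborel A" using sum a1 by (simp add: algebra_simps)
  obtain c' where c': "measure lborel (B \<inter> {x. x \<bullet> i < c'}) = \<theta> * measure lborel B"
    "measure lborel (B \<inter> {x. x \<bullet> i > c'}) = (1 - \<theta>) * measure lborel B"
    using halfspace_fraction[OF B i th posB] .
  define B1 B2 where B12: "B1 = B \<inter> {x. x \<bullet> i < c'}" "B2 = B \<inter> {x. x \<bullet> i > c'}"
  have BM12: "BM_ineq A1 B1" "BM_ineq A2 B2"
    using IH[of c'] c' th posB by (auto simp: A12 B12)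
  have op: "open (sumset A1 B1)" "open (sumset A2 B2)" "open (sumset A B)"
    using A B by (auto intro!: open_sums open_Int simp: A12 B12 open_halfspace_component_lt open_halfspace_component_gt)
  have bd: "bounded (sumset A B)" using A B by (intro bounded_sumset)
  have sub: "sumset A1 B1 \<union> sumset A2 B2 \<subseteq> sumset A B" by (auto simp: A12 B12)
  have bd12: "bounded (sumset A1 B1)" "bounded (sumset A2 B2)"
    using bd sub by (auto intro: bounded_subset)
  \<comment> \<open>The hyperplane at level \<open>c + c'\<close> separates the two sumsets, so
    their volumes add up inside \<open>sumset A B\<close>.\<close>
  have "u \<bullet> i < c + c'" if "u \<in> sumset A1 B1" for u
    using that by (auto simp: A12 B12 inner_add_left)
  moreover have "u \<bullet> i > c + c'" if "u \<in> sumset A2 B2" for u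
    using that by (auto simp: A12 B12 inner_add_left)
  ultimately have disj: "sumset A1 B1 \<inter> sumset A2 B2 = {}"
    by (meson disjoint_iff less_asym)
  let ?N = "real DIM('a)"
  let ?s = "(measure lborel A powr (1/?N) + measure lborel B powr (1/?N)) powr ?N"
  have "?s = \<theta> * ?s + (1 - \<theta>) * ?s" by (simp add: algebra_simps)
  also have "\<dots> = (measure lborel A1 powr (1/?N) + measure lborel B1 powr (1/?N)) powr ?N
      + (measure lborel A2 powr (1/?N) + measure lborel B2 powr (1/?N)) powr ?N"
    using th c' by (simp add: a1 a2 powr_scaled_sum flip: B12)
  also have "\<dots> \<le> measure lborel (sumset A1 B1) + measure lborel (sumset A2 B2)"
    using BM12 by (intro add_mono) (auto simp: BM_ineq_def)
  also have "\<dots> = measure lborel (sumset A1 B1 \<union> sumset A2 B2)"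
    using op bd12 disj emeasure_bounded_open
    by (intro measure_Union[symmetric]) (auto simp: less_top)
  also have "\<dots> \<le> measure lborel (sumset A B)"
    using op sub bd by (intro content_mono_bounded) auto
  finally show ?thesis by (simp add: BM_ineq_def)
qed

text \<open>The sumset contains the box with the added side lengths \<open>l + m\<close>. After
  division by the d-th root of its volume, the claim is the inequality of arithmetic and geometric
  means for the ratios \<open>l / (l + m)\<close> and \<open>m / (l + m)\<close>, whose arithmetic
  means add up to 1.\<close>

lemma BM_box_box:
  fixes a b c d :: "'a::euclidean_space"
  assumes "box a b \<noteq> {}" "box c d \<noteq> {}"
  shows "BM_ineq (box a b) (box c d)"
proof -
  let ?l = "\<lambda>i. (b - a) \<bullet> i" and ?m = "\<lambda>i. (d - c) \<bullet> i" and ?N = "real DIM('a)"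
  have ab: "a \<bullet> i < b \<bullet> i" and cd: "c \<bullet> i < d \<bullet> i" if "i \<in> Basis" for i
    using assms that by (auto simp: box_ne_empty)
  have lm: "?l i > 0" "?m i > 0" if "i \<in> Basis" for i
    using ab[OF that] cd[OF that] by (auto simp: inner_diff_left)
  have cA: "measure lborel (box a b) = (\<Prod>i\<in>Basis. ?l i)" using ab by (auto simp: measure_lborel_box_eq less_imp_le)
  have cB: "measure lborel (box c d) = (\<Prod>i\<in>Basis. ?m i)" using cd by (auto simp: measure_lborel_box_eq less_imp_le)
  have cS: "measure lborel (box (a + c) (b + d)) = (\<Prod>i\<in>Basis. ?l i + ?m i)"
  proof -
    have *: "(a + c) \<bullet> i \<le> (b + d) \<bullet> i" if "i \<in> Basis" for i
      using ab[OF that] cd[OF that] by (simp add: inner_add_left)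
    show ?thesis using * by (auto simp: measure_lborel_box_eq inner_add_left inner_diff_left algebra_simps intro!: prod.cong)
  qed
  have sub: "box (a + c) (b + d) \<subseteq> sumset (box a b) (box c d)"
  proof
    fix z assume z: "z \<in> box (a + c) (b + d)"
    \<comment> \<open>\<open>t i\<close> is the relative position of \<open>z\<close> along
      coordinate \<open>i\<close> of the sum box; both summands are placed at that same relative
      position in their boxes.\<close>
    define t where "t i = (z \<bullet> i - a \<bullet> i - c \<bullet> i) / (?l i + ?m i)" for i
    have t: "0 < t i" "t i < 1" if "i \<in> Basis" for i
      using z that lm[OF that] by (auto simp: t_def mem_box inner_add_left inner_diff_left field_simps)
    define x where "x = (\<Sum>i\<in>Basis. (a \<bullet> i + t i * ?l i) *\<^sub>R i)"
    have xi: "x \<bullet> i = a \<bullet> i + t i * ?l i" if "i \<in> Basis" for i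
      using that by (simp add: x_def)
    have zi: "(z - x) \<bullet> i = c \<bullet> i + t i * ?m i" if i: "i \<in> Basis" for i
    proof -
      have "t i * (?l i + ?m i) = z \<bullet> i - a \<bullet> i - c \<bullet> i" using lm[OF i] by (simp add: t_def)
      then show ?thesis using xi[OF i] by (simp add: algebra_simps inner_diff_left)
    qed
    have *: "0 < s * w \<and> s * w < w" if "0 < s" "s < 1" "w > 0" for s w :: real
      using that by simp
    have "a \<bullet> i < x \<bullet> i \<and> x \<bullet> i < b \<bullet> i" if "i \<in> Basis" for i
      using xi[OF that] *[OF t(1)[OF that] t(2)[OF that] lm(1)[OF that]] inner_diff_left[of b a i] by linarith
    then have "x \<in> box a b" by (auto simp: mem_box)
    moreover have "c \<bullet> i < (z - x) \<bullet> i \<and> (z - x) \<bullet> i < d \<bullet> i" if "i \<in> Basis" for i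
      using zi[OF that] *[OF t(1)[OF that] t(2)[OF that] lm(2)[OF that]] inner_diff_left[of d c i] by linarith
    then have "z - x \<in> box c d" by (auto simp: mem_box)
    ultimately have "x \<in> box a b" "z - x \<in> box c d" "z = x + (z - x)" by simp_all
    then show "z \<in> sumset (box a b) (box c d)" by blast
  qed
  let ?S = "\<Prod>i\<in>Basis. ?l i + ?m i"
  have Spos: "?S > 0" using lm by (intro prod_pos) (auto simp: add_pos_pos)
  have am: "(\<Prod>i\<in>Basis. f i) powr (1 / ?N) \<le> (\<Sum>i\<in>Basis. f i / (?l i + ?m i)) / ?N * ?S powr (1 / ?N)"
    if f: "\<And>i. i \<in> Basis \<Longrightarrow> f i > 0" for f :: "'a \<Rightarrow> real"
  proof -
    have "(\<Prod>i\<in>Basis. f i / (?l i + ?m i)) powr (1 / ?N) \<le> (\<Sum>i\<in>Basis. f i / (?l i + ?m i) / ?N)"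
      using arith_geom_mean[of "Basis::'a set" "\<lambda>i. f i / (?l i + ?m i)"] f lm
      by (auto intro!: divide_nonneg_pos add_pos_pos less_imp_le[OF f])
    moreover have "(\<Prod>i\<in>Basis. f i / (?l i + ?m i)) = (\<Prod>i\<in>Basis. f i) / ?S"
      by (simp add: prod_dividef)
    ultimately have "(\<Prod>i\<in>Basis. f i) powr (1 / ?N) / ?S powr (1 / ?N) \<le> (\<Sum>i\<in>Basis. f i / (?l i + ?m i)) / ?N"
      using Spos f by (simp add: powr_divide prod_nonneg less_imp_le sum_divide_distrib)
    moreover have "?S powr (1 / ?N) > 0" using Spos by (metis less_irrefl powr_gt_zero)
    ultimately show ?thesis using pos_divide_le_eq by blast
  qed
  have "(\<Sum>i\<in>Basis. ?l i / (?l i + ?m i)) + (\<Sum>i\<in>Basis. ?m i / (?l i + ?m i)) = (\<Sum>i\<in>(Basis::'a set). 1)"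
    unfolding sum.distrib[symmetric]
  proof (intro sum.cong refl)
    fix i :: 'a assume "i \<in> Basis"
    from lm[OF this] have "?l i + ?m i > 0" by linarith
    then show "?l i / (?l i + ?m i) + ?m i / (?l i + ?m i) = 1" by (simp add: add_divide_distrib[symmetric])
  qed
  then have one: "(\<Sum>i\<in>Basis. ?l i / (?l i + ?m i)) / ?N + (\<Sum>i\<in>Basis. ?m i / (?l i + ?m i)) / ?N = 1"
    by (simp add: add_divide_distrib[symmetric])
  have "measure lborel (box a b) powr (1/?N) + measure lborel (box c d) powr (1/?N) \<le> ?S powr (1/?N)"
  proof -
    have *: "x + y \<le> s" if "x \<le> p * s" "y \<le> q * s" "p + q = 1" for x y p q s :: real
      using add_mono[OF that(1,2)] that(3) by (simp add: distrib_right[symmetric])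
    show ?thesis unfolding cA cB by (rule *[OF am[of ?l, OF lm(1)] am[of ?m, OF lm(2)] one])
  qed
  then have "(measure lborel (box a b) powr (1/?N) + measure lborel (box c d) powr (1/?N)) powr ?N \<le> (?S powr (1/?N)) powr ?N"
    by (intro powr_mono2) auto
  also have "\<dots> = ?S" using Spos by (simp add: powr_powr)
  also have "\<dots> \<le> measure lborel (sumset (box a b) (box c d))"
    unfolding cS[symmetric] by (intro content_mono_bounded sub bounded_sumset borel_open open_sums) auto
  finally show ?thesis by (simp add: BM_ineq_def)
qed

section \<open>Finite families of disjoint open boxes\<close>

lemma box_Int_halfspace_lt:
  fixes a b :: "'a::euclidean_space"
  assumes "i \<in> Basis"
  shows "\<exists>a' b'. box a b \<inter> {x. x \<bullet> i < c} = box a' b'"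
proof -
  let ?b = "b + (min (b \<bullet> i) c - b \<bullet> i) *\<^sub>R i"
  have "?b \<bullet> j = (if j = i then min (b \<bullet> i) c else b \<bullet> j)" if "j \<in> Basis" for j
    using assms that by (auto simp: inner_add_left inner_Basis)
  then have "x \<in> box a ?b \<longleftrightarrow> x \<in> box a b \<inter> {x. x \<bullet> i < c}" for x
    using assms by (auto simp: mem_box split: if_splits)
  then have "box a b \<inter> {x. x \<bullet> i < c} = box a ?b" by blast
  then show ?thesis by blast
qed

lemma box_Int_halfspace_gt:
  fixes a b :: "'a::euclidean_space"
  assumes "i \<in> Basis"
  shows "\<exists>a' b'. box a b \<inter> {x. x \<bullet> i > c} = box a' b'"
proof -
  let ?a = "a + (max (a \<bullet> i) c - a \<bullet> i) *\<^sub>R i"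
  have "?a \<bullet> j = (if j = i then max (a \<bullet> i) c else a \<bullet> j)" if "j \<in> Basis" for j
    using assms that by (auto simp: inner_add_left inner_Basis)
  then have "x \<in> box ?a b \<longleftrightarrow> x \<in> box a b \<inter> {x. x \<bullet> i > c}" for x
    using assms by (auto simp: mem_box split: if_splits)
  then have "box a b \<inter> {x. x \<bullet> i > c} = box ?a b" by blast
  then show ?thesis by blast
qed

lemma content_pos_superset_box:
  fixes A :: "'a::euclidean_space set"
  assumes "box a b \<noteq> {}" "box a b \<subseteq> A" "open A" "bounded A"
  shows "measure lborel A > 0"
proof -
  have "0 < measure lborel (box a b)"
    using assms(1) by (subst measure_lborel_box_eq) (auto simp: box_ne_empty inner_diff_left less_imp_le intro!: prod_pos)
  also have "\<dots> \<le> measure lborel A" using assms by (intro content_mono_bounded) auto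
  finally show ?thesis .
qed

text \<open>The boxes are open so that intersecting with an open half-space gives open boxes again;
  the faces between them are lost, which costs only a null set.\<close>

definition box_family :: "'a::euclidean_space set set \<Rightarrow> bool" where
  "box_family \<D> \<longleftrightarrow> finite \<D> \<and> \<D> \<noteq> {} \<and> disjoint \<D> \<and> (\<forall>D\<in>\<D>. D \<noteq> {} \<and> (\<exists>a b. D = box a b))"

lemma box_familyE:
  assumes "box_family \<D>" "D \<in> \<D>"
  obtains a b where "D = box a b" "box a b \<noteq> {}"
  using assms unfolding box_family_def by metis

lemma box_family_open_bounded:
  assumes "box_family \<D>"
  shows "open (\<Union>\<D>)" "bounded (\<Union>\<D>)"
proof -
  have *: "open D \<and> bounded D" if "D \<in> \<D>" for D
    using assms that bounded_box open_box unfolding box_family_def by metis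
  then show "open (\<Union>\<D>)" by blast
  show "bounded (\<Union>\<D>)" using * assms by (intro bounded_Union) (auto simp: box_family_def)
qed

text \<open>\<open>Y\<close> misses \<open>H\<close> and drops out, which lowers the number of boxes
  for the induction; \<open>X\<close> meets \<open>H\<close> and keeps the new family
  nonempty.\<close>

lemma box_family_cut:
  assumes \<D>: "box_family \<D>" and X: "X \<in> \<D>" "X \<inter> H \<noteq> {}" and Y: "Y \<in> \<D>" "Y \<inter> H = {}"
    and H: "\<And>a b. \<exists>a' b'. box a b \<inter> H = box a' b'"
  obtains \<E> where "box_family \<E>" "\<Union>\<E> = \<Union>\<D> \<inter> H" "card \<E> < card \<D>"
proof
  let ?\<E> = "(\<lambda>D. D \<inter> H) ` (\<D> - {Y}) - {{}}"
  have fin: "finite \<D>" using \<D> by (simp add: box_family_def)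
  have "X \<noteq> Y" using X Y by auto
  then have "X \<inter> H \<in> ?\<E>" using X by auto
  then have "?\<E> \<noteq> {}" by blast
  moreover have "disjoint ?\<E>"
    using \<D> unfolding box_family_def disjoint_def by blast
  moreover have "\<exists>a b. D = box a b" if "D \<in> ?\<E>" for D
  proof -
    have "\<exists>D'\<in>\<D>. D = D' \<inter> H" using that by blast
    then obtain D' where D': "D' \<in> \<D>" "D = D' \<inter> H" by blast
    obtain a b where "D' = box a b" using box_familyE[OF \<D> D'(1)] by metis
    then show ?thesis using H[of a b] D' by simp
  qed
  ultimately show "box_family ?\<E>" using fin by (auto simp: box_family_def)
  show "\<Union>?\<E> = \<Union>\<D> \<inter> H" using Y by auto
  have "card ?\<E> \<le> card (\<D> - {Y})"
    using fin by (meson card_image_le card_mono finite_Diff finite_imageI Diff_subset order_trans)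
  also have "\<dots> < card \<D>" using fin Y by (intro card_Diff1_less) auto
  finally show "card ?\<E> < card \<D>" .
qed

text \<open>Induction on the number of boxes: two disjoint boxes are separated by a coordinate
  hyperplane, and cutting there leaves fewer boxes on each side. The class \<open>\<C>\<close> of
  second sets is a parameter because the argument runs twice, with single boxes and then with all
  bounded open sets of positive measure.\<close>

lemma BM_box_family:
  fixes \<D> :: "'a::euclidean_space set set" and \<C> :: "'a set set"
  assumes C: "\<And>B. B \<in> \<C> \<Longrightarrow> open B \<and> bounded B \<and> measure lborel B > 0"
    and cut_lt: "\<And>B i c. \<lbrakk>B \<in> \<C>; i \<in> Basis; measure lborel (B \<inter> {x. x \<bullet> i < c}) > 0\<rbrakk> \<Longrightarrow> B \<inter> {x. x \<bullet> i < c} \<in> \<C>"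
    and cut_gt: "\<And>B i c. \<lbrakk>B \<in> \<C>; i \<in> Basis; measure lborel (B \<inter> {x. x \<bullet> i > c}) > 0\<rbrakk> \<Longrightarrow> B \<inter> {x. x \<bullet> i > c} \<in> \<C>"
    and base: "\<And>a b B. \<lbrakk>box a b \<noteq> {}; B \<in> \<C>\<rbrakk> \<Longrightarrow> BM_ineq (box a b) B"
    and "box_family \<D>" "B \<in> \<C>"
  shows "BM_ineq (\<Union>\<D>) B"
  using assms(5,6)
proof (induction "card \<D>" arbitrary: \<D> B rule: less_induct)
  case less
  note \<D> = less.prems(1)
  show ?case
  proof (cases "\<exists>X\<in>\<D>. \<D> = {X}")
    case True
    then obtain X where X: "\<D> = {X}" by blast
    then have "X \<in> \<D>" by simp
    then obtain a b where "X = box a b" "box a b \<noteq> {}" using box_familyE[OF \<D>] by metis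
    then show ?thesis using X base less.prems by simp
  next
    case False
    then obtain X Y where XY: "X \<in> \<D>" "Y \<in> \<D>" "X \<noteq> Y"
      using \<D> unfolding box_family_def by blast
    obtain a b where X: "X = box a b" "box a b \<noteq> {}" using box_familyE[OF \<D> XY(1)] .
    obtain c d where Y: "Y = box c d" "box c d \<noteq> {}" using box_familyE[OF \<D> XY(2)] .
    have "box a b \<inter> box c d = {}" using \<D> XY X Y by (auto simp: box_family_def disjoint_def)
    then obtain i where i: "i \<in> Basis"
        "b \<bullet> i \<le> a \<bullet> i \<or> d \<bullet> i \<le> c \<bullet> i \<or> b \<bullet> i \<le> c \<bullet> i \<or> d \<bullet> i \<le> a \<bullet> i"
      unfolding disjoint_interval by blast
    have "a \<bullet> i < b \<bullet> i" "c \<bullet> i < d \<bullet> i" using X(2) Y(2) i(1) by (simp_all add: box_ne_empty)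
    then have i2: "b \<bullet> i \<le> c \<bullet> i \<or> d \<bullet> i \<le> a \<bullet> i" using i(2) by linarith
    \<comment> \<open>Renaming the two boxes by their side removes the case distinction: one lies
      below the level \<open>c0\<close>, the other above.\<close>
    have "\<exists>X Y c0. X \<in> \<D> \<and> Y \<in> \<D> \<and> X \<subseteq> {x. x \<bullet> i < c0} \<and> Y \<subseteq> {x. x \<bullet> i > c0}"
      using i2
    proof
      assume "b \<bullet> i \<le> c \<bullet> i"
      then have "X \<subseteq> {x. x \<bullet> i < b \<bullet> i}" "Y \<subseteq> {x. x \<bullet> i > b \<bullet> i}"
        using X Y i(1) by (force simp: mem_box)+
      then show ?thesis using XY by blast
    next
      assume "d \<bullet> i \<le> a \<bullet> i"
      then have "Y \<subseteq> {x. x \<bullet> i < d \<bullet> i}" "X \<subseteq> {x. x \<bullet> i > d \<bullet> i}"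
        using X Y i(1) by (force simp: mem_box)+
      then show ?thesis using XY by blast
    qed
    then obtain X' Y' c0 where XY': "X' \<in> \<D>" "Y' \<in> \<D>" "X' \<subseteq> {x. x \<bullet> i < c0}" "Y' \<subseteq> {x. x \<bullet> i > c0}" by blast
    have ne: "X' \<noteq> {}" "Y' \<noteq> {}" using XY' \<D> by (auto simp: box_family_def)
    obtain \<E>1 where E1: "box_family \<E>1" "\<Union>\<E>1 = \<Union>\<D> \<inter> {x. x \<bullet> i < c0}" "card \<E>1 < card \<D>"
    proof (rule box_family_cut[OF \<D> XY'(1) _ XY'(2)])
      show "X' \<inter> {x. x \<bullet> i < c0} \<noteq> {}" "Y' \<inter> {x. x \<bullet> i < c0} = {}" using ne XY' by force+
    qed (use box_Int_halfspace_lt[OF i(1)] in auto)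
    obtain \<E>2 where E2: "box_family \<E>2" "\<Union>\<E>2 = \<Union>\<D> \<inter> {x. x \<bullet> i > c0}" "card \<E>2 < card \<D>"
    proof (rule box_family_cut[OF \<D> XY'(2) _ XY'(1)])
      show "Y' \<inter> {x. x \<bullet> i > c0} \<noteq> {}" "X' \<inter> {x. x \<bullet> i > c0} = {}" using ne XY' by force+
    qed (use box_Int_halfspace_gt[OF i(1)] in auto)
    obtain a1 b1 where X1: "X' = box a1 b1" using box_familyE[OF \<D> XY'(1)] by metis
    obtain a2 b2 where Y1: "Y' = box a2 b2" using box_familyE[OF \<D> XY'(2)] by metis
    note ob = box_family_open_bounded[OF \<D>]
    have p1: "measure lborel (\<Union>\<D> \<inter> {x. x \<bullet> i < c0}) > 0"
      using XY' ne X1 box_family_open_bounded[OF E1(1)] unfolding E1(2)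
      by (intro content_pos_superset_box[of a1 b1]) auto
    have p2: "measure lborel (\<Union>\<D> \<inter> {x. x \<bullet> i > c0}) > 0"
      using XY' ne Y1 box_family_open_bounded[OF E2(1)] unfolding E2(2)
      by (intro content_pos_superset_box[of a2 b2]) auto
    show ?thesis
    proof (rule BM_split[OF ob _ _ i(1) p1 p2])
      show "open B" "bounded B" "0 < measure lborel B" using C[OF less.prems(2)] by auto
    next
      fix c' assume "0 < measure lborel (B \<inter> {x. x \<bullet> i < c'})" "0 < measure lborel (B \<inter> {x. x \<bullet> i > c'})"
      then have "B \<inter> {x. x \<bullet> i < c'} \<in> \<C>" "B \<inter> {x. x \<bullet> i > c'} \<in> \<C>"
        using cut_lt cut_gt less.prems(2) i by auto
      then show "BM_ineq (\<Union> \<D> \<inter> {x. x \<bullet> i < c0}) (B \<inter> {x. x \<bullet> i < c'}) \<and> BM_ineq (\<Union> \<D> \<inter> {x. x \<bullet> i > c0}) (B \<inter> {x. x \<bullet> i > c'})"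
        using less.hyps[OF E1(3,1)] less.hyps[OF E2(3,1)] E1(2) E2(2) by auto
    qed
  qed
qed

text \<open>An open set is a countable union of closed boxes, and finitely many of them exhaust the
  finite volume up to any error. A division of that finite union has non-overlapping interiors, and
  the discarded faces are null.\<close>

lemma open_inner_box_family:
  fixes A :: "'a::euclidean_space set"
  assumes A: "open A" "bounded A" and e: "e < measure lborel A" "0 \<le> e"
  obtains \<D> where "box_family \<D>" "\<Union>\<D> \<subseteq> A" "measure lborel (\<Union>\<D>) > e"
proof -
  obtain \<D>0 where D0: "countable \<D>0" "\<D>0 \<subseteq> Pow A" "\<And>X. X \<in> \<D>0 \<Longrightarrow> \<exists>a b. X = cbox a b" "\<Union>\<D>0 = A"
    using open_countable_Union_open_cbox[OF A(1)] by blast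
  have ne: "\<D>0 \<noteq> {}" using D0(4) e by auto
  define U where "U k = \<Union>(from_nat_into \<D>0 ` {..k})" for k
  have UA: "(\<Union>k. U k) = A"
  proof -
    have "(\<Union>k. U k) = \<Union>(range (from_nat_into \<D>0))" by (auto simp: U_def)
    then show ?thesis using range_from_nat_into[OF ne D0(1)] D0(4) by simp
  qed
  have Us: "U k \<in> sets lborel" for k
  proof -
    have "from_nat_into \<D>0 j \<in> sets lborel" for j
      using D0(3)[OF from_nat_into[OF ne, of j]] by auto
    then show ?thesis unfolding U_def by (intro sets.finite_Union) auto
  qed
  have "(\<lambda>k. measure lborel (U k)) \<longlonglongrightarrow> measure lborel (\<Union>k. U k)"
  proof (rule Lim_measure_incseq)
    show "range U \<subseteq> sets lborel" using Us by auto
    show "incseq U" unfolding U_def incseq_def by (intro allI impI Union_mono image_mono) auto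
    show "emeasure lborel (\<Union>k. U k) \<noteq> \<infinity>" using emeasure_bounded_open(2)[OF A] UA by (simp add: less_top)
  qed
  then have "eventually (\<lambda>k. measure lborel (U k) > e) sequentially"
    using e UA by (intro order_tendstoD(1)) auto
  then obtain k where k: "measure lborel (U k) > e" by (auto simp: eventually_sequentially)
  obtain p where p: "p division_of (U k)"
    unfolding U_def
    by (rule elementary_unions_intervals[of "from_nat_into \<D>0 ` {..k}"]) (use D0(3) from_nat_into[OF ne] in auto)
  let ?q = "interior ` p - {{}}"
  have op: "open (\<Union>?q)" by auto
  have qp: "\<Union>?q \<subseteq> U k" using division_ofD(2)[OF p] interior_subset by blast
  have UkA: "U k \<subseteq> A" using UA by auto
  have null: "(\<Union>K\<in>p. K - interior K) \<in> null_sets lborel"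
  proof (rule null_sets.finite_UN)
    show "finite p" using p by auto
    fix K assume "K \<in> p"
    then obtain a b where K: "K = cbox a b" using p by blast
    have "cbox a b - box a b \<in> sets lborel" by simp
    then show "K - interior K \<in> null_sets lborel"
      using negligible_frontier_interval[of a b] K
      by (simp add: interior_cbox negligible_iff_null_sets null_sets_completion_iff)
  qed
  have "e < measure lborel (U k - (\<Union>K\<in>p. K - interior K))"
    using k measure_Diff_null_set[OF Us null] by simp
  also have "\<dots> \<le> measure lborel (\<Union>?q)"
  proof (rule content_mono_bounded)
    have "U k = \<Union>p" using p by (simp add: division_of_def)
    then show "U k - (\<Union>K\<in>p. K - interior K) \<subseteq> \<Union>?q" by auto
    show "U k - (\<Union>K\<in>p. K - interior K) \<in> sets borel"
      using sets.Diff[OF Us null_setsD2[OF null]] by simp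
    show "\<Union>?q \<in> sets borel" using op by simp
    show "bounded (\<Union>?q)" using qp UkA A(2) bounded_subset by blast
  qed
  finally have big: "e < measure lborel (\<Union>?q)" .
  have "box_family ?q"
    unfolding box_family_def
  proof (intro conjI ballI)
    show "finite ?q" using division_of_finite[OF p] by simp
    show "?q \<noteq> {}"
    proof
      assume "?q = {}"
      then show False using big e by (metis Union_empty measure_empty not_less)
    qed
    show "disjoint ?q"
      unfolding disjoint_def
    proof (intro ballI impI)
      fix X Y assume "X \<in> ?q" "Y \<in> ?q" "X \<noteq> Y"
      then obtain K L where "K \<in> p" "L \<in> p" "X = interior K" "Y = interior L" "K \<noteq> L" by blast
      then show "X \<inter> Y = {}" using division_ofD(5)[OF p] by simp
    qed
    show "D \<noteq> {}" if "D \<in> ?q" for D using that by blast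
    show "\<exists>a b. D = box a b" if "D \<in> ?q" for D
    proof -
      have "\<exists>K\<in>p. D = interior K" using that by blast
      then obtain K where "K \<in> p" "D = interior K" by blast
      then show ?thesis using p interior_cbox by (metis division_ofD(4))
    qed
  qed
  then show ?thesis using that big qp UkA by (meson order_trans)
qed

text \<open>Inner approximation of \<open>A\<close> by box families: the left side is continuous in
  the volume of the first set, and the sumset is monotone in it.\<close>

lemma BM_approx:
  fixes A B :: "'a::euclidean_space set"
  assumes A: "open A" "bounded A" "measure lborel A > 0" and B: "open B" "bounded B" "measure lborel B > 0"
    and bm: "\<And>\<D>. box_family \<D> \<Longrightarrow> BM_ineq (\<Union>\<D>) B"
  shows "BM_ineq A B"
proof -
  \<comment> \<open>With \<open>Suc k\<close> the bounds start at 0, since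
    \<open>open_inner_box_family\<close> asks for a nonnegative bound, and stay strictly below the
    volume of \<open>A\<close>.\<close>
  define e where "e k = measure lborel A * (1 - 1 / Suc k)" for k
  have e: "e k < measure lborel A" "0 \<le> e k" for k using A(3) by (auto simp: e_def)
  then have "\<exists>\<D>. box_family \<D> \<and> \<Union>\<D> \<subseteq> A \<and> measure lborel (\<Union>\<D>) > e k" for k
    by (meson open_inner_box_family A)
  then obtain \<D> where D: "\<And>k. box_family (\<D> k)" "\<And>k. \<Union>(\<D> k) \<subseteq> A" "\<And>k. measure lborel (\<Union>(\<D> k)) > e k" by metis
  let ?N = "real DIM('a)"
  have up: "measure lborel (\<Union>(\<D> k)) \<le> measure lborel A" for k
    using D A box_family_open_bounded[OF D(1)] by (intro content_mono_bounded) auto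
  have "(\<lambda>k. 1 - 1 / real (Suc k)) \<longlonglongrightarrow> 1 - 0"
    by (intro tendsto_diff tendsto_const LIMSEQ_Suc[OF lim_const_over_n[of 1, simplified]])
  then have "e \<longlonglongrightarrow> measure lborel A * (1 - 0)" unfolding e_def by (intro tendsto_mult_left)
  then have elim: "e \<longlonglongrightarrow> measure lborel A" by simp
  have lim: "(\<lambda>k. measure lborel (\<Union>(\<D> k))) \<longlonglongrightarrow> measure lborel A"
    by (rule tendsto_sandwich[OF _ _ elim tendsto_const]) (simp_all add: less_imp_le[OF D(3)] up)
  have "(\<lambda>k. (measure lborel (\<Union>(\<D> k)) powr (1/?N) + measure lborel B powr (1/?N)) powr ?N)
     \<longlonglongrightarrow> (measure lborel A powr (1/?N) + measure lborel B powr (1/?N)) powr ?N"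
    by (intro tendsto_powr tendsto_add lim tendsto_const) (use A B in \<open>simp_all add: add_pos_pos less_imp_neq[THEN not_sym]\<close>)
  moreover have "(measure lborel (\<Union>(\<D> k)) powr (1/?N) + measure lborel B powr (1/?N)) powr ?N \<le> measure lborel (sumset A B)" for k
  proof -
    have "(measure lborel (\<Union>(\<D> k)) powr (1/?N) + measure lborel B powr (1/?N)) powr ?N \<le> measure lborel (sumset (\<Union>(\<D> k)) B)"
      using bm[OF D(1)[of k]] by (simp add: BM_ineq_def)
    also have "\<dots> \<le> measure lborel (sumset A B)"
    proof (rule content_mono_bounded)
      show "sumset (\<Union>(\<D> k)) B \<subseteq> sumset A B" using D(2)[of k] by blast
      show "sumset (\<Union>(\<D> k)) B \<in> sets borel" "sumset A B \<in> sets borel"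
        by (rule borel_open, rule open_sums, simp add: B)+
      show "bounded (sumset A B)" using A B by (intro bounded_sumset)
    qed
    finally show ?thesis .
  qed
  ultimately show ?thesis unfolding BM_ineq_def by (intro LIMSEQ_le_const2) auto
qed

text \<open>Two rounds of the same argument: box families against boxes give, after approximation,
  open sets against boxes. Exchanging the two sets turns this into the base case for box families
  against open sets, and a second approximation finishes.\<close>

theorem brunn_minkowski:
  fixes A B :: "'a::euclidean_space set"
  assumes "open A" "bounded A" "measure lborel A > 0" "open B" "bounded B" "measure lborel B > 0"
  shows "BM_ineq A B"
proof -
  define \<B> where "\<B> = {X :: 'a set. X \<noteq> {} \<and> (\<exists>a b. X = box a b)}"
  have Bp: "open X \<and> bounded X \<and> measure lborel X > 0" if X: "X \<in> \<B>" for X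
  proof -
    obtain a b where "X = box a b" "box a b \<noteq> {}" using X by (auto simp: \<B>_def)
    then show ?thesis using content_pos_superset_box[of a b X] open_box[of a b] bounded_box[of a b] by simp
  qed
  have 1: "BM_ineq (\<Union>\<D>) X" if D: "box_family \<D>" and X: "X \<in> \<B>" for \<D> X
  proof (rule BM_box_family[OF Bp _ _ _ D X])
    fix Y i c assume Y: "Y \<in> \<B>" "i \<in> (Basis :: 'a set)"
    then obtain a b where ab: "Y = box a b" by (auto simp: \<B>_def)
    have ne: "S \<noteq> {}" if "0 < measure lborel S" for S :: "'a set" using that by auto
    show "Y \<inter> {x. x \<bullet> i < c} \<in> \<B>" if "0 < measure lborel (Y \<inter> {x. x \<bullet> i < c})"
      using ne[OF that] box_Int_halfspace_lt[OF Y(2), of a b c] unfolding ab \<B>_def by blast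
    show "Y \<inter> {x. x \<bullet> i > c} \<in> \<B>" if "0 < measure lborel (Y \<inter> {x. x \<bullet> i > c})"
      using ne[OF that] box_Int_halfspace_gt[OF Y(2), of a b c] unfolding ab \<B>_def by blast
  qed (auto simp: \<B>_def intro: BM_box_box)
  have BMs: "BM_ineq Y X" if "BM_ineq X Y" for X Y :: "'a set"
    using that by (simp add: BM_ineq_def add.commute sumset_commute[of Y X])
  define \<C> where "\<C> = {X :: 'a set. open X \<and> bounded X \<and> measure lborel X > 0}"
  have 2: "BM_ineq (\<Union>\<D>) X" if D: "box_family \<D>" and X: "X \<in> \<C>" for \<D> X
  proof (rule BM_box_family[OF _ _ _ _ D X])
    fix a b :: 'a and Y assume ab: "box a b \<noteq> {}" "Y \<in> \<C>"
    have "box a b \<in> \<B>" using ab by (auto simp: \<B>_def)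
    moreover have Y: "open Y" "bounded Y" "measure lborel Y > 0" using ab(2) by (simp_all add: \<C>_def)
    ultimately have "BM_ineq Y (box a b)" using Bp 1 by (intro BM_approx[OF Y]) blast+
    then show "BM_ineq (box a b) Y" by (rule BMs)
  next
    show "\<And>B. B \<in> \<C> \<Longrightarrow> open B \<and> bounded B \<and> 0 < measure lborel B" by (simp add: \<C>_def)
    show "\<And>B i c. \<lbrakk>B \<in> \<C>; i \<in> Basis; 0 < measure lborel (B \<inter> {x. x \<bullet> i < c})\<rbrakk> \<Longrightarrow> B \<inter> {x. x \<bullet> i < c} \<in> \<C>"
      by (simp add: \<C>_def open_Int open_halfspace_component_lt bounded_Int)
    show "\<And>B i c. \<lbrakk>B \<in> \<C>; i \<in> Basis; 0 < measure lborel (B \<inter> {x. x \<bullet> i > c})\<rbrakk> \<Longrightarrow> B \<inter> {x. x \<bullet> i > c} \<in> \<C>"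
      by (simp add: \<C>_def open_Int open_halfspace_component_gt bounded_Int)
  qed
  have "B \<in> \<C>" using assms by (simp add: \<C>_def)
  then show ?thesis using 2 by (intro BM_approx[OF assms]) blast
qed

section \<open>Continuously differentiable maps, divergence and convolution\<close>

text \<open>The derivative is an explicit argument so that the rules for products, translations and
  convolutions can compute it; continuity is asked in every fixed direction, as in
  \<open>C1_compact_support\<close>.\<close>

definition C1 :: "('a::euclidean_space \<Rightarrow> 'b::euclidean_space) \<Rightarrow> ('a \<Rightarrow> 'a \<Rightarrow> 'b) \<Rightarrow> bool" where
  "C1 f f' \<longleftrightarrow> (\<forall>x. (f has_derivative f' x) (at x)) \<and> (\<forall>v. continuous_on UNIV (\<lambda>x. f' x v))"

definition vanishes_outside :: "real \<Rightarrow> ('a::euclidean_space \<Rightarrow> 'b::zero) \<Rightarrow> bool" where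
  "vanishes_outside R f \<longleftrightarrow> (\<forall>x. R < norm x \<longrightarrow> f x = 0)"

lemma C1_D:
  assumes "C1 f f'"
  shows "(f has_derivative f' x) (at x)" "continuous_on UNIV (\<lambda>x. f' x v)" "linear (f' x)"
proof -
  show 1: "(f has_derivative f' x) (at x)" using assms by (simp add: C1_def)
  show "continuous_on UNIV (\<lambda>x. f' x v)" using assms by (simp add: C1_def)
  show "linear (f' x)" using 1 by (rule has_derivative_linear)
qed

lemma C1_continuous: "C1 f f' \<Longrightarrow> continuous_on UNIV f"
  by (meson C1_D(1) continuous_at_imp_continuous_on has_derivative_continuous)

lemma C1_vanishes_deriv:
  assumes "C1 f f'" "vanishes_outside R f"
  shows "vanishes_outside R (\<lambda>x. f' x v)"
  unfolding vanishes_outside_def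
proof (intro allI impI)
  fix x :: 'a assume x: "R < norm x"
  have op: "open {x::'a. R < norm x}" by (intro open_Collect_less continuous_intros)
  have "((\<lambda>_. 0) has_derivative f' x) (at x)"
    by (rule has_derivative_transform_within_open[OF C1_D(1)[OF assms(1)] op])
      (use x assms(2) in \<open>auto simp: vanishes_outside_def\<close>)
  then have "f' x = (\<lambda>_. 0)" by (metis has_derivative_const has_derivative_unique)
  then show "f' x v = 0" by simp
qed

lemma vanishing_bounded:
  fixes f :: "'a::euclidean_space \<Rightarrow> 'b::euclidean_space"
  assumes "continuous_on UNIV f" "vanishes_outside R f"
  obtains B where "B > 0" "\<And>x. norm (f x) \<le> B"
proof -
  have "compact (f ` cball 0 R)"
    using assms(1) by (intro compact_continuous_image) (auto intro: continuous_on_subset)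
  then obtain B where B: "B > 0" "\<And>x. x \<in> cball 0 R \<Longrightarrow> norm (f x) \<le> B"
    using bounded_pos compact_imp_bounded by (metis imageI)
  have "norm (f x) \<le> B" for x
  proof (cases "x \<in> cball 0 R")
    case False
    then show ?thesis using assms(2) B(1) by (simp add: vanishes_outside_def)
  qed (use B in auto)
  then show ?thesis using that B(1) by blast
qed

lemma integrable_indicator_cball [simp]:
  "integrable lborel (indicator (cball (x::'a::euclidean_space) R) :: 'a \<Rightarrow> real)"
  using emeasure_bounded_finite[of "cball x R"] by (simp add: integrable_indicator_iff)

lemma integrable_vanishing:
  fixes f :: "'a::euclidean_space \<Rightarrow> 'b::euclidean_space"
  assumes "f \<in> borel_measurable borel" "\<And>x. norm (f x) \<le> B" "vanishes_outside R f"
  shows "integrable lborel f"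
proof (rule Bochner_Integration.integrable_bound)
  show "integrable lborel (\<lambda>x. B * indicator (cball 0 R) x :: real)"
    by (intro integrable_mult_right integrable_indicator_cball)
  show "f \<in> borel_measurable lborel" using assms(1) by simp
  have "norm (f x) \<le> norm (B * indicator (cball 0 R) x :: real)" for x
  proof (cases "x \<in> cball 0 R")
    case True then show ?thesis using assms(2)[of x] by simp
  next
    case False then show ?thesis using assms(3) by (simp add: vanishes_outside_def)
  qed
  then show "AE x in lborel. norm (f x) \<le> norm (B * indicator (cball 0 R) x :: real)" by simp
qed

lemma integrable_continuous_vanishing:
  fixes f :: "'a::euclidean_space \<Rightarrow> 'b::euclidean_space"
  assumes "continuous_on UNIV f" "vanishes_outside R f"
  shows "integrable lborel f"
proof -
  obtain B where "\<And>x. norm (f x) \<le> B" using vanishing_bounded[OF assms] by metis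
  then show ?thesis using assms by (intro integrable_vanishing borel_measurable_continuous_onI)
qed

lemma integral_translate:
  fixes f :: "'a::euclidean_space \<Rightarrow> 'b::euclidean_space"
  assumes "f \<in> borel_measurable borel"
  shows "(\<integral>x. f (a + x) \<partial>lborel) = (\<integral>x. f x \<partial>lborel)"
proof -
  have "(\<integral>x. f x \<partial>lborel) = (\<integral>x. f x \<partial>(distr lborel borel ((+) a)))"
    by (simp add: lborel_distr_plus)
  also have "\<dots> = (\<integral>x. f (a + x) \<partial>lborel)"
    using assms by (intro integral_distr) auto
  finally show ?thesis by simp
qed

lemma integral_reflect:
  fixes f :: "'a::euclidean_space \<Rightarrow> 'b::euclidean_space"
  assumes "f \<in> borel_measurable borel"
  shows "(\<integral>x. f (a - x) \<partial>lborel) = (\<integral>x. f x \<partial>lborel)"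
proof -
  have *: "(lborel :: 'a measure) = distr lborel borel (\<lambda>x::'a. a - x)"
    using lborel_affine[of "-1" a] by (simp add: density_1)
  have "(\<integral>x. f x \<partial>lborel) = (\<integral>x. f x \<partial>(distr lborel borel (\<lambda>x::'a. a - x)))"
    using * by simp
  also have "\<dots> = (\<integral>x. f (a - x) \<partial>lborel)"
    using assms by (intro integral_distr) auto
  finally show ?thesis by simp
qed

lemma C1_deriv_bounded:
  assumes "C1 f f'" "vanishes_outside R f"
  obtains L where "L > 0" "\<And>x h. norm (f' x h) \<le> L * norm h"
proof -
  have "\<exists>B. B > 0 \<and> (\<forall>x. norm (f' x b) \<le> B)" for b
    using vanishing_bounded[OF C1_D(2)[OF assms(1)] C1_vanishes_deriv[OF assms]] by metis
  then obtain B where B: "\<And>b. B b > 0" "\<And>b x. norm (f' x b) \<le> B b" by metis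
  have "norm (f' x h) \<le> (\<Sum>b\<in>Basis. B b) * norm h" for x h
  proof -
    have "f' x h = f' x (\<Sum>b\<in>Basis. (h \<bullet> b) *\<^sub>R b)" by (simp add: euclidean_representation)
    also have "\<dots> = (\<Sum>b\<in>Basis. (h \<bullet> b) *\<^sub>R f' x b)"
      using C1_D(3)[OF assms(1)] by (simp add: linear_sum linear_scale)
    also have "norm \<dots> \<le> (\<Sum>b\<in>Basis. norm ((h \<bullet> b) *\<^sub>R f' x b))" by (rule norm_sum)
    also have "\<dots> \<le> (\<Sum>b\<in>Basis. B b * norm h)"
    proof (rule sum_mono)
      fix b :: 'a assume "b \<in> Basis"
      then have "\<bar>h \<bullet> b\<bar> \<le> norm h" by (rule Basis_le_norm)
      then have "\<bar>h \<bullet> b\<bar> * norm (f' x b) \<le> norm h * B b"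
        using B(2)[where b=b and x=x] by (intro mult_mono) auto
      then show "norm ((h \<bullet> b) *\<^sub>R f' x b) \<le> B b * norm h" by (simp add: mult.commute)
    qed
    finally show ?thesis by (simp add: sum_distrib_right)
  qed
  moreover have "(\<Sum>b\<in>(Basis::'a set). B b) > 0" using B(1) by (intro sum_pos) auto
  ultimately show ?thesis using that by blast
qed

lemma C1_lipschitz:
  assumes "C1 f f'" "\<And>x h. norm (f' x h) \<le> L * norm h"
  shows "norm (f y - f x) \<le> L * norm (y - x)"
proof (rule differentiable_bound[where S=UNIV and f'=f'])
  show "(f has_derivative f' x) (at x within UNIV)" for x using C1_D(1)[OF assms(1)] by simp
  show "onorm (f' x) \<le> L" for x using assms(2) by (intro onorm_le)
qed auto

text \<open>Translation invariance makes the integral of every difference quotient zero, and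
  dominated convergence passes to the derivative. This is the divergence theorem on which the later
  integrations by parts rest.\<close>

lemma integral_directional_derivative:
  fixes g :: "'a::euclidean_space \<Rightarrow> real"
  assumes g: "C1 g g'" "vanishes_outside R g"
  shows "(\<integral>x. g' x v \<partial>lborel) = 0"
proof -
  obtain L where L: "L > 0" "\<And>x h. norm (g' x h) \<le> L * norm h"
    using C1_deriv_bounded[OF g] by metis
  define t where "t k = 1 / real (Suc k)" for k
  \<comment> \<open>Steps of length at most 1 keep all difference quotients supported in one ball of
    radius \<open>R + norm v\<close>.\<close>
  have t: "t k > 0" "t k \<le> 1" for k by (auto simp: t_def)
  have tlim: "t \<longlonglongrightarrow> 0" unfolding t_def by (rule LIMSEQ_Suc[OF lim_const_over_n])
  define q where "q k x = (g (t k *\<^sub>R v + x) - g x) / t k" for k x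
  have gm: "g \<in> borel_measurable borel" using C1_continuous[OF g(1)] by (intro borel_measurable_continuous_onI)
  have gi: "integrable lborel g" using C1_continuous[OF g(1)] g(2) by (rule integrable_continuous_vanishing)
  have "(\<lambda>k. \<integral>x. q k x \<partial>lborel) \<longlonglongrightarrow> (\<integral>x. g' x v \<partial>lborel)"
  proof (rule integral_dominated_convergence[where w="\<lambda>x. L * norm v * indicator (cball 0 (R + norm v)) x"])
    show "(\<lambda>x. g' x v) \<in> borel_measurable lborel"
      using borel_measurable_continuous_onI[OF C1_D(2)[OF g(1), of v]] by simp
    show "q k \<in> borel_measurable lborel" for k unfolding q_def using gm by measurable
    show "integrable lborel (\<lambda>x. L * norm v * indicator (cball 0 (R + norm v)) x)"
      by (intro integrable_mult_right integrable_indicator_cball)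
    show "AE x in lborel. (\<lambda>k. q k x) \<longlonglongrightarrow> g' x v"
    proof (rule AE_I2)
      fix x
      have "((\<lambda>s. g (s *\<^sub>R v + x)) has_derivative (\<lambda>s. g' x (s *\<^sub>R v))) (at 0)"
        by (rule has_derivative_compose[where g=g and f="\<lambda>s. s *\<^sub>R v + x"])
          (auto intro!: derivative_eq_intros simp: C1_D(1)[OF g(1)])
      moreover have "(\<lambda>s. g' x (s *\<^sub>R v)) = (\<lambda>s. g' x v * s)"
        using C1_D(3)[OF g(1)] by (simp add: linear_scale mult.commute)
      ultimately have "DERIV (\<lambda>s. g (s *\<^sub>R v + x)) 0 :> g' x v"
        by (simp add: has_field_derivative_def)
      then have "((\<lambda>h. (g (h *\<^sub>R v + x) - g x) / h) \<longlongrightarrow> g' x v) (at 0)"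
        by (simp add: DERIV_def)
      moreover have "filterlim t (at 0) sequentially"
        using tlim t(1) by (simp add: filterlim_at less_imp_neq[THEN not_sym])
      ultimately show "(\<lambda>k. q k x) \<longlonglongrightarrow> g' x v"
        unfolding q_def by (rule filterlim_compose)
    qed
    show "AE x in lborel. norm (q k x) \<le> L * norm v * indicator (cball 0 (R + norm v)) x" for k
    proof (rule AE_I2)
      fix x
      show "norm (q k x) \<le> L * norm v * indicator (cball 0 (R + norm v)) x"
      proof (cases "x \<in> cball 0 (R + norm v)")
        case True
        have "norm (g (t k *\<^sub>R v + x) - g x) \<le> L * norm (t k *\<^sub>R v + x - x)"
          by (rule C1_lipschitz[OF g(1) L(2)])
        then show ?thesis using True t(1)[of k] by (simp add: q_def field_simps)
      next
        case False
        then have "R + norm v < norm x" by simp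
        moreover have "norm (t k *\<^sub>R v) \<le> norm v" using t[of k] by (simp add: mult_left_le_one_le)
        moreover have "norm x \<le> norm (t k *\<^sub>R v + x) + norm (t k *\<^sub>R v)"
          by (metis add_diff_cancel_left' norm_triangle_ineq4)
        ultimately have "R < norm (t k *\<^sub>R v + x)" "R < norm x" using norm_ge_zero[of v] by linarith+
        then show ?thesis using g(2) False by (simp add: q_def vanishes_outside_def)
      qed
    qed
  qed
  moreover have "(\<integral>x. q k x \<partial>lborel) = 0" for k
  proof -
    have gi': "integrable lborel (\<lambda>x. g (t k *\<^sub>R v + x))"
    proof (rule integrable_continuous_vanishing)
      show "continuous_on UNIV (\<lambda>x. g (t k *\<^sub>R v + x))"
        by (rule continuous_on_compose2[OF C1_continuous[OF g(1)]]) (auto intro!: continuous_intros)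
      show "vanishes_outside (R + norm (t k *\<^sub>R v)) (\<lambda>x. g (t k *\<^sub>R v + x))"
        unfolding vanishes_outside_def
      proof (intro allI impI)
        fix x :: 'a assume "R + norm (t k *\<^sub>R v) < norm x"
        moreover have "norm x \<le> norm (t k *\<^sub>R v + x) + norm (t k *\<^sub>R v)"
          by (metis add_diff_cancel_left' norm_triangle_ineq4)
        ultimately show "g (t k *\<^sub>R v + x) = 0" using g(2) by (simp add: vanishes_outside_def)
      qed
    qed
    show ?thesis unfolding q_def using gi gi' integral_translate[OF gm, of "t k *\<^sub>R v"] by simp
  qed
  ultimately show ?thesis using LIMSEQ_unique[OF _ tendsto_const[of "0::real"]] by simp
qed

section \<open>Test fields and their divergence\<close>

lemma C1_compact_supportI:
  assumes "C1 \<phi> D" "vanishes_outside R \<phi>"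
  shows "C1_compact_support \<phi>"
proof -
  have fd: "frechet_derivative \<phi> (at x) = D x" for x
    using frechet_derivative_at[OF C1_D(1)[OF assms(1)]] by simp
  have "closure {x. \<phi> x \<noteq> 0} \<subseteq> cball 0 R"
    using assms(2) by (intro closure_minimal) (force simp: vanishes_outside_def)+
  then have "compact (closure {x. \<phi> x \<noteq> 0})"
    by (meson bounded_cball bounded_subset closed_closure compact_eq_bounded_closed)
  moreover have "\<phi> differentiable_on UNIV"
    using C1_D(1)[OF assms(1)] by (auto simp: differentiable_on_def differentiable_def)
  ultimately show ?thesis using C1_D(2)[OF assms(1)] by (simp add: C1_compact_support_def fd)
qed

lemma C1_compact_supportE:
  assumes "C1_compact_support \<phi>"
  obtains D R where "C1 \<phi> D" "vanishes_outside R \<phi>" "R > 0"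
proof -
  have "C1 \<phi> (\<lambda>x. frechet_derivative \<phi> (at x))"
    using assms by (auto simp: C1_compact_support_def C1_def differentiable_on_def frechet_derivative_works)
  moreover obtain R where R: "R > 0" "\<And>x. x \<in> closure {x. \<phi> x \<noteq> 0} \<Longrightarrow> norm x \<le> R"
    using assms compact_imp_bounded bounded_pos unfolding C1_compact_support_def by metis
  have "vanishes_outside R \<phi>"
    using R(2) closure_subset[of "{x. \<phi> x \<noteq> 0}"] by (force simp: vanishes_outside_def)
  ultimately show ?thesis using that R(1) by blast
qed

lemma divergence_C1:
  assumes "C1 \<phi> D"
  shows "divergence \<phi> x = (\<Sum>b\<in>Basis. D x b \<bullet> b)"
  using frechet_derivative_at[OF C1_D(1)[OF assms], of x] by (simp add: divergence_def)

lemma divergence_continuous: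
  assumes "C1 \<phi> D"
  shows "continuous_on UNIV (divergence \<phi>)"
proof -
  have "divergence \<phi> = (\<lambda>x. \<Sum>b\<in>Basis. D x b \<bullet> b)" using divergence_C1[OF assms] by auto
  then show ?thesis using C1_D(2)[OF assms] by (auto intro!: continuous_intros)
qed

lemma divergence_vanishes:
  assumes "C1 \<phi> D" "vanishes_outside R \<phi>"
  shows "vanishes_outside R (divergence \<phi>)"
  using C1_vanishes_deriv[OF assms] divergence_C1[OF assms(1)] by (simp add: vanishes_outside_def)

lemma divergence_bounded:
  assumes "C1_compact_support \<phi>"
  obtains B where "B > 0" "\<And>x. norm (divergence \<phi> x) \<le> B"
proof -
  obtain D R where D: "C1 \<phi> D" "vanishes_outside R \<phi>" using C1_compact_supportE[OF assms] by metis
  show ?thesis using vanishing_bounded[OF divergence_continuous[OF D(1)] divergence_vanishes[OF D]] that by metis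
qed

lemma divergence_measurable [measurable]:
  assumes "C1_compact_support \<phi>"
  shows "divergence \<phi> \<in> borel_measurable borel"
proof -
  obtain D R where D: "C1 \<phi> D" using C1_compact_supportE[OF assms] by metis
  show ?thesis using borel_measurable_continuous_onI[OF divergence_continuous[OF D]] .
qed

lemma divergence_integrable:
  assumes "C1_compact_support \<phi>"
  shows "integrable lborel (divergence \<phi>)"
proof -
  obtain D R where D: "C1 \<phi> D" "vanishes_outside R \<phi>" using C1_compact_supportE[OF assms] by metis
  show ?thesis using integrable_continuous_vanishing[OF divergence_continuous[OF D(1)] divergence_vanishes[OF D]] .
qed

lemma integral_divergence:
  assumes "C1_compact_support \<phi>"
  shows "(\<integral>x. divergence \<phi> x \<partial>lborel) = 0"
proof -
  obtain D R where D: "C1 \<phi> D" "vanishes_outside R \<phi>" using C1_compact_supportE[OF assms] by metis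
  have c: "C1 (\<lambda>x. \<phi> x \<bullet> b) (\<lambda>x v. D x v \<bullet> b)" for b
    using D(1) by (auto simp: C1_def intro!: derivative_intros continuous_intros)
  have v: "vanishes_outside R (\<lambda>x. \<phi> x \<bullet> b)" for b
    using D(2) by (simp add: vanishes_outside_def)
  have i: "integrable lborel (\<lambda>x. D x b \<bullet> b)" for b
    using C1_D(2)[OF c] C1_vanishes_deriv[OF c v] by (rule integrable_continuous_vanishing)
  show ?thesis
    using integral_directional_derivative[OF c v] i by (simp add: divergence_C1[OF D(1)])
qed

lemma C1_scaleR:
  assumes "C1 \<eta> \<eta>'" "C1 \<phi> D"
  shows "C1 (\<lambda>x. \<eta> x *\<^sub>R \<phi> x) (\<lambda>x v. \<eta> x *\<^sub>R D x v + \<eta>' x v *\<^sub>R \<phi> x)"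
proof -
  have "continuous_on UNIV \<eta>" "continuous_on UNIV \<phi>" using assms C1_continuous by auto
  then show ?thesis
    using assms unfolding C1_def by (auto intro!: derivative_eq_intros continuous_intros)
qed

lemma divergence_scaleR:
  assumes "C1 \<eta> (\<lambda>x v. G x \<bullet> v)" "C1 \<phi> D"
  shows "divergence (\<lambda>x. \<eta> x *\<^sub>R \<phi> x) x = \<eta> x * divergence \<phi> x + G x \<bullet> \<phi> x"
  unfolding divergence_C1[OF C1_scaleR[OF assms]] divergence_C1[OF assms(2)]
  using euclidean_inner[of "G x" "\<phi> x"] by (simp add: inner_add_left sum.distrib sum_distrib_left)

lemma vanishes_outside_scaleR:
  "vanishes_outside R \<phi> \<Longrightarrow> vanishes_outside R (\<lambda>x. \<eta> x *\<^sub>R \<phi> x)" for \<phi> :: "'a::euclidean_space \<Rightarrow> 'b::real_vector"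
  by (simp add: vanishes_outside_def)

lemma C1_translate:
  assumes "C1 \<phi> D"
  shows "C1 (\<lambda>x. \<phi> (x + a)) (\<lambda>x. D (x + a))"
proof -
  have "((\<lambda>x. \<phi> (x + a)) has_derivative D (x + a)) (at x)" for x
    by (rule has_derivative_compose[where f="\<lambda>x. x + a" and g=\<phi> and f'="\<lambda>h. h"])
      (auto intro!: derivative_eq_intros simp: C1_D(1)[OF assms])
  moreover have "continuous_on UNIV (\<lambda>x. D (x + a) v)" for v
    by (rule continuous_on_compose2[OF C1_D(2)[OF assms]]) (auto intro!: continuous_intros)
  ultimately show ?thesis by (auto simp: C1_def)
qed

lemma C1_compact_support_translate:
  assumes "C1_compact_support \<phi>"
  shows "C1_compact_support (\<lambda>x. \<phi> (x + a))" "divergence (\<lambda>x. \<phi> (x + a)) x = divergence \<phi> (x + a)"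
proof -
  obtain D R where D: "C1 \<phi> D" "vanishes_outside R \<phi>" using C1_compact_supportE[OF assms] by metis
  have "vanishes_outside (R + norm a) (\<lambda>x. \<phi> (x + a))"
    unfolding vanishes_outside_def
  proof (intro allI impI)
    fix x :: 'a assume "R + norm a < norm x"
    moreover have "norm x \<le> norm (x + a) + norm a" by (metis add_diff_cancel_right' norm_triangle_ineq4)
    ultimately show "\<phi> (x + a) = 0" using D(2) by (simp add: vanishes_outside_def)
  qed
  then show "C1_compact_support (\<lambda>x. \<phi> (x + a))" using C1_translate[OF D(1)] C1_compact_supportI by blast
  show "divergence (\<lambda>x. \<phi> (x + a)) x = divergence \<phi> (x + a)"
    by (simp add: divergence_C1[OF D(1)] divergence_C1[OF C1_translate[OF D(1)]])
qed

text \<open>The kernel may be vector valued: a mollifier as \<open>K\<close> gives the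
  mollification, and the gradient field of the mollifier gives the gradient of the
  mollification.\<close>

definition conv :: "('a::euclidean_space \<Rightarrow> real) \<Rightarrow> ('a \<Rightarrow> 'b::euclidean_space) \<Rightarrow> 'a \<Rightarrow> 'b" where
  "conv u K x = (\<integral>y. u y *\<^sub>R K (x - y) \<partial>lborel)"

lemma conv_integrable:
  fixes K :: "'a::euclidean_space \<Rightarrow> 'b::euclidean_space"
  assumes u: "u \<in> borel_measurable borel" "\<And>x. \<bar>u x\<bar> \<le> 1"
    and K: "continuous_on UNIV K" "vanishes_outside R K"
  shows "integrable lborel (\<lambda>y. u y *\<^sub>R K (x - y))"
proof -
  obtain B where B: "\<And>x. norm (K x) \<le> B" using vanishing_bounded[OF K] by metis
  have [measurable]: "K \<in> borel_measurable borel" using K(1) by (rule borel_measurable_continuous_onI)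
  note [measurable] = u(1)
  show ?thesis
  proof (rule integrable_vanishing)
    show "(\<lambda>y. u y *\<^sub>R K (x - y)) \<in> borel_measurable borel" by measurable
    show "norm (u y *\<^sub>R K (x - y)) \<le> B" for y
      using mult_mono[OF u(2)[of y] B[of "x - y"]] by simp
    show "vanishes_outside (R + norm x) (\<lambda>y. u y *\<^sub>R K (x - y))"
      unfolding vanishes_outside_def
    proof (intro allI impI)
      fix y :: 'a assume "R + norm x < norm y"
      moreover have "norm y \<le> norm (x - y) + norm x" by (metis norm_triangle_sub norm_minus_commute add.commute)
      ultimately show "u y *\<^sub>R K (x - y) = 0" using K(2) by (simp add: vanishes_outside_def)
    qed
  qed
qed

text \<open>A convergent sequence is bounded, so all shifted kernels are supported in one ball and
  dominated convergence applies.\<close>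

lemma conv_continuous:
  fixes K :: "'a::euclidean_space \<Rightarrow> 'b::euclidean_space"
  assumes u: "u \<in> borel_measurable borel" "\<And>x. \<bar>u x\<bar> \<le> 1"
    and K: "continuous_on UNIV K" "vanishes_outside R K"
  shows "continuous_on UNIV (conv u K)"
  unfolding continuous_on_sequentially
proof (intro ballI allI impI)
  fix X :: "nat \<Rightarrow> 'a" and x assume "(\<forall>n. X n \<in> UNIV) \<and> X \<longlonglongrightarrow> x"
  then have X: "X \<longlonglongrightarrow> x" by simp
  obtain B where B: "\<And>x. norm (K x) \<le> B" using vanishing_bounded[OF K] by metis
  have [measurable]: "K \<in> borel_measurable borel" using K(1) by (rule borel_measurable_continuous_onI)
  note [measurable] = u(1)
  have "Bseq X" using X convergentI convergent_imp_Bseq by blast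
  then obtain H where H: "\<And>n. norm (X n) \<le> H" by (auto simp: Bseq_def)
  have "(\<lambda>n. \<integral>y. u y *\<^sub>R K (X n - y) \<partial>lborel) \<longlonglongrightarrow> (\<integral>y. u y *\<^sub>R K (x - y) \<partial>lborel)"
  proof (rule integral_dominated_convergence[where w="\<lambda>y. B * indicator (cball 0 (R + H)) y"])
    show "(\<lambda>y. u y *\<^sub>R K (x - y)) \<in> borel_measurable lborel" by measurable
    show "(\<lambda>y. u y *\<^sub>R K (X n - y)) \<in> borel_measurable lborel" for n by measurable
    show "integrable lborel (\<lambda>y. B * indicator (cball 0 (R + H)) y)"
      by (intro integrable_mult_right integrable_indicator_cball)
    show "AE y in lborel. (\<lambda>n. u y *\<^sub>R K (X n - y)) \<longlonglongrightarrow> u y *\<^sub>R K (x - y)"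
    proof (rule AE_I2)
      fix y
      have "isCont K (x - y)" using K(1) by (simp add: continuous_on_eq_continuous_at)
      then have "(\<lambda>n. K (X n - y)) \<longlonglongrightarrow> K (x - y)"
        by (rule isCont_tendsto_compose) (intro tendsto_intros X)
      then show "(\<lambda>n. u y *\<^sub>R K (X n - y)) \<longlonglongrightarrow> u y *\<^sub>R K (x - y)" by (intro tendsto_intros)
    qed
    show "AE y in lborel. norm (u y *\<^sub>R K (X n - y)) \<le> B * indicator (cball 0 (R + H)) y" for n
    proof (rule AE_I2)
      fix y
      show "norm (u y *\<^sub>R K (X n - y)) \<le> B * indicator (cball 0 (R + H)) y"
      proof (cases "y \<in> cball 0 (R + H)")
        case True
        then show ?thesis using mult_mono[OF u(2)[of y] B[of "X n - y"]] by simp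
      next
        case False
        moreover have "norm y \<le> norm (X n - y) + norm (X n)" by (metis norm_triangle_sub norm_minus_commute add.commute)
        ultimately have "R < norm (X n - y)" using H[of n] by simp
        then show ?thesis using K(2) False by (simp add: vanishes_outside_def)
      qed
    qed
  qed
  then show "(conv u K \<circ> X) \<longlonglongrightarrow> conv u K x" by (simp add: conv_def o_def)
qed

text \<open>All derivatives fall on the kernel. Its normalised remainders \<open>q n\<close> are
  bounded by \<open>2 * L\<close>, supported in one ball and tend to zero pointwise; dominated
  convergence turns this into differentiability of the convolution.\<close>

lemma C1_conv:
  fixes K :: "'a::euclidean_space \<Rightarrow> 'b::euclidean_space"
  assumes u: "u \<in> borel_measurable borel" "\<And>x. \<bar>u x\<bar> \<le> 1"
    and K: "C1 K K'" "vanishes_outside R K"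
  shows "C1 (conv u K) (\<lambda>x v. conv u (\<lambda>z. K' z v) x)"
proof -
  obtain L where L: "L > 0" "\<And>x h. norm (K' x h) \<le> L * norm h"
    using C1_deriv_bounded[OF K] by metis
  have K'i: "integrable lborel (\<lambda>y. u y *\<^sub>R K' (x - y) v)" for x v
    by (rule conv_integrable[OF u C1_D(2)[OF K(1)] C1_vanishes_deriv[OF K]])
  have Ki: "integrable lborel (\<lambda>y. u y *\<^sub>R K (x - y))" for x
    by (rule conv_integrable[OF u C1_continuous[OF K(1)] K(2)])
  have [measurable]: "K \<in> borel_measurable borel"
    using C1_continuous[OF K(1)] by (rule borel_measurable_continuous_onI)
  have [measurable]: "(\<lambda>x. K' x v) \<in> borel_measurable borel" for v
    using C1_D(2)[OF K(1)] by (rule borel_measurable_continuous_onI)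
  note [measurable] = u(1)
  have lin: "linear (\<lambda>v. conv u (\<lambda>z. K' z v) x)" for x
  proof (rule linearI)
    fix v w show "conv u (\<lambda>z. K' z (v + w)) x = conv u (\<lambda>z. K' z v) x + conv u (\<lambda>z. K' z w) x"
      using K'i[of x v] K'i[of x w] C1_D(3)[OF K(1)] by (simp add: conv_def linear_add scaleR_add_right)
  next
    fix r v show "conv u (\<lambda>z. K' z (r *\<^sub>R v)) x = r *\<^sub>R conv u (\<lambda>z. K' z v) x"
    proof -
      have "(\<lambda>y. u y *\<^sub>R K' (x - y) (r *\<^sub>R v)) = (\<lambda>y. r *\<^sub>R (u y *\<^sub>R K' (x - y) v))"
        using C1_D(3)[OF K(1)] by (simp add: linear_scale mult.commute)
      then show ?thesis unfolding conv_def by (simp only: integral_scaleR_right)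
    qed
  qed
  have "(conv u K has_derivative (\<lambda>v. conv u (\<lambda>z. K' z v) x)) (at x)" for x
    unfolding has_derivative_at tendsto_at_iff_sequentially
  proof (intro conjI allI impI)
    show "bounded_linear (\<lambda>v. conv u (\<lambda>z. K' z v) x)" using lin linear_conv_bounded_linear by blast
  next
    fix X :: "nat \<Rightarrow> 'a" assume X0: "\<forall>n. X n \<in> UNIV - {0}" and X: "X \<longlonglongrightarrow> 0"
    then have Xn: "X n \<noteq> 0" for n by simp
    have "Bseq X" using X convergentI convergent_imp_Bseq by blast
    then obtain H where H: "\<And>n. norm (X n) \<le> H" by (auto simp: Bseq_def)
    define q where "q n y = norm (K (x - y + X n) - K (x - y) - K' (x - y) (X n)) / norm (X n)" for n y
    have [measurable]: "q n \<in> borel_measurable borel" for n unfolding q_def by measurable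
    let ?w = "\<lambda>y. 2 * L * indicator (cball 0 (R + H + norm x)) y :: real"
    have wi: "integrable lborel ?w" by (intro integrable_mult_right integrable_indicator_cball)
    have qw: "norm (q n y) \<le> ?w y" for n y
    proof (cases "y \<in> cball 0 (R + H + norm x)")
      case True
      have "norm (K (x - y + X n) - K (x - y) - K' (x - y) (X n)) \<le> norm (K (x - y + X n) - K (x - y)) + norm (K' (x - y) (X n))"
        by (rule norm_triangle_ineq4)
      also have "\<dots> \<le> 2 * L * norm (X n)"
        using C1_lipschitz[OF K(1) L(2), of "x - y + X n" "x - y"] L(2)[of "x - y" "X n"] by simp
      finally show ?thesis using True Xn[of n] by (simp add: q_def field_simps)
    next
      case False
      have 1: "norm y \<le> norm (x - y) + norm x" by (metis norm_triangle_sub norm_minus_commute add.commute)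
      have 2: "norm (x - y) \<le> norm (x - y + X n) + norm (X n)" by (metis add_diff_cancel_right' norm_triangle_ineq4)
      have "R < norm (x - y)" "R < norm (x - y + X n)"
        using False 1 2 H[of n] norm_ge_zero[of "X n"] unfolding mem_cball_0 by linarith+
      then show ?thesis
        using False K(2) C1_vanishes_deriv[OF K, of "X n"] by (simp add: q_def vanishes_outside_def)
    qed
    have qi: "integrable lborel (q n)" for n
    proof (rule Bochner_Integration.integrable_bound[OF wi])
      show "AE y in lborel. norm (q n y) \<le> norm (?w y)"
        by (rule AE_I2, rule order_trans[OF qw]) (simp only: real_norm_def abs_ge_self)
    qed simp
    have "(\<lambda>n. \<integral>y. q n y \<partial>lborel) \<longlonglongrightarrow> integral\<^sup>L lborel (\<lambda>_::'a. 0)"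
    proof (rule integral_dominated_convergence[where w="?w"])
      show "AE y in lborel. (\<lambda>n. q n y) \<longlonglongrightarrow> 0"
      proof (rule AE_I2)
        fix y
        have "((\<lambda>h. norm (K (x - y + h) - K (x - y) - K' (x - y) h) / norm h) \<longlongrightarrow> 0) (at 0)"
          using C1_D(1)[OF K(1), of "x - y"] by (simp add: has_derivative_at)
        moreover have "filterlim X (at 0) sequentially" using X Xn by (simp add: filterlim_at)
        ultimately show "(\<lambda>n. q n y) \<longlonglongrightarrow> 0" unfolding q_def by (rule filterlim_compose)
      qed
      show "AE y in lborel. norm (q n y) \<le> ?w y" for n using qw by (intro AE_I2)
    qed (use wi in simp_all)
    then have lim: "(\<lambda>n. \<integral>y. q n y \<partial>lborel) \<longlonglongrightarrow> 0" by simp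
    have qb: "norm (norm (conv u K (x + X n) - conv u K x - conv u (\<lambda>z. K' z (X n)) x) / norm (X n)) \<le> (\<integral>y. q n y \<partial>lborel)" for n
    proof -
      have eq: "conv u K (x + X n) - conv u K x - conv u (\<lambda>z. K' z (X n)) x
        = (\<integral>y. u y *\<^sub>R K (x + X n - y) - u y *\<^sub>R K (x - y) - u y *\<^sub>R K' (x - y) (X n) \<partial>lborel)"
        unfolding conv_def
        by (simp only: Bochner_Integration.integral_diff Bochner_Integration.integrable_diff Ki K'i)
      have "norm (conv u K (x + X n) - conv u K x - conv u (\<lambda>z. K' z (X n)) x)
          \<le> (\<integral>y. norm (u y *\<^sub>R K (x + X n - y) - u y *\<^sub>R K (x - y) - u y *\<^sub>R K' (x - y) (X n)) \<partial>lborel)"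
        unfolding eq by (rule integral_norm_bound)
      also have "\<dots> \<le> (\<integral>y. norm (X n) * q n y \<partial>lborel)"
      proof (rule integral_mono)
        show "integrable lborel (\<lambda>y. norm (u y *\<^sub>R K (x + X n - y) - u y *\<^sub>R K (x - y) - u y *\<^sub>R K' (x - y) (X n)))"
          by (rule integrable_norm[OF Bochner_Integration.integrable_diff[OF Bochner_Integration.integrable_diff[OF Ki Ki] K'i]])
        show "integrable lborel (\<lambda>y. norm (X n) * q n y)" by (rule integrable_mult_right[OF qi])
        fix y
        have "u y *\<^sub>R K (x + X n - y) - u y *\<^sub>R K (x - y) - u y *\<^sub>R K' (x - y) (X n)
          = u y *\<^sub>R (K (x - y + X n) - K (x - y) - K' (x - y) (X n))"
          by (simp only: scaleR_diff_right add_diff_eq diff_add_eq)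
        then have "norm (u y *\<^sub>R K (x + X n - y) - u y *\<^sub>R K (x - y) - u y *\<^sub>R K' (x - y) (X n))
          = \<bar>u y\<bar> * norm (K (x - y + X n) - K (x - y) - K' (x - y) (X n))" by simp
        also have "\<dots> \<le> 1 * norm (K (x - y + X n) - K (x - y) - K' (x - y) (X n))"
          using u(2)[of y] by (intro mult_right_mono) auto
        also have "\<dots> = norm (X n) * q n y" using Xn[of n] by (simp add: q_def)
        finally show "norm (u y *\<^sub>R K (x + X n - y) - u y *\<^sub>R K (x - y) - u y *\<^sub>R K' (x - y) (X n)) \<le> norm (X n) * q n y" .
      qed
      also have "\<dots> = norm (X n) * (\<integral>y. q n y \<partial>lborel)" by simp
      finally show ?thesis using Xn[of n] by (simp add: field_simps)
    qed
    have "(\<lambda>n. norm (conv u K (x + X n) - conv u K x - conv u (\<lambda>z. K' z (X n)) x) / norm (X n)) \<longlonglongrightarrow> 0"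
      by (rule Lim_null_comparison[OF always_eventually[OF allI[OF qb]] lim])
    then show "((\<lambda>h. norm (conv u K (x + h) - conv u K x - conv u (\<lambda>z. K' z h) x) / norm h) \<circ> X) \<longlonglongrightarrow> 0"
      by (simp add: o_def)
  qed
  moreover have "continuous_on UNIV (\<lambda>x. conv u (\<lambda>z. K' z v) x)" for v
    by (rule conv_continuous[OF u C1_D(2)[OF K(1)] C1_vanishes_deriv[OF K]])
  ultimately show ?thesis unfolding C1_def by blast
qed

section \<open>The first variation of the Brunn-Minkowski inequality\<close>

text \<open>Tonelli for the region under the graph; conversion to \<open>ennreal\<close> drops
  negative values of \<open>h\<close>, which matches the restriction to positive levels.\<close>

lemma layer_cake:
  fixes h :: "'a::euclidean_space \<Rightarrow> real"
  assumes [measurable]: "h \<in> borel_measurable borel"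
  shows "(\<integral>\<^sup>+x. ennreal (h x) \<partial>lborel)
    = (\<integral>\<^sup>+t. indicator {0<..} t * emeasure lborel {x. t < h x} \<partial>lborel)"
proof -
  have *: "ennreal (h x) = (\<integral>\<^sup>+t. indicator {0<..<h x} t \<partial>lborel)" for x
    by (cases "0 \<le> h x") (simp_all add: ennreal_neg)
  have "(\<integral>\<^sup>+x. ennreal (h x) \<partial>lborel) = (\<integral>\<^sup>+x. (\<integral>\<^sup>+t. indicator {0<..<h x} t \<partial>lborel) \<partial>lborel)"
    by (rule nn_integral_cong) (rule *)
  also have "\<dots> = (\<integral>\<^sup>+x. (\<integral>\<^sup>+t. indicator {0<..} t * indicator {x. t < h x} x \<partial>lborel) \<partial>lborel)"
    by (intro nn_integral_cong) (auto simp: indicator_def)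
  also have "\<dots> = (\<integral>\<^sup>+t. (\<integral>\<^sup>+x. indicator {0<..} t * indicator {x. t < h x} x \<partial>lborel) \<partial>lborel)"
  proof (rule lborel_pair.Fubini')
    have "(\<lambda>(t, x). indicator {0<..} t * indicator {p :: real \<times> 'a. fst p < h (snd p)} (t, x) :: ennreal)
        \<in> borel_measurable (lborel \<Otimes>\<^sub>M lborel)"
      by measurable
    then show "(\<lambda>(t, x). indicator {0<..} t * indicator {x. t < h x} x :: ennreal) \<in> borel_measurable (lborel \<Otimes>\<^sub>M lborel)"
      by (simp add: indicator_def case_prod_unfold)
  qed
  also have "\<dots> = (\<integral>\<^sup>+t. indicator {0<..} t * emeasure lborel {x. t < h x} \<partial>lborel)"
    by (intro nn_integral_cong) (simp add: nn_integral_cmult)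
  finally show ?thesis .
qed

lemma open_superlevel_set:
  fixes g :: "'a::euclidean_space \<Rightarrow> real"
  assumes "continuous_on UNIV g"
  shows "open {x. t < g x}"
  using assms by (intro open_Collect_less) (auto intro: continuous_intros)

lemma bounded_superlevel_set:
  fixes g :: "'a::euclidean_space \<Rightarrow> real"
  assumes "vanishes_outside R g" "t \<ge> 0"
  shows "bounded {x. t < g x}"
proof (rule bounded_subset[OF bounded_cball])
  show "{x. t < g x} \<subseteq> cball 0 R"
  proof
    fix x assume "x \<in> {x. t < g x}"
    then have "g x \<noteq> 0" using assms(2) by auto
    then show "x \<in> cball 0 R" using assms(1) by (auto simp: vanishes_outside_def not_less[symmetric])
  qed
qed

text \<open>Bernoulli's inequality scaled by \<open>a ^ n\<close>: the first two terms of the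
  binomial expansion.\<close>

lemma power_add_lower_bound:
  fixes a b :: real
  assumes "a > 0" "b \<ge> 0" "n \<ge> 1"
  shows "a ^ n + real n * a ^ (n - 1) * b \<le> (a + b) ^ n"
proof -
  have "1 + real n * (b / a) \<le> (1 + b / a) ^ n"
    using assms by (intro Bernoulli_inequality) (auto intro: order_trans[of _ 0])
  then have "a ^ n * (1 + real n * (b / a)) \<le> a ^ n * (1 + b / a) ^ n"
    using assms by (intro mult_left_mono) auto
  moreover have "a ^ n * (1 + b / a) ^ n = (a + b) ^ n"
    using assms by (simp add: power_mult_distrib[symmetric] field_simps)
  moreover have "a ^ n = a * a ^ (n - 1)" using assms(3) by (metis Suc_diff_1 power_Suc less_le_trans zero_less_one)
  moreover have "a ^ n * (1 + real n * (b / a)) = a ^ n + real n * (a ^ n / a) * b"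
    by (simp add: algebra_simps)
  moreover have "a ^ n / a = a ^ (n - 1)" using assms(1) \<open>a ^ n = a * a ^ (n - 1)\<close> by simp
  ultimately show ?thesis by simp
qed

text \<open>The sharp isoperimetric constant: the perimeter of the unit ball divided by the power
  \<open>(d - 1) / d\<close> of its volume. The argument of type \<open>itself\<close> only carries
  the dimension.\<close>

definition iso_const :: "'a::euclidean_space itself \<Rightarrow> real" where
  "iso_const _ = real DIM('a) * unit_ball_vol (real DIM('a)) powr (1 / real DIM('a))"

lemma unit_ball_vol_powr_pos: "unit_ball_vol (real n) powr p > 0"
  using unit_ball_vol_pos[of "real n"] by (metis less_irrefl of_nat_0_le_iff powr_gt_zero)

lemma iso_const_pos: "iso_const TYPE('a::euclidean_space) > 0"
  by (simp add: iso_const_def unit_ball_vol_powr_pos del: powr_gt_zero)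

text \<open>The part of Brunn-Minkowski against a ball that is linear in \<epsilon>:
  \<open>(a + b) ^ d \<ge> a ^ d + d * a ^ (d - 1) * b\<close>, with \<open>a\<close> and
  \<open>b\<close> the d-th roots of the two volumes. The lower bound \<open>v\<close> in place of
  the volume of \<open>A\<close> makes the gain uniform over many superlevel sets.\<close>

lemma content_ball_sumset:
  fixes A :: "'a::euclidean_space set"
  assumes A: "open A" "bounded A" and v: "0 < v" "v \<le> measure lborel A" and e: "\<epsilon> > 0"
  shows "measure lborel A + \<epsilon> * iso_const TYPE('a) * v powr ((real DIM('a) - 1) / real DIM('a))
    \<le> measure lborel (sumset A (ball 0 \<epsilon>))"
proof -
  let ?n = "real DIM('a)" and ?\<omega> = "unit_ball_vol (real DIM('a))"
  have n: "?n \<ge> 1" by (simp add: Suc_leI)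
  have w: "?\<omega> > 0" by (simp add: unit_ball_vol_pos)
  define a where "a = measure lborel A powr (1 / ?n)"
  define b where "b = \<epsilon> * ?\<omega> powr (1 / ?n)"
  have a: "a > 0" using v by (simp add: a_def)
  have b: "b > 0" using e by (simp add: b_def unit_ball_vol_powr_pos del: powr_gt_zero)
  have mA: "measure lborel A > 0" using v by simp
  have mB: "measure lborel (ball (0::'a) \<epsilon>) = ?\<omega> * \<epsilon> ^ DIM('a)" using e by (simp add: content_ball)
  have "measure lborel (ball (0::'a) \<epsilon>) powr (1 / ?n) = ?\<omega> powr (1 / ?n) * (\<epsilon> powr ?n) powr (1 / ?n)"
    unfolding mB using e w by (simp add: powr_mult powr_realpow)
  also have "\<dots> = b" using e by (simp add: powr_powr b_def)
  finally have bB: "measure lborel (ball (0::'a) \<epsilon>) powr (1 / ?n) = b" .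
  have "BM_ineq A (ball 0 \<epsilon>)"
    using A mA e w mB by (intro brunn_minkowski) auto
  then have bm: "(a + b) powr ?n \<le> measure lborel (sumset A (ball 0 \<epsilon>))"
    unfolding BM_ineq_def bB a_def .
  have "measure lborel A = a powr ?n" using mA by (simp add: a_def powr_powr)
  also have "\<dots> = a ^ DIM('a)" using a by (simp add: powr_realpow)
  finally have A_eq: "measure lborel A = a ^ DIM('a)" .
  have "v powr ((?n - 1) / ?n) \<le> measure lborel A powr ((?n - 1) / ?n)"
    using v n by (intro powr_mono2) auto
  also have "\<dots> = a powr (?n - 1)" by (simp add: a_def powr_powr)
  also have "\<dots> = a ^ (DIM('a) - 1)"
    using a n by (simp add: powr_realpow[symmetric] of_nat_diff)
  finally have "v powr ((?n - 1) / ?n) * (?n * b) \<le> a ^ (DIM('a) - 1) * (?n * b)"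
    using b n by (intro mult_right_mono) auto
  then have "measure lborel A + \<epsilon> * iso_const TYPE('a) * v powr ((?n - 1) / ?n) \<le> a ^ DIM('a) + ?n * a ^ (DIM('a) - 1) * b"
    by (simp add: A_eq iso_const_def b_def mult_ac)
  also have "\<dots> \<le> (a + b) ^ DIM('a)" using a b by (intro power_add_lower_bound) (auto simp: Suc_leI)
  also have "\<dots> = (a + b) powr ?n" using a b by (simp add: powr_realpow)
  finally show ?thesis using bm by simp
qed

text \<open>Dilation of a function: every superlevel set of \<open>sup_conv \<epsilon> g\<close> is
  the open \<epsilon>-neighbourhood of the same superlevel set of \<open>g\<close>, which is how
  Brunn-Minkowski reaches functions.\<close>

definition sup_conv :: "real \<Rightarrow> ('a::euclidean_space \<Rightarrow> real) \<Rightarrow> 'a \<Rightarrow> real" where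
  "sup_conv \<epsilon> g x = (SUP y\<in>ball 0 \<epsilon>. g (x + y))"

lemma less_sup_conv_iff:
  fixes g :: "'a::euclidean_space \<Rightarrow> real"
  assumes "\<epsilon> > 0" "\<And>x. g x \<le> B"
  shows "{x. t < sup_conv \<epsilon> g x} = sumset {x. t < g x} (ball 0 \<epsilon>)"
proof -
  have "t < sup_conv \<epsilon> g x \<longleftrightarrow> (\<exists>y\<in>ball 0 \<epsilon>. t < g (x + y))" for x
    unfolding sup_conv_def using assms by (intro less_cSUP_iff) (auto intro!: bdd_aboveI2)
  moreover have "(\<exists>y\<in>ball 0 \<epsilon>. t < g (x + y)) \<longleftrightarrow> x \<in> sumset {x. t < g x} (ball 0 \<epsilon>)" for x
  proof
    assume "\<exists>y\<in>ball 0 \<epsilon>. t < g (x + y)"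
    then obtain y where y: "y \<in> ball 0 \<epsilon>" "t < g (x + y)" by blast
    then have "x + y \<in> {x. t < g x}" "- y \<in> ball 0 \<epsilon>" "x = (x + y) + (- y)" by auto
    then show "x \<in> sumset {x. t < g x} (ball 0 \<epsilon>)" by blast
  next
    assume "x \<in> sumset {x. t < g x} (ball 0 \<epsilon>)"
    then obtain z y where zy: "t < g z" "y \<in> ball 0 \<epsilon>" "x = z + y" by blast
    then have "- y \<in> ball 0 \<epsilon>" "t < g (x + (- y))" by auto
    then show "\<exists>y\<in>ball 0 \<epsilon>. t < g (x + y)" by blast
  qed
  ultimately show ?thesis by blast
qed

lemma sup_conv_measurable:
  fixes g :: "'a::euclidean_space \<Rightarrow> real"
  assumes "\<epsilon> > 0" "\<And>x. g x \<le> B" "continuous_on UNIV g"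
  shows "sup_conv \<epsilon> g \<in> borel_measurable borel"
proof -
  have "open (sumset {x. t < g x} (ball 0 \<epsilon>))" for t
    by (rule open_sums) simp
  then show ?thesis
    unfolding borel_measurable_iff_greater by (simp add: less_sup_conv_iff[OF assms(1,2)])
qed

lemma sup_conv_bounds:
  fixes g :: "'a::euclidean_space \<Rightarrow> real"
  assumes "\<epsilon> > 0" "\<And>x. g x \<le> B"
  shows "g x \<le> sup_conv \<epsilon> g x" "(\<And>y. norm y < \<epsilon> \<Longrightarrow> g (x + y) \<le> C) \<Longrightarrow> sup_conv \<epsilon> g x \<le> C"
proof -
  have "g (x + 0) \<le> sup_conv \<epsilon> g x"
    unfolding sup_conv_def using assms by (intro cSUP_upper) (auto intro!: bdd_aboveI2)
  then show "g x \<le> sup_conv \<epsilon> g x" by simp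
  show "(\<And>y. norm y < \<epsilon> \<Longrightarrow> g (x + y) \<le> C) \<Longrightarrow> sup_conv \<epsilon> g x \<le> C"
    unfolding sup_conv_def using assms(1) by (intro cSUP_least) auto
qed

text \<open>Each level between 0 and \<open>T\<close> has superlevel volume at least
  \<open>v\<close>, so passing to the neighbourhood gains at least one fixed amount; the layer-cake
  formula adds up these gains over an interval of length \<open>T\<close>.\<close>

lemma sup_conv_integral:
  fixes g :: "'a::euclidean_space \<Rightarrow> real"
  assumes g: "continuous_on UNIV g" "vanishes_outside R g" "\<And>x. g x \<ge> 0"
    and T: "T > 0" and v: "v > 0" "v \<le> measure lborel {x. T < g x}" and e: "\<epsilon> > 0"
  shows "T * (\<epsilon> * iso_const TYPE('a) * v powr ((real DIM('a) - 1) / real DIM('a)))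
    \<le> (\<integral>x. sup_conv \<epsilon> g x - g x \<partial>lborel)"
    "integrable lborel (sup_conv \<epsilon> g)"
proof -
  obtain B where B: "B > 0" "\<And>x. norm (g x) \<le> B" using vanishing_bounded[OF g(1,2)] by metis
  then have gB: "g x \<le> B" for x by (metis abs_le_D1 real_norm_def)
  have [measurable]: "g \<in> borel_measurable borel" using g(1) by (rule borel_measurable_continuous_onI)
  have [measurable]: "sup_conv \<epsilon> g \<in> borel_measurable borel" using sup_conv_measurable[OF e gB g(1)] .
  have sb: "g x \<le> sup_conv \<epsilon> g x" for x by (rule sup_conv_bounds(1)[OF e gB])
  have sb2: "sup_conv \<epsilon> g x \<le> C" if "\<And>y. norm y < \<epsilon> \<Longrightarrow> g (x + y) \<le> C" for x C
    using that by (rule sup_conv_bounds(2)[OF e gB])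
  have nn: "sup_conv \<epsilon> g x \<ge> 0" for x using sb[of x] g(3)[of x] by linarith
  have gi: "integrable lborel g" by (rule integrable_continuous_vanishing[OF g(1,2)])
  show si: "integrable lborel (sup_conv \<epsilon> g)"
  proof (rule integrable_vanishing)
    show "norm (sup_conv \<epsilon> g x) \<le> B" for x using sb2[of x B] gB nn by simp
    show "vanishes_outside (R + \<epsilon>) (sup_conv \<epsilon> g)"
      unfolding vanishes_outside_def
    proof (intro allI impI)
      fix x :: 'a assume x: "R + \<epsilon> < norm x"
      have "g (x + y) \<le> 0" if "norm y < \<epsilon>" for y
      proof -
        have "norm x \<le> norm (x + y) + norm y" by (metis add_diff_cancel_right' norm_triangle_ineq4)
        then show ?thesis using g(2) x that by (simp add: vanishes_outside_def)
      qed
      then show "sup_conv \<epsilon> g x = 0" using sb2[of x 0] nn[of x] by simp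
    qed
  qed simp
  let ?c = "\<epsilon> * iso_const TYPE('a) * v powr ((real DIM('a) - 1) / real DIM('a))"
  have c0: "?c \<ge> 0" using e iso_const_pos[where 'a='a] by simp
  \<comment> \<open>No gain is claimed for levels from \<open>T\<close> on; there monotonicity is
    enough.\<close>
  have level: "emeasure lborel {x. t < g x} + indicator {0<..<T} t * ennreal ?c \<le> emeasure lborel {x. t < sup_conv \<epsilon> g x}"
    if t: "t > 0" for t
  proof -
    let ?A = "{x. t < g x}"
    have A: "open ?A" "bounded ?A"
      using open_superlevel_set[OF g(1)] bounded_superlevel_set[OF g(2)] t by auto
    have S: "open (sumset ?A (ball 0 \<epsilon>))" "bounded (sumset ?A (ball 0 \<epsilon>))"
      using A by (auto intro!: bounded_sumset intro: open_sums)
    have eq: "{x. t < sup_conv \<epsilon> g x} = sumset ?A (ball 0 \<epsilon>)" by (rule less_sup_conv_iff[OF e gB])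
    show ?thesis
    proof (cases "t < T")
      case True
      have "measure lborel {x. T < g x} \<le> measure lborel ?A"
        using True A open_superlevel_set[OF g(1), of T] by (intro content_mono_bounded) auto
      then have "measure lborel ?A + ?c \<le> measure lborel (sumset ?A (ball 0 \<epsilon>))"
        using v by (intro content_ball_sumset A e) auto
      then have "ennreal (measure lborel ?A) + ennreal ?c \<le> ennreal (measure lborel (sumset ?A (ball 0 \<epsilon>)))"
        using c0 by (simp add: ennreal_plus[symmetric] ennreal_leI del: ennreal_plus)
      then show ?thesis using True t unfolding eq
        by (simp add: emeasure_bounded_open[OF A] emeasure_bounded_open[OF S])
    next
      case False
      have "?A \<subseteq> {x. t < sup_conv \<epsilon> g x}" using sb by (auto intro: less_le_trans)
      then show ?thesis using False by (simp add: emeasure_mono)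
    qed
  qed
  have "(\<integral>\<^sup>+x. ennreal (g x) \<partial>lborel) + ennreal (T * ?c)
    = (\<integral>\<^sup>+t. indicator {0<..} t * emeasure lborel {x. t < g x} \<partial>lborel) + (\<integral>\<^sup>+t. indicator {0<..<T} t * ennreal ?c \<partial>lborel)"
    using T c0 by (simp add: layer_cake nn_integral_multc ennreal_mult)
  also have "\<dots> = (\<integral>\<^sup>+t. indicator {0<..} t * emeasure lborel {x. t < g x} + indicator {0<..<T} t * ennreal ?c \<partial>lborel)"
  proof (rule nn_integral_add[symmetric])
    have "{p \<in> space (borel \<Otimes>\<^sub>M lborel). fst p < g (snd p)} \<in> sets (borel \<Otimes>\<^sub>M lborel)" by measurable
    then have "{p. fst p < g (snd p)} \<in> sets (borel \<Otimes>\<^sub>M lborel)" by (simp add: space_pair_measure)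
    then have "(\<lambda>t. emeasure lborel (Pair t -` {p. fst p < g (snd p)})) \<in> borel_measurable borel"
      by (rule lborel.measurable_emeasure_Pair)
    then have [measurable]: "(\<lambda>t. emeasure lborel {x. t < g x}) \<in> borel_measurable borel"
      by (simp add: vimage_def)
    show "(\<lambda>t. indicator {0<..} t * emeasure lborel {x. t < g x}) \<in> borel_measurable lborel" by measurable
  qed measurable
  also have "\<dots> \<le> (\<integral>\<^sup>+t. indicator {0<..} t * emeasure lborel {x. t < sup_conv \<epsilon> g x} \<partial>lborel)"
    using level by (intro nn_integral_mono) (auto split: split_indicator)
  also have "\<dots> = (\<integral>\<^sup>+x. ennreal (sup_conv \<epsilon> g x) \<partial>lborel)" by (simp add: layer_cake)
  finally have "ennreal (\<integral>x. g x \<partial>lborel) + ennreal (T * ?c) \<le> ennreal (\<integral>x. sup_conv \<epsilon> g x \<partial>lborel)"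
    using gi si g(3) nn by (simp add: nn_integral_eq_integral)
  then have "(\<integral>x. g x \<partial>lborel) + T * ?c \<le> (\<integral>x. sup_conv \<epsilon> g x \<partial>lborel)"
    using c0 T g(3) nn by (simp add: ennreal_plus[symmetric] ennreal_le_iff del: ennreal_plus)
  then show "T * ?c \<le> (\<integral>x. sup_conv \<epsilon> g x - g x \<partial>lborel)" using gi si by simp
qed

text \<open>As \<epsilon> tends to 0, the increment of \<open>sup_conv \<epsilon> g\<close> over
  \<open>g\<close>, divided by \<epsilon>, is asymptotically at most the steepest slope
  \<open>norm (G x)\<close>, while its integral is bounded below by the gain per level.\<close>

lemma gradient_lower_bound:
  fixes g :: "'a::euclidean_space \<Rightarrow> real"
  assumes g: "C1 g (\<lambda>x v. G x \<bullet> v)" "vanishes_outside R g" "\<And>x. g x \<ge> 0"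
    and G: "continuous_on UNIV G" "vanishes_outside R G"
    and T: "T > 0" and v: "v > 0" "v \<le> measure lborel {x. T < g x}"
  shows "T * iso_const TYPE('a) * v powr ((real DIM('a) - 1) / real DIM('a)) \<le> (\<integral>x. norm (G x) \<partial>lborel)"
proof -
  note gc = C1_continuous[OF g(1)]
  obtain B where B: "B > 0" "\<And>x. norm (g x) \<le> B" using vanishing_bounded[OF gc g(2)] by metis
  then have gB: "g x \<le> B" for x by (metis abs_le_D1 real_norm_def)
  obtain L where L: "L > 0" "\<And>x. norm (G x) \<le> L" using vanishing_bounded[OF G] by metis
  have L': "norm (G x \<bullet> h) \<le> L * norm h" for x h
  proof -
    have "norm (G x \<bullet> h) \<le> norm (G x) * norm h" using Cauchy_Schwarz_ineq2 by simp
    also have "\<dots> \<le> L * norm h" using L(2) by (intro mult_right_mono) auto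
    finally show ?thesis .
  qed
  have lip: "g (x + y) \<le> g x + L * norm y" for x y
    using C1_lipschitz[OF g(1) L', of "x + y" x] by simp
  have [measurable]: "g \<in> borel_measurable borel" using gc by (rule borel_measurable_continuous_onI)
  have [measurable]: "G \<in> borel_measurable borel" using G(1) by (rule borel_measurable_continuous_onI)
  let ?c = "iso_const TYPE('a) * v powr ((real DIM('a) - 1) / real DIM('a))"
  define e where "e k = 1 / real (Suc k)" for k
  have e: "e k > 0" "e k \<le> 1" for k by (auto simp: e_def)
  have elim: "e \<longlonglongrightarrow> 0" unfolding e_def by (rule LIMSEQ_Suc[OF lim_const_over_n])
  define q where "q k x = (sup_conv (e k) g x - g x) / e k" for k x
  have [measurable]: "sup_conv (e k) g \<in> borel_measurable borel" for k
    using sup_conv_measurable[OF e(1) gB gc] .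
  have sb: "g x \<le> sup_conv (e k) g x" for k x by (rule sup_conv_bounds(1)[OF e(1) gB])
  have sb2: "sup_conv (e k) g x \<le> C" if "\<And>y. norm y < e k \<Longrightarrow> g (x + y) \<le> C" for k x C
    using that by (rule sup_conv_bounds(2)[OF e(1) gB])
  have q0: "q k x \<ge> 0" for k x using sb[of x k] e(1)[of k] by (simp add: q_def)
  have qL: "q k x \<le> L" for k x
  proof -
    have "sup_conv (e k) g x \<le> g x + L * e k"
    proof (rule sb2)
      fix y :: 'a assume "norm y < e k"
      then have "L * norm y \<le> L * e k" using L(1) by simp
      then show "g (x + y) \<le> g x + L * e k" using lip[of x y] by linarith
    qed
    then show ?thesis using e(1)[of k] by (simp add: q_def field_simps)
  qed
  have qv: "q k x = 0" if "norm x > R + 1" for k x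
  proof -
    have "g (x + y) \<le> 0" if "norm y < e k" for y
    proof -
      have "norm x \<le> norm (x + y) + norm y" by (metis add_diff_cancel_right' norm_triangle_ineq4)
      then have "R < norm (x + y)" using \<open>norm x > R + 1\<close> that e(2)[of k] by linarith
      then show ?thesis using g(2) by (simp add: vanishes_outside_def)
    qed
    then have "sup_conv (e k) g x \<le> 0" by (rule sb2)
    then show ?thesis using q0[of k x] g(2) that e(1)[of k] by (simp add: q_def vanishes_outside_def divide_le_0_iff zero_le_divide_iff)
  qed
  have up: "\<exists>N. \<forall>k\<ge>N. q k x \<le> norm (G x) + d" if d: "d > 0" for x d
  proof -
    have "(g has_derivative (\<lambda>v. G x \<bullet> v)) (at x)" using C1_D(1)[OF g(1)] .
    then obtain s where s: "s > 0" "\<And>y. norm (y - x) < s \<Longrightarrow> norm (g y - g x - G x \<bullet> (y - x)) \<le> d * norm (y - x)"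
      using d unfolding has_derivative_at_alt by blast
    obtain N where N: "\<And>k. k \<ge> N \<Longrightarrow> e k < s"
      using order_tendstoD(2)[OF elim s(1)] by (auto simp: eventually_sequentially)
    have "q k x \<le> norm (G x) + d" if "k \<ge> N" for k
    proof -
      have "sup_conv (e k) g x \<le> g x + (norm (G x) + d) * e k"
      proof (rule sb2)
        fix y :: 'a assume y: "norm y < e k"
        then have "norm (g (x + y) - g x - G x \<bullet> y) \<le> d * norm y" using s(2)[of "x + y"] N[OF that] by simp
        moreover have "G x \<bullet> y \<le> norm (G x) * norm y" by (rule norm_cauchy_schwarz)
        ultimately have "g (x + y) \<le> g x + (norm (G x) + d) * norm y" by (simp add: algebra_simps)
        also have "\<dots> \<le> g x + (norm (G x) + d) * e k"
          using y d by (intro add_left_mono mult_left_mono) auto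
        finally show "g (x + y) \<le> g x + (norm (G x) + d) * e k" .
      qed
      then show ?thesis using e(1)[of k] by (simp add: q_def field_simps)
    qed
    then show ?thesis by blast
  qed
  \<comment> \<open>Only the upper limit of \<open>q k\<close> is controlled. The maximum with
    \<open>norm (G x)\<close> converges and still lies above \<open>q k\<close>, so dominated
    convergence is applied to it.\<close>
  define m where "m k x = max (q k x) (norm (G x))" for k x
  have [measurable]: "m k \<in> borel_measurable borel" for k unfolding m_def q_def by measurable
  let ?w = "\<lambda>x. L * indicator (cball 0 (R + 1)) x :: real"
  have wi: "integrable lborel ?w" by (rule integrable_mult_right[OF integrable_indicator_cball])
  have mw: "norm (m k x) \<le> ?w x" for k x
  proof (cases "x \<in> cball 0 (R + 1)")
    case True
    then show ?thesis using qL[of k x] L(2)[of x] q0[of k x] by (simp add: m_def)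
  next
    case False
    then show ?thesis using qv[of x k] G(2) by (simp add: m_def vanishes_outside_def)
  qed
  have mi: "integrable lborel (m k)" for k
  proof (rule Bochner_Integration.integrable_bound[OF wi])
    show "AE x in lborel. norm (m k x) \<le> norm (?w x)"
      by (rule AE_I2, rule order_trans[OF mw]) (simp only: real_norm_def abs_ge_self)
  qed simp
  have "(\<lambda>k. \<integral>x. m k x \<partial>lborel) \<longlonglongrightarrow> (\<integral>x. norm (G x) \<partial>lborel)"
  proof (rule integral_dominated_convergence[where w="?w"])
    show "AE x in lborel. (\<lambda>k. m k x) \<longlonglongrightarrow> norm (G x)"
    proof (rule AE_I2, rule LIMSEQ_I)
      fix x and r :: real assume r: "0 < r"
      obtain N where "\<And>k. k \<ge> N \<Longrightarrow> q k x \<le> norm (G x) + r / 2" using up[of "r / 2" x] r by auto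
      then show "\<exists>N. \<forall>k\<ge>N. norm (m k x - norm (G x)) < r"
        using r by (intro exI[of _ N]) (force simp: m_def max_def)
    qed
    show "AE x in lborel. norm (m k x) \<le> ?w x" for k using mw by (rule AE_I2)
  qed (use wi in simp_all)
  moreover have "T * ?c \<le> (\<integral>x. m k x \<partial>lborel)" for k
  proof -
    note sc = sup_conv_integral[OF gc g(2,3) T v e(1)[of k]]
    have gi: "integrable lborel g" by (rule integrable_continuous_vanishing[OF gc g(2)])
    have qi: "integrable lborel (q k)"
      unfolding q_def using sc(2) gi by simp
    have "T * ?c * e k \<le> (\<integral>x. sup_conv (e k) g x - g x \<partial>lborel)" using sc(1) by (simp add: mult_ac)
    also have "\<dots> = (\<integral>x. q k x \<partial>lborel) * e k" using e(1)[of k] by (simp add: q_def)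
    finally have "T * ?c \<le> (\<integral>x. q k x \<partial>lborel)" using e(1)[of k] by simp
    also have "\<dots> \<le> (\<integral>x. m k x \<partial>lborel)"
      by (rule Bochner_Integration.integral_mono[OF qi mi]) (simp add: m_def)
    finally show ?thesis .
  qed
  ultimately have "T * ?c \<le> (\<integral>x. norm (G x) \<partial>lborel)" by (intro LIMSEQ_le_const) auto
  then show ?thesis by (simp add: mult_ac)
qed

section \<open>Bumps and mollifiers\<close>

text \<open>The squared positive part is differentiable also at 0, with continuous derivative; every
  cut-off below is built on it.\<close>

lemma DERIV_max_0_square: "((\<lambda>s::real. (max 0 s)\<^sup>2) has_real_derivative 2 * max 0 s) (at s)"
proof (cases "s = 0")
  case True
  have "((\<lambda>h::real. (max 0 h)\<^sup>2 / h) \<longlongrightarrow> 0) (at 0)"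
  proof (rule Lim_null_comparison)
    show "\<forall>\<^sub>F h in at (0::real). norm ((max 0 h)\<^sup>2 / h) \<le> norm h"
      by (intro always_eventually) (auto simp: max_def power2_eq_square)
    show "((\<lambda>h::real. norm h) \<longlongrightarrow> 0) (at 0)" by (intro tendsto_eq_intros) auto
  qed
  then show ?thesis using True by (simp add: DERIV_def)
next
  case False
  consider "s < 0" | "s > 0" using False by linarith
  then show ?thesis
  proof cases
    case 1
    show ?thesis
    proof (rule has_field_derivative_transform_within_open[where S="{..<0}" and f="\<lambda>_. 0"])
      show "((\<lambda>_. 0) has_real_derivative 2 * max 0 s) (at s)" using 1 by simp
    qed (use 1 in auto)
  next
    case 2
    show ?thesis
    proof (rule has_field_derivative_transform_within_open[where S="{0<..}" and f="\<lambda>s. s\<^sup>2"])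
      show "((\<lambda>s. s\<^sup>2) has_real_derivative 2 * max 0 s) (at s)" using 2 by (auto intro!: derivative_eq_intros)
    qed (use 2 in auto)
  qed
qed

lemma has_derivative_max_0_square [derivative_intros]:
  fixes f :: "'a::real_normed_vector \<Rightarrow> real"
  assumes "(f has_derivative f') (at x)"
  shows "((\<lambda>x. (max 0 (f x))\<^sup>2) has_derivative (\<lambda>v. 2 * max 0 (f x) * f' v)) (at x)"
  using has_derivative_compose[OF assms, of "\<lambda>s. (max 0 s)\<^sup>2" "\<lambda>t. 2 * max 0 (f x) * t"]
    DERIV_max_0_square[of "f x"] by (simp add: has_field_derivative_def)

lemma has_derivative_max_0_cube [derivative_intros]:
  fixes f :: "'a::real_normed_vector \<Rightarrow> real"
  assumes f: "(f has_derivative f') (at x)"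
  shows "((\<lambda>x. (max 0 (f x)) ^ 3) has_derivative (\<lambda>v. 3 * (max 0 (f x))\<^sup>2 * f' v)) (at x)"
proof -
  have "(\<lambda>x. (max 0 (f x)) ^ 3) = (\<lambda>x. (max 0 (f x))\<^sup>2 * f x)"
    by (auto simp: max_def power2_eq_square power3_eq_cube)
  moreover have "((\<lambda>x. (max 0 (f x))\<^sup>2 * f x) has_derivative
      (\<lambda>v. (max 0 (f x))\<^sup>2 * f' v + (2 * max 0 (f x) * f' v) * f x)) (at x)"
    by (intro has_derivative_mult has_derivative_max_0_square f)
  moreover have "(max 0 (f x))\<^sup>2 * f' v + (2 * max 0 (f x) * f' v) * f x = 3 * (max 0 (f x))\<^sup>2 * f' v" for v
    by (auto simp: max_def power2_eq_square)
  ultimately show ?thesis by simp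
qed

definition quad :: "real \<Rightarrow> 'a::euclidean_space \<Rightarrow> real" where
  "quad R x = 1 - (x \<bullet> x) / R\<^sup>2"

text \<open>A cube rather than a square: the gradient of a bump enters test fields and has to be C1
  itself. Small radii serve for mollifiers, large radii for truncations.\<close>

definition bump :: "real \<Rightarrow> 'a::euclidean_space \<Rightarrow> real" where
  "bump R x = (max 0 (quad R x)) ^ 3"

definition bump_grad :: "real \<Rightarrow> 'a::euclidean_space \<Rightarrow> 'a" where
  "bump_grad R x = (- (6 / R\<^sup>2) * (max 0 (quad R x))\<^sup>2) *\<^sub>R x"

lemma quad_derivative: "(quad R has_derivative (\<lambda>v. - (2 / R\<^sup>2) * (x \<bullet> v))) (at x)"
proof -
  have "((\<lambda>x. x \<bullet> x) has_derivative (\<lambda>v. x \<bullet> v + v \<bullet> x)) (at x)"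
    by (intro has_derivative_inner has_derivative_ident)
  from has_derivative_diff[OF has_derivative_const[of 1] has_derivative_mult_right[OF this, of "1 / R\<^sup>2"]]
  show ?thesis by (simp add: quad_def[abs_def] inner_commute[of _ x])
qed

lemma quad_continuous [continuous_intros]: "continuous_on S (quad R)"
  unfolding quad_def by (cases "R = 0") (auto intro!: continuous_intros)

lemma C1_bump: "C1 (bump R) (\<lambda>x v. bump_grad R x \<bullet> v)"
  unfolding C1_def
proof (intro conjI allI)
  fix x :: 'a
  show "(bump R has_derivative (\<lambda>v. bump_grad R x \<bullet> v)) (at x)"
    unfolding bump_def
    using has_derivative_max_0_cube[OF quad_derivative[of R x]]
    by (simp add: bump_grad_def mult_ac)
  fix v :: 'a
  show "continuous_on UNIV (\<lambda>x. bump_grad R x \<bullet> v)"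
    unfolding bump_grad_def by (intro continuous_intros)
qed

lemma C1_bump_grad:
  "C1 (bump_grad R) (\<lambda>x v. (24 / R ^ 4 * max 0 (quad R x) * (x \<bullet> v)) *\<^sub>R x + (- (6 / R\<^sup>2) * (max 0 (quad R x))\<^sup>2) *\<^sub>R v)"
  unfolding C1_def
proof (intro conjI allI)
  fix x :: 'a
  have "((\<lambda>x. (- (6 / R\<^sup>2) * (max 0 (quad R x))\<^sup>2) *\<^sub>R x) has_derivative
     (\<lambda>v. (- (6 / R\<^sup>2) * (max 0 (quad R x))\<^sup>2) *\<^sub>R v
        + (- (6 / R\<^sup>2) * (2 * max 0 (quad R x) * (- (2 / R\<^sup>2) * (x \<bullet> v)))) *\<^sub>R x)) (at x)"
    by (intro has_derivative_scaleR has_derivative_ident has_derivative_mult_right has_derivative_max_0_square quad_derivative)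
  moreover have "- (6 / R\<^sup>2) * (2 * max 0 (quad R x) * (- (2 / R\<^sup>2) * (x \<bullet> v))) = 24 / R ^ 4 * max 0 (quad R x) * (x \<bullet> v)" for v
    by (simp add: power4_eq_xxxx power2_eq_square)
  ultimately show "(bump_grad R has_derivative (\<lambda>v. (24 / R ^ 4 * max 0 (quad R x) * (x \<bullet> v)) *\<^sub>R x + (- (6 / R\<^sup>2) * (max 0 (quad R x))\<^sup>2) *\<^sub>R v)) (at x)"
    unfolding bump_grad_def by (simp add: add.commute mult.assoc)
  fix v :: 'a
  show "continuous_on UNIV (\<lambda>x. (24 / R ^ 4 * max 0 (quad R x) * (x \<bullet> v)) *\<^sub>R x + (- (6 / R\<^sup>2) * (max 0 (quad R x))\<^sup>2) *\<^sub>R v)"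
    by (intro continuous_intros)
qed

lemma quad_bounds:
  fixes x :: "'a::euclidean_space"
  assumes "R > 0"
  shows "max 0 (quad R x) \<le> 1" "R \<le> norm x \<Longrightarrow> max 0 (quad R x) = 0" "norm x < R \<Longrightarrow> quad R x > 0"
proof -
  have q: "quad R x = 1 - (norm x / R)\<^sup>2" by (simp add: quad_def power_divide dot_square_norm)
  show "max 0 (quad R x) \<le> 1" by (simp add: q)
  show "max 0 (quad R x) = 0" if "R \<le> norm x"
  proof -
    have "1 \<le> norm x / R" using that assms by simp
    then have "1 \<le> (norm x / R)\<^sup>2" by (rule one_le_power)
    then show ?thesis by (simp add: q)
  qed
  show "quad R x > 0" if "norm x < R"
  proof -
    have "norm x / R < 1" "0 \<le> norm x / R" using that assms by auto
    then have "(norm x / R)\<^sup>2 < 1" by (simp add: power_less_one_iff abs_square_less_1)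
    then show ?thesis by (simp add: q)
  qed
qed

lemma bump_bounds:
  fixes x :: "'a::euclidean_space"
  assumes "R > 0"
  shows "0 \<le> bump R x" "bump R x \<le> 1" "vanishes_outside R (bump R :: 'a \<Rightarrow> real)" "vanishes_outside R (bump_grad R :: 'a \<Rightarrow> 'a)"
    "norm (bump_grad R x) \<le> 6 / R" "norm x < R \<Longrightarrow> bump R x > 0"
proof -
  show "0 \<le> bump R x" by (simp add: bump_def)
  show "bump R x \<le> 1" unfolding bump_def using quad_bounds(1)[OF assms] by (intro power_le_one) auto
  show "vanishes_outside R (bump R :: 'a \<Rightarrow> real)" "vanishes_outside R (bump_grad R :: 'a \<Rightarrow> 'a)"
    using quad_bounds(2)[OF assms, where 'a='a] by (auto simp: vanishes_outside_def bump_def bump_grad_def)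
  show "norm x < R \<Longrightarrow> bump R x > 0" unfolding bump_def
    using quad_bounds(3)[OF assms, of x] by (simp add: less_max_iff_disj)
  show "norm (bump_grad R x) \<le> 6 / R"
  proof (cases "R \<le> norm x")
    case True
    then show ?thesis using quad_bounds(2)[OF assms, of x] assms by (simp add: bump_grad_def)
  next
    case False
    have "(max 0 (quad R x))\<^sup>2 \<le> 1" using quad_bounds(1)[OF assms] by (intro power_le_one) auto
    then have "(max 0 (quad R x))\<^sup>2 * norm x \<le> 1 * R" using False by (intro mult_mono) auto
    then have "6 / R\<^sup>2 * ((max 0 (quad R x))\<^sup>2 * norm x) \<le> 6 / R\<^sup>2 * R"
      by (intro mult_left_mono) auto
    then show ?thesis using assms by (simp add: bump_grad_def power2_eq_square abs_mult mult_ac)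
  qed
qed

lemma bump_integral_pos:
  assumes "R > 0"
  shows "(\<integral>x. bump R (x::'a::euclidean_space) \<partial>lborel) > 0"
proof -
  have bi: "integrable lborel (bump R :: 'a \<Rightarrow> real)"
    using C1_continuous[OF C1_bump] bump_bounds(3)[OF assms] by (rule integrable_continuous_vanishing)
  have "\<not> (AE x in lborel. bump R (x::'a) = 0)"
  proof
    assume "AE x in lborel. bump R (x::'a) = 0"
    then have "AE x in lborel. x \<notin> ball (0::'a) R"
    proof (rule eventually_mono)
      fix x :: 'a assume "bump R x = 0"
      then show "x \<notin> ball 0 R" using bump_bounds(6)[OF assms, of x] by auto
    qed
    then have "ball (0::'a) R \<in> null_sets lborel" by (simp add: AE_iff_null_sets)
    then have "measure lborel (ball (0::'a) R) = 0" by (simp add: measure_eq_0_null_sets)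
    then show False using assms by simp
  qed
  moreover have "(\<integral>x. bump R (x::'a) \<partial>lborel) \<ge> 0" using bump_bounds(1)[OF assms, where 'a='a] by simp
  moreover have "(\<integral>x. bump R (x::'a) \<partial>lborel) \<noteq> 0"
    using integral_nonneg_eq_0_iff_AE[OF bi] bump_bounds(1)[OF assms, where 'a='a] calculation(1) by simp
  ultimately show ?thesis by linarith
qed

text \<open>On the ball of radius \<open>r\<close> the bump is at least the cube of the positive
  part of \<open>1 - r^2 / R^2\<close>, which tends to 1. Truncation by large bumps therefore loses
  nothing in the limit.\<close>

lemma bump_at_top:
  fixes r c :: real
  assumes "c < 1"
  shows "\<forall>\<^sub>F R in at_top. \<forall>x\<in>cball (0::'a::euclidean_space) r. c < bump R x"
proof -
  have "((\<lambda>R::real. r\<^sup>2 / R\<^sup>2) \<longlongrightarrow> 0) at_top"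
    by (intro tendsto_divide_0 tendsto_const filterlim_at_top_imp_at_infinity filterlim_pow_at_top filterlim_ident) auto
  then have "((\<lambda>R. (max 0 (1 - r\<^sup>2 / R\<^sup>2)) ^ 3) \<longlongrightarrow> (max 0 (1 - 0)) ^ 3) at_top"
    by (intro tendsto_intros)
  then have "\<forall>\<^sub>F R in at_top. c < (max 0 (1 - r\<^sup>2 / R\<^sup>2)) ^ 3"
    using assms by (intro order_tendstoD(1)) auto
  then show ?thesis
  proof (rule eventually_mono, intro ballI)
    fix R and x :: 'a assume R: "c < (max 0 (1 - r\<^sup>2 / R\<^sup>2)) ^ 3" and x: "x \<in> cball 0 r"
    have "norm x ^ 2 \<le> r ^ 2" using x by (intro power_mono) auto
    then have "1 - r\<^sup>2 / R\<^sup>2 \<le> quad R x" by (simp add: quad_def dot_square_norm divide_right_mono)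
    then have "(max 0 (1 - r\<^sup>2 / R\<^sup>2)) ^ 3 \<le> bump R x" unfolding bump_def by (intro power_mono) auto
    then show "c < bump R x" using R by linarith
  qed
qed

definition mollifier :: "real \<Rightarrow> 'a::euclidean_space \<Rightarrow> real" where
  "mollifier \<epsilon> x = bump \<epsilon> x / (\<integral>x. bump \<epsilon> (x::'a) \<partial>lborel)"

definition mollifier_grad :: "real \<Rightarrow> 'a::euclidean_space \<Rightarrow> 'a" where
  "mollifier_grad \<epsilon> x = (1 / (\<integral>x. bump \<epsilon> (x::'a) \<partial>lborel)) *\<^sub>R bump_grad \<epsilon> x"

lemma C1_scaleR_const:
  assumes "C1 f f'"
  shows "C1 (\<lambda>x. c *\<^sub>R f x) (\<lambda>x v. c *\<^sub>R f' x v)"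
  using assms unfolding C1_def by (auto intro!: derivative_intros continuous_intros)

lemma C1_mollifier: "C1 (mollifier \<epsilon>) (\<lambda>x v. mollifier_grad \<epsilon> x \<bullet> v)"
  using C1_scaleR_const[OF C1_bump, of "1 / (\<integral>x. bump \<epsilon> (x::'a) \<partial>lborel)" \<epsilon>]
  unfolding mollifier_def[abs_def] mollifier_grad_def by simp

lemma C1_mollifier_grad:
  "\<exists>D. C1 (mollifier_grad \<epsilon>) D"
  unfolding mollifier_grad_def[abs_def] using C1_scaleR_const[OF C1_bump_grad] by blast

lemma mollifier_bounds:
  fixes x :: "'a::euclidean_space"
  assumes "\<epsilon> > 0"
  shows "0 \<le> mollifier \<epsilon> x" "vanishes_outside \<epsilon> (mollifier \<epsilon> :: 'a \<Rightarrow> real)"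
    "vanishes_outside \<epsilon> (mollifier_grad \<epsilon> :: 'a \<Rightarrow> 'a)"
    "(\<integral>x. mollifier \<epsilon> (x::'a) \<partial>lborel) = 1" "integrable lborel (mollifier \<epsilon> :: 'a \<Rightarrow> real)"
    "mollifier \<epsilon> \<in> borel_measurable (borel :: 'a measure)"
proof -
  note Z = bump_integral_pos[OF assms, where 'a='a]
  show "0 \<le> mollifier \<epsilon> x" using bump_bounds(1)[OF assms, of x] Z by (simp add: mollifier_def less_imp_le)
  show v: "vanishes_outside \<epsilon> (mollifier \<epsilon> :: 'a \<Rightarrow> real)" "vanishes_outside \<epsilon> (mollifier_grad \<epsilon> :: 'a \<Rightarrow> 'a)"
    using bump_bounds(3,4)[OF assms, where 'a='a] by (auto simp: vanishes_outside_def mollifier_def mollifier_grad_def)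
  show "(\<integral>x. mollifier \<epsilon> (x::'a) \<partial>lborel) = 1" using Z by (simp add: mollifier_def)
  show "integrable lborel (mollifier \<epsilon> :: 'a \<Rightarrow> real)"
    using C1_continuous[OF C1_mollifier] v(1) by (rule integrable_continuous_vanishing)
  show "mollifier \<epsilon> \<in> borel_measurable (borel :: 'a measure)"
    using C1_continuous[OF C1_mollifier] by (rule borel_measurable_continuous_onI)
qed

lemma conv_mollifier_nonneg:
  fixes x :: "'a::euclidean_space"
  assumes "\<epsilon> > 0" "\<And>x. 0 \<le> u x"
  shows "0 \<le> conv u (mollifier \<epsilon>) x"
  unfolding conv_def using assms mollifier_bounds(1)[OF assms(1), where 'a='a] by (simp add: integral_nonneg_AE)

text \<open>Fubini moves the mollifier to the test function: the integral is an average, weighted by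
  \<open>mollifier \<epsilon> z\<close>, of the integrals of \<open>u\<close> against the translates
  \<open>k (x + z)\<close>. A bound uniform in \<open>z\<close> thus survives mollification.\<close>

lemma conv_mollifier_integral_le:
  fixes u k :: "'a::euclidean_space \<Rightarrow> real"
  assumes e: "\<epsilon> > 0" and u: "u \<in> borel_measurable borel" "\<And>x. 0 \<le> u x" "\<And>x. u x \<le> 1"
    and k: "continuous_on UNIV k" "vanishes_outside R k"
    and C: "\<And>z. (\<integral>x. u x * k (x + z) \<partial>lborel) \<le> C"
  shows "(\<integral>x. conv u (mollifier \<epsilon>) x * k x \<partial>lborel) \<le> C"
proof -
  let ?\<rho> = "mollifier \<epsilon> :: 'a \<Rightarrow> real"
  note [measurable] = u(1) mollifier_bounds(6)[OF e]
  have [measurable]: "k \<in> borel_measurable borel" using k(1) by (rule borel_measurable_continuous_onI)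
  obtain B where B: "B > 0" "\<And>x. norm (k x) \<le> B" using vanishing_bounded[OF k] by metis
  obtain P where P: "P > 0" "\<And>x. norm (?\<rho> x) \<le> P"
    using vanishing_bounded[OF C1_continuous[OF C1_mollifier] mollifier_bounds(2)[OF e]] by metis
  have c: "conv u ?\<rho> x = (\<integral>z. u (x - z) * ?\<rho> z \<partial>lborel)" for x
  proof -
    have "(\<lambda>y. u y *\<^sub>R ?\<rho> (x - y)) \<in> borel_measurable borel" by measurable
    from integral_reflect[OF this, of x] show ?thesis by (simp add: conv_def)
  qed
  define F where "F x z = u (x - z) * ?\<rho> z * k x" for x z
  have Fb: "norm (F x z) \<le> P * B" for x z
  proof -
    have "norm (F x z) = \<bar>u (x - z)\<bar> * norm (?\<rho> z) * norm (k x)" by (simp add: F_def abs_mult)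
    also have "\<dots> \<le> 1 * P * B"
      using u(2,3)[of "x - z"] P B by (intro mult_mono mult_nonneg_nonneg) auto
    finally show ?thesis by simp
  qed
  have Fi: "integrable (lborel \<Otimes>\<^sub>M lborel) (\<lambda>(x, z). F x z)"
    unfolding lborel_prod
  proof (rule integrable_vanishing)
    show "norm (case p of (x, z) \<Rightarrow> F x z) \<le> P * B" for p using Fb by (simp add: case_prod_unfold)
    have "(\<lambda>(x, z). F x z) \<in> borel_measurable (borel \<Otimes>\<^sub>M borel)" unfolding F_def by measurable
    then show "(\<lambda>(x, z). F x z) \<in> borel_measurable borel" by (simp add: borel_prod)
    show "vanishes_outside (R + \<epsilon>) (\<lambda>(x, z). F x z)"
      unfolding vanishes_outside_def
    proof (intro allI impI)
      fix p :: "'a \<times> 'a" assume "R + \<epsilon> < norm p"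
      moreover obtain x z where p: "p = (x, z)" by (cases p)
      moreover have "norm (x, z) \<le> norm x + norm z" by (rule norm_Pair_le)
      ultimately have "R < norm x \<or> \<epsilon> < norm z" by auto
      then show "(case p of (x, z) \<Rightarrow> F x z) = 0"
        using k(2) mollifier_bounds(2)[OF e, where 'a='a] by (auto simp: p F_def vanishes_outside_def)
    qed
  qed
  have "(\<integral>x. conv u ?\<rho> x * k x \<partial>lborel) = (\<integral>x. (\<integral>z. F x z \<partial>lborel) \<partial>lborel)"
    by (simp add: c F_def)
  also have "\<dots> = (\<integral>z. (\<integral>x. F x z \<partial>lborel) \<partial>lborel)"
    by (rule lborel_pair.Fubini_integral[OF Fi, symmetric])
  also have "\<dots> \<le> (\<integral>z. C * ?\<rho> z \<partial>lborel)"
  proof (rule Bochner_Integration.integral_mono)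
    show "integrable lborel (\<lambda>z. \<integral>x. F x z \<partial>lborel)"
      using lborel_pair.integrable_snd[OF Fi] .
    show "integrable lborel (\<lambda>z. C * ?\<rho> z)" by (rule integrable_mult_right[OF mollifier_bounds(5)[OF e]])
    fix z
    have "(\<lambda>x. u (x - z) * k x) \<in> borel_measurable borel" by measurable
    from integral_translate[OF this, of z] have "(\<integral>x. u (x - z) * k x \<partial>lborel) = (\<integral>x. u x * k (x + z) \<partial>lborel)"
      by (simp add: add.commute)
    then have *: "(\<integral>x. u (x - z) * k x \<partial>lborel) \<le> C" using C[of z] by simp
    have "(\<integral>x. F x z \<partial>lborel) = ?\<rho> z * (\<integral>x. u (x - z) * k x \<partial>lborel)"
      by (simp add: F_def mult_ac flip: integral_mult_right_zero)
    also have "\<dots> \<le> ?\<rho> z * C" using * mollifier_bounds(1)[OF e] by (intro mult_left_mono) auto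
    finally show "(\<integral>x. F x z \<partial>lborel) \<le> C * ?\<rho> z" by (simp add: mult.commute)
  qed
  also have "\<dots> = C" using mollifier_bounds(4)[OF e, where 'a='a] by simp
  finally show ?thesis .
qed

text \<open>The \<delta> under the root keeps the regularised direction \<open>- G / norm G\<close>
  of class C1 where \<open>G\<close> vanishes.\<close>

lemma C1_normalise:
  assumes G: "C1 G D" and d: "\<delta> > 0"
  shows "\<exists>D'. C1 (\<lambda>x. (- (1 / sqrt (\<delta>\<^sup>2 + G x \<bullet> G x))) *\<^sub>R G x) D'"
proof -
  let ?s = "\<lambda>x. sqrt (\<delta>\<^sup>2 + G x \<bullet> G x)"
  have pos: "\<delta>\<^sup>2 + G x \<bullet> G x > 0" for x using d by (intro add_pos_nonneg) auto
  then have spos: "?s x > 0" for x by simp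
  have "C1 (\<lambda>x. - (1 / ?s x)) (\<lambda>x v. (G x \<bullet> D x v) / (?s x) ^ 3)"
    unfolding C1_def
  proof (intro conjI allI)
    fix x
    have "((\<lambda>x. \<delta>\<^sup>2 + G x \<bullet> G x) has_derivative (\<lambda>v. 2 * (G x \<bullet> D x v))) (at x)"
      by (rule derivative_eq_intros C1_D(1)[OF G] refl | simp add: inner_commute)+
    from has_derivative_real_sqrt[where g="\<lambda>x. \<delta>\<^sup>2 + G x \<bullet> G x" and x=x, OF pos[of x] this]
    have "(?s has_derivative (\<lambda>v. (2 * (G x \<bullet> D x v)) * (1 / (2 * ?s x)))) (at x)"
      by (simp add: field_simps)
    then have h: "((\<lambda>x. - inverse (?s x)) has_derivative (\<lambda>v. - (- (inverse (?s x) * ((2 * (G x \<bullet> D x v)) * (1 / (2 * ?s x))) * inverse (?s x))))) (at x)"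
      using spos[of x] by (intro has_derivative_minus Deriv.has_derivative_inverse) auto
    have eq: "(\<lambda>v. - (- (inverse (?s x) * ((2 * (G x \<bullet> D x v)) * (1 / (2 * ?s x))) * inverse (?s x)))) = (\<lambda>v. (G x \<bullet> D x v) / (?s x) ^ 3)"
      using spos[of x] by (simp add: fun_eq_iff field_simps power3_eq_cube)
    show "((\<lambda>x. - (1 / ?s x)) has_derivative (\<lambda>v. (G x \<bullet> D x v) / (?s x) ^ 3)) (at x)"
      using h[unfolded eq] by (simp only: inverse_eq_divide)
    fix v
    have "continuous_on UNIV G" using C1_continuous[OF G] .
    then show "continuous_on UNIV (\<lambda>x. (G x \<bullet> D x v) / (?s x) ^ 3)"
      using spos C1_D(2)[OF G, of v] by (intro continuous_intros) (auto simp: less_imp_neq[THEN not_sym])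
  qed
  from C1_scaleR[OF this G] show ?thesis by blast
qed

section \<open>The isoperimetric inequality for functions\<close>

lemma C1_add:
  assumes "C1 f f'" "C1 g g'"
  shows "C1 (\<lambda>x. f x + g x) (\<lambda>x v. f' x v + g' x v)"
  using assms unfolding C1_def by (auto intro!: derivative_intros continuous_intros)

text \<open>The price of the regularisation: testing with the normalised field recovers
  \<open>norm (G x)\<close> up to \<delta>.\<close>

lemma square_over_sqrt_lower_bound:
  fixes w \<delta> :: real
  assumes "\<delta> > 0" "w \<ge> 0"
  shows "w - \<delta> \<le> w\<^sup>2 / sqrt (\<delta>\<^sup>2 + w\<^sup>2)"
proof -
  have s: "sqrt (\<delta>\<^sup>2 + w\<^sup>2) \<le> \<delta> + w" "sqrt (\<delta>\<^sup>2 + w\<^sup>2) > 0"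
    using assms by (auto simp: sqrt_sum_squares_le_sum intro!: add_pos_nonneg)
  have "(w - \<delta>) * (\<delta> + w) \<le> w\<^sup>2" by (simp add: algebra_simps power2_eq_square)
  then have "w - \<delta> \<le> w\<^sup>2 / (\<delta> + w)" using assms by (simp add: pos_le_divide_eq)
  also have "\<dots> \<le> w\<^sup>2 / sqrt (\<delta>\<^sup>2 + w\<^sup>2)" using s assms by (intro divide_left_mono mult_pos_pos) auto
  finally show ?thesis .
qed

text \<open>Testing the truncated mollification with a field \<phi> amounts to testing
  \<open>u\<close> with translates of \<open>bump R\<close> times \<phi>, up to a term with the
  gradient of the bump, which is at most \<open>6 / R\<close>. With \<phi> the regularised
  \<open>- G / norm G\<close> this controls the whole gradient integral.\<close>

lemma mollified_gradient_bound:
  fixes u :: "'a::euclidean_space \<Rightarrow> real"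
  assumes u: "u \<in> borel_measurable borel" "\<And>x. 0 \<le> u x" "\<And>x. u x \<le> 1" "integrable lborel u"
    and M: "\<And>\<phi>. \<lbrakk>C1_compact_support \<phi>; \<And>x. norm (\<phi> x) \<le> 1\<rbrakk> \<Longrightarrow> (\<integral>x. u x * divergence \<phi> x \<partial>lborel) \<le> M"
    and e: "\<epsilon> > 0" and R: "R > 0"
  shows "\<exists>G. C1 (\<lambda>x. bump R x *\<^sub>R conv u (mollifier \<epsilon>) x) (\<lambda>x v. G x \<bullet> v) \<and> continuous_on UNIV G \<and> vanishes_outside R G
    \<and> (\<integral>x. norm (G x) \<partial>lborel) \<le> M + 6 / R * (\<integral>x. u x \<partial>lborel)"
proof -
  define f where "f = conv u (mollifier \<epsilon>)"
  define F where "F = conv u (mollifier_grad \<epsilon>)"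
  have u1: "\<bar>u x\<bar> \<le> 1" for x using u(2,3)[of x] by simp
  note vm = mollifier_bounds(2)[OF e, where 'a='a] and vg = mollifier_bounds(3)[OF e, where 'a='a]
  obtain D0 where D0: "C1 (mollifier_grad \<epsilon> :: 'a \<Rightarrow> 'a) D0" using C1_mollifier_grad by metis
  have fF: "C1 f (\<lambda>x v. F x \<bullet> v)"
  proof -
    have "conv u (\<lambda>z. mollifier_grad \<epsilon> z \<bullet> v) x = F x \<bullet> v" for x v
    proof -
      have "conv u (\<lambda>z. mollifier_grad \<epsilon> z \<bullet> v) x = (\<integral>y. (u y *\<^sub>R mollifier_grad \<epsilon> (x - y)) \<bullet> v \<partial>lborel)"
        by (simp add: conv_def)
      also have "\<dots> = (\<integral>y. u y *\<^sub>R mollifier_grad \<epsilon> (x - y) \<partial>lborel) \<bullet> v"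
        by (rule integral_inner_left, rule conv_integrable[OF u(1) u1 C1_continuous[OF D0] vg])
      finally show ?thesis by (simp add: F_def conv_def)
    qed
    then show ?thesis using C1_conv[OF u(1) u1 C1_mollifier vm] by (simp add: f_def)
  qed
  obtain DF where DF: "C1 F DF" using C1_conv[OF u(1) u1 D0 vg] unfolding F_def by blast
  define g where "g x = bump R x *\<^sub>R f x" for x
  define G where "G x = bump R x *\<^sub>R F x + f x *\<^sub>R bump_grad R x" for x
  obtain DG where DG: "C1 G DG"
    using C1_add[OF C1_scaleR[OF C1_bump DF] C1_scaleR[OF fF C1_bump_grad]] unfolding G_def[abs_def] by blast
  have gG: "C1 g (\<lambda>x v. G x \<bullet> v)"
  proof -
    have "C1 g (\<lambda>x v. bump R x *\<^sub>R (F x \<bullet> v) + (bump_grad R x \<bullet> v) *\<^sub>R f x)"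
      unfolding g_def[abs_def] by (rule C1_scaleR[OF C1_bump fF])
    then show ?thesis by (simp add: G_def inner_add_left mult.commute)
  qed
  note bb = bump_bounds[OF R, where 'a='a]
  have vG: "vanishes_outside R G" using bb(3,4) by (simp add: G_def vanishes_outside_def)
  have cG: "continuous_on UNIV G" by (rule C1_continuous[OF DG])
  have cf: "continuous_on UNIV f" by (rule C1_continuous[OF fF])
  let ?K = "M + 6 / R * (\<integral>x. u x \<partial>lborel)"
  have iG: "integrable lborel (\<lambda>x. norm (G x))"
    by (intro integrable_norm integrable_continuous_vanishing[OF cG vG])
  have step: "(\<integral>x. norm (G x) \<partial>lborel) \<le> ?K + \<delta> * measure lborel (cball (0::'a) R)" if d: "\<delta> > 0" for \<delta>
  proof -
    let ?s = "\<lambda>x. sqrt (\<delta>\<^sup>2 + G x \<bullet> G x)"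
    define \<phi> where "\<phi> x = (- (1 / ?s x)) *\<^sub>R G x" for x
    obtain D where D: "C1 \<phi> D" using C1_normalise[OF DG d] unfolding \<phi>_def[abs_def] by blast
    have cphi: "continuous_on UNIV \<phi>" by (rule C1_continuous[OF D])
    have v\<phi>: "vanishes_outside R \<phi>" using vG by (simp add: \<phi>_def vanishes_outside_def)
    have spos: "?s x > 0" for x using d by (simp add: add_pos_nonneg)
    have n\<phi>: "norm (\<phi> x) \<le> 1" for x
    proof -
      have "norm (G x) = sqrt (G x \<bullet> G x)" by (rule norm_eq_sqrt_inner)
      also have "\<dots> \<le> ?s x" by simp
      finally show ?thesis using spos[of x] by (simp add: \<phi>_def)
    qed
    note cd = divergence_continuous[OF D] and vd = divergence_vanishes[OF D v\<phi>]
    define \<psi> where "\<psi> x = bump R x *\<^sub>R \<phi> x" for x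
    \<comment> \<open>\<open>k1 + k2\<close> equals \<open>bump R\<close> times
      \<open>divergence \<phi>\<close>: \<open>k1\<close> is the divergence of a competitor, so its
      test is at most \<open>M\<close>, and \<open>k2\<close> is a correction of size at most
      \<open>6 / R\<close>.\<close>
    define k1 where "k1 = divergence \<psi>"
    define k2 where "k2 x = - (bump_grad R x \<bullet> \<phi> x)" for x
    have D\<psi>: "C1 \<psi> (\<lambda>x v. bump R x *\<^sub>R D x v + (bump_grad R x \<bullet> v) *\<^sub>R \<phi> x)"
      unfolding \<psi>_def[abs_def] by (rule C1_scaleR[OF C1_bump D])
    have v\<psi>: "vanishes_outside R \<psi>" using v\<phi> by (simp add: \<psi>_def vanishes_outside_def)
    have S\<psi>: "C1_compact_support \<psi>" by (rule C1_compact_supportI[OF D\<psi> v\<psi>])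
    have n\<psi>: "norm (\<psi> x) \<le> 1" for x
      using mult_mono[OF bb(2)[of x] n\<phi>[of x]] bb(1)[of x] by (simp add: \<psi>_def)
    have k1: "k1 x = bump R x * divergence \<phi> x + bump_grad R x \<bullet> \<phi> x" for x
      unfolding k1_def \<psi>_def[abs_def] by (rule divergence_scaleR[OF C1_bump D])
    have ck1: "continuous_on UNIV k1" "vanishes_outside R k1"
      unfolding k1_def using divergence_continuous[OF D\<psi>] divergence_vanishes[OF D\<psi> v\<psi>] by auto
    have ck2: "continuous_on UNIV k2" "vanishes_outside R k2"
      using cphi C1_continuous[OF C1_bump_grad] v\<phi> by (auto simp: k2_def[abs_def] vanishes_outside_def intro!: continuous_intros)
    have 1: "(\<integral>x. f x * k1 x \<partial>lborel) \<le> M"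
      unfolding f_def
    proof (rule conv_mollifier_integral_le[OF e u(1-3) ck1])
      fix z
      show "(\<integral>x. u x * k1 (x + z) \<partial>lborel) \<le> M"
        using M[OF C1_compact_support_translate(1)[OF S\<psi>, of z] n\<psi>] C1_compact_support_translate(2)[OF S\<psi>]
        by (simp add: k1_def)
    qed
    have 2: "(\<integral>x. f x * k2 x \<partial>lborel) \<le> 6 / R * (\<integral>x. u x \<partial>lborel)"
      unfolding f_def
    proof (rule conv_mollifier_integral_le[OF e u(1-3) ck2])
      fix z
      have k2b: "\<bar>k2 y\<bar> \<le> 6 / R" for y
      proof -
        have "\<bar>k2 y\<bar> \<le> norm (bump_grad R y) * norm (\<phi> y)" unfolding k2_def using Cauchy_Schwarz_ineq2 by simp
        also have "\<dots> \<le> 6 / R * 1" using bb(5)[of y] n\<phi>[of y] R by (intro mult_mono) auto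
        finally show ?thesis by simp
      qed
      have ub: "\<bar>u x * k2 (x + z)\<bar> \<le> 6 / R * u x" for x
        using mult_right_mono[OF k2b u(2)[of x], of "x + z"] u(2)[of x] by (simp add: abs_mult mult.commute)
      have [measurable]: "k2 \<in> borel_measurable borel" using ck2(1) by (rule borel_measurable_continuous_onI)
      note [measurable] = u(1)
      have i2: "integrable lborel (\<lambda>x. 6 / R * u x)" by (rule integrable_mult_right[OF u(4)])
      have i1: "integrable lborel (\<lambda>x. u x * k2 (x + z))"
      proof (rule Bochner_Integration.integrable_bound[OF i2])
        show "AE x in lborel. norm (u x * k2 (x + z)) \<le> norm (6 / R * u x)"
          by (rule AE_I2, simp only: real_norm_def, rule order_trans[OF ub abs_ge_self])
      qed measurable
      have "(\<integral>x. u x * k2 (x + z) \<partial>lborel) \<le> (\<integral>x. 6 / R * u x \<partial>lborel)"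
        by (rule Bochner_Integration.integral_mono[OF i1 i2]) (rule abs_le_D1[OF ub])
      also have "\<dots> = 6 / R * (\<integral>x. u x \<partial>lborel)" by (rule integral_mult_right_zero)
      finally show "(\<integral>x. u x * k2 (x + z) \<partial>lborel) \<le> 6 / R * (\<integral>x. u x \<partial>lborel)" .
    qed
    have ifk: "integrable lborel (\<lambda>x. f x * k x)" if "continuous_on UNIV k" "vanishes_outside R k" for k
    proof (rule integrable_continuous_vanishing)
      show "continuous_on UNIV (\<lambda>x. f x * k x)" using cf that(1) by (intro continuous_intros)
      show "vanishes_outside R (\<lambda>x. f x * k x)" using that(2) by (simp add: vanishes_outside_def)
    qed
    have 3: "(\<integral>x. f x * k1 x \<partial>lborel) + (\<integral>x. f x * k2 x \<partial>lborel) = (\<integral>x. g x * divergence \<phi> x \<partial>lborel)"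
    proof -
      have "(\<integral>x. f x * k1 x \<partial>lborel) + (\<integral>x. f x * k2 x \<partial>lborel) = (\<integral>x. f x * k1 x + f x * k2 x \<partial>lborel)"
        by (rule Bochner_Integration.integral_add[OF ifk[OF ck1] ifk[OF ck2], symmetric])
      also have "(\<lambda>x. f x * k1 x + f x * k2 x) = (\<lambda>x. g x * divergence \<phi> x)"
        by (simp add: k1 k2_def g_def algebra_simps)
      finally show ?thesis .
    qed
    have ig: "integrable lborel (\<lambda>x. g x * divergence \<phi> x)"
    proof (rule integrable_continuous_vanishing)
      show "continuous_on UNIV (\<lambda>x. g x * divergence \<phi> x)" using C1_continuous[OF gG] cd by (intro continuous_intros)
      show "vanishes_outside R (\<lambda>x. g x * divergence \<phi> x)" using vd by (simp add: vanishes_outside_def)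
    qed
    have iGp: "integrable lborel (\<lambda>x. G x \<bullet> \<phi> x)"
    proof (rule integrable_continuous_vanishing)
      show "continuous_on UNIV (\<lambda>x. G x \<bullet> \<phi> x)" using cG cphi by (intro continuous_intros)
      show "vanishes_outside R (\<lambda>x. G x \<bullet> \<phi> x)" using vG by (simp add: vanishes_outside_def)
    qed
    have "C1_compact_support (\<lambda>x. g x *\<^sub>R \<phi> x)"
      using C1_compact_supportI[OF C1_scaleR[OF gG D] vanishes_outside_scaleR[OF v\<phi>]] .
    from integral_divergence[OF this] have "(\<integral>x. g x * divergence \<phi> x + G x \<bullet> \<phi> x \<partial>lborel) = 0"
      by (simp only: divergence_scaleR[OF gG D])
    then have 4: "(\<integral>x. g x * divergence \<phi> x \<partial>lborel) = - (\<integral>x. G x \<bullet> \<phi> x \<partial>lborel)"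
      using ig iGp by simp
    have ic: "integrable lborel (\<lambda>x. \<delta> * indicator (cball 0 R) x :: real)"
      by (rule integrable_mult_right[OF integrable_indicator_cball])
    have pt: "norm (G x) \<le> - (G x \<bullet> \<phi> x) + \<delta> * indicator (cball 0 R) x" for x
    proof (cases "x \<in> cball 0 R")
      case True
      have "- (G x \<bullet> \<phi> x) = (norm (G x))\<^sup>2 / sqrt (\<delta>\<^sup>2 + (norm (G x))\<^sup>2)"
        by (simp add: \<phi>_def dot_square_norm)
      then show ?thesis using square_over_sqrt_lower_bound[OF d norm_ge_zero[of "G x"]] True by simp
    next
      case False
      then have "G x = 0" using vG by (simp add: vanishes_outside_def)
      then show ?thesis using d by simp
    qed
    have "(\<integral>x. norm (G x) \<partial>lborel) \<le> (\<integral>x. - (G x \<bullet> \<phi> x) + \<delta> * indicator (cball 0 R) x \<partial>lborel)"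
      using iGp ic by (intro Bochner_Integration.integral_mono[OF iG _ pt] Bochner_Integration.integrable_add integrable_minus)
    also have "\<dots> = - (\<integral>x. G x \<bullet> \<phi> x \<partial>lborel) + \<delta> * measure lborel (cball (0::'a) R)"
      using iGp ic by simp
    finally show ?thesis using 1 2 3 4 by linarith
  qed
  \<comment> \<open>The error is \<delta> times the volume of the truncation ball, so \<delta> may
    tend to 0 while \<open>R\<close> is fixed.\<close>
  have "(\<integral>x. norm (G x) \<partial>lborel) \<le> ?K"
  proof (rule field_le_epsilon)
    fix r :: real assume r: "0 < r"
    define m where "m = measure lborel (cball (0::'a) R)"
    have "m \<ge> 0" by (simp add: m_def)
    then have "r / (m + 1) * m \<le> r" "r / (m + 1) > 0" using r by (auto simp: field_simps)
    then show "(\<integral>x. norm (G x) \<partial>lborel) \<le> ?K + r" using step[of "r / (m + 1)"] unfolding m_def by linarith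
  qed
  then show ?thesis using gG cG vG unfolding g_def[abs_def] f_def by blast
qed

text \<open>The set where the mollified and truncated \<open>u\<close> exceeds
  \<open>(1 - \<delta>)^2\<close> covers \<open>A\<close> up to a fraction \<delta> of its volume.
  There the lower and the upper bound for the gradient integral meet, and \<delta> tends to 0.
  Stated for a function with a plateau \<open>A\<close>, the inequality applies to indicators
  multiplied by cut-offs.\<close>

theorem isoperimetric_function:
  fixes u :: "'a::euclidean_space \<Rightarrow> real"
  assumes u: "u \<in> borel_measurable borel" "\<And>x. 0 \<le> u x" "\<And>x. u x \<le> 1" "integrable lborel u"
    and A: "A \<in> sets borel" "\<And>x. x \<in> A \<Longrightarrow> u x = 1"
    and M: "\<And>\<phi>. \<lbrakk>C1_compact_support \<phi>; \<And>x. norm (\<phi> x) \<le> 1\<rbrakk> \<Longrightarrow> (\<integral>x. u x * divergence \<phi> x \<partial>lborel) \<le> M"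
  shows "iso_const TYPE('a) * measure lborel A powr ((real DIM('a) - 1) / real DIM('a)) \<le> M"
proof (cases "measure lborel A = 0")
  case True
  have z: "C1 (\<lambda>_::'a. 0 :: 'a) (\<lambda>_ _. 0)" by (auto simp: C1_def)
  have "C1_compact_support (\<lambda>_::'a. 0 :: 'a)"
    by (rule C1_compact_supportI[OF z, of 0]) (simp add: vanishes_outside_def)
  moreover have "divergence (\<lambda>_::'a. 0 :: 'a) x = 0" for x using divergence_C1[OF z] by simp
  ultimately have "0 \<le> M" using M[of "\<lambda>_. 0"] by simp
  then show ?thesis using True by simp
next
  case False
  define m where "m = measure lborel A"
  have m: "m > 0" using False by (simp add: m_def zero_less_measure_iff)
  have Afin: "emeasure lborel A < \<infinity>"
  proof -
    have "emeasure lborel A = (\<integral>\<^sup>+x. indicator A x \<partial>lborel)" using A(1) by simp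
    also have "\<dots> \<le> (\<integral>\<^sup>+x. ennreal (norm (u x)) \<partial>lborel)"
      by (intro nn_integral_mono) (auto simp: A(2) split: split_indicator)
    also have "\<dots> < \<infinity>" using u(4) by (simp add: integrable_iff_bounded)
    finally show ?thesis .
  qed
  let ?a = "(real DIM('a) - 1) / real DIM('a)" and ?c = "iso_const TYPE('a)"
  have claim: "(1 - \<delta>)\<^sup>2 * ?c * ((1 - \<delta>) * m) powr ?a \<le> M + \<delta>" if d: "0 < \<delta>" "\<delta> < 1" for \<delta>
  proof -
    \<comment> \<open>\<tau> controls two losses: the part of \<open>A\<close> cut away near the
      complement of \<open>U\<close> and near infinity, at most \<tau>, and the exceptional set
      \<open>S\<close>, at most \<open>\<tau> / (\<delta> * (1 - \<delta>))\<close>. Together they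
      are at most \<open>\<delta> * m\<close>.\<close>
    define \<tau> where "\<tau> = \<delta>\<^sup>2 * (1 - \<delta>) * m / 2"
    have t: "\<tau> > 0" using d m by (simp add: \<tau>_def)
    have nz: "\<delta> * (1 - \<delta>) \<noteq> 0" using d by simp
    have "\<tau> = (\<delta> * (1 - \<delta>)) * (\<delta> * m / 2)" by (simp add: \<tau>_def power2_eq_square)
    then have "\<tau> / (\<delta> * (1 - \<delta>)) = \<delta> * m / 2" using nonzero_mult_div_cancel_left[OF nz] by metis
    moreover have "\<tau> \<le> \<delta> * m / 2"
    proof -
      have "\<delta> * (1 - \<delta>) \<le> 1 * 1" using d by (intro mult_mono) auto
      then have "\<delta> * (1 - \<delta>) * (\<delta> * m) \<le> 1 * (\<delta> * m)" using d m by (intro mult_right_mono) auto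
      then show ?thesis by (simp add: \<tau>_def power2_eq_square algebra_simps)
    qed
    ultimately have tb: "\<tau> + \<tau> / (\<delta> * (1 - \<delta>)) \<le> \<delta> * m" by linarith
    obtain U where U: "open U" "A \<subseteq> U" "(U - A) \<in> lmeasurable" "emeasure lebesgue (U - A) < ennreal \<tau>"
      using sets_lebesgue_outer_open[of A \<tau>] A(1) t by auto
    have UA: "U - A \<in> sets borel" using U A by auto
    have UAm: "emeasure lborel (U - A) < ennreal \<tau>" using U(4) UA by simp
    \<comment> \<open>\<open>A' j\<close> collects the points of \<open>A\<close> within distance
      \<open>j\<close> of the origin and at distance at least \<open>1 / real (Suc j)\<close> from
      the complement of \<open>U\<close>; since \<open>U\<close> is open, these sets exhaust
      \<open>A\<close>.\<close>
    define N where "N j = (\<Union>y\<in>-U. ball y (1 / real (Suc j)))" for j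
    define A' where "A' j = A \<inter> cball 0 (real j) \<inter> - N j" for j
    have A's: "A' j \<in> sets lborel" for j
    proof -
      have "open (N j)" unfolding N_def by auto
      then show ?thesis using A(1) by (auto simp: A'_def)
    qed
    have UnA: "(\<Union>j. A' j) = A"
    proof
      show "A \<subseteq> (\<Union>j. A' j)"
      proof
        fix x assume x: "x \<in> A"
        then obtain r where r: "r > 0" "ball x r \<subseteq> U" using U(1,2) openE by blast
        obtain j0 :: nat where j0: "1 / r < real j0" using reals_Archimedean2 by blast
        obtain j1 :: nat where j1: "norm x < real j1" using reals_Archimedean2 by blast
        let ?j = "max j0 j1"
        have "1 / r < real (Suc ?j)" using j0 by linarith
        then have "1 / real (Suc ?j) < r" using r(1) by (simp add: field_simps)
        then have "x \<notin> N ?j" using r(2) unfolding N_def by (force simp: dist_commute)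
        then have "x \<in> A' ?j" using x j1 by (simp add: A'_def)
        then show "x \<in> (\<Union>j. A' j)" by blast
      qed
    qed (auto simp: A'_def)
    have "incseq A'"
    proof (rule incseq_SucI)
      fix j
      have "1 / real (Suc (Suc j)) \<le> 1 / real (Suc j)" by (simp add: field_simps)
      then have "N (Suc j) \<subseteq> N j" unfolding N_def by (intro UN_mono subset_ball) auto
      then show "A' j \<subseteq> A' (Suc j)" unfolding A'_def by auto
    qed
    then have "(\<lambda>j. measure lborel (A' j)) \<longlonglongrightarrow> measure lborel (\<Union>j. A' j)"
      using A's Afin UnA by (intro Lim_measure_incseq) auto
    then have "\<forall>\<^sub>F j in sequentially. m - \<tau> < measure lborel (A' j)"
      using t by (intro order_tendstoD(1)) (auto simp: UnA m_def)
    then obtain j where j: "m - \<tau> < measure lborel (A' j)" by (auto simp: eventually_sequentially)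
    \<comment> \<open>Half of that distance, so that the closed \<epsilon>-ball about each point of
      \<open>A' j\<close> stays in \<open>U\<close>.\<close>
    define \<epsilon> where "\<epsilon> = 1 / real (Suc j) / 2"
    have e: "\<epsilon> > 0" by (simp add: \<epsilon>_def)
    have near: "y \<in> U" if "x \<in> A' j" "norm (x - y) \<le> \<epsilon>" for x y
    proof (rule ccontr)
      assume "y \<notin> U"
      moreover have "dist y x < 1 / real (Suc j)"
        using that(2) by (simp add: \<epsilon>_def dist_norm norm_minus_commute field_simps)
      ultimately have "x \<in> N j" unfolding N_def by auto
      then show False using that(1) by (simp add: A'_def)
    qed
    define I where "I = (\<integral>x. u x \<partial>lborel)"
    have I0: "I \<ge> 0" using u(2) by (simp add: I_def)
    \<comment> \<open>\<open>R\<close> is chosen last: large enough for the bump to exceed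
      \<open>1 - \<delta>\<close> on the ball that contains \<open>A' j\<close>, and for the
      truncation error \<open>6 / R * I\<close> to be at most \<delta>.\<close>
    obtain R where R: "R > 0" "\<forall>x\<in>cball (0::'a) (real j). 1 - \<delta> < bump R x" "6 / R * I \<le> \<delta>"
    proof -
      have "\<forall>\<^sub>F R in at_top. R > 0 \<and> (\<forall>x\<in>cball (0::'a) (real j). 1 - \<delta> < bump R x) \<and> R \<ge> 6 * I / \<delta>"
        using d by (intro eventually_conj eventually_gt_at_top bump_at_top eventually_ge_at_top) auto
      then obtain R where "R > 0" "\<forall>x\<in>cball (0::'a) (real j). 1 - \<delta> < bump R x" "R \<ge> 6 * I / \<delta>"
        by (auto simp: eventually_at_top_linorder)
      then show ?thesis using d that[of R] by (simp add: field_simps)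
    qed
    note bb = bump_bounds[OF R(1), where 'a='a]
    define f where "f = conv u (mollifier \<epsilon>)"
    \<comment> \<open>On \<open>U\<close> the sum of \<open>u\<close> and \<open>v\<close> is at
      least 1. So where the mollification of \<open>u\<close> stays below
      \<open>1 - \<delta>\<close>, that of \<open>v\<close>, whose integral is small, exceeds
      \<delta>.\<close>
    define v where "v = (indicator (U - A) :: 'a \<Rightarrow> real)"
    define fv where "fv = conv v (mollifier \<epsilon>)"
    have u1: "\<bar>u x\<bar> \<le> 1" for x using u(2,3)[of x] by simp
    have v: "v \<in> borel_measurable borel" "\<And>x. 0 \<le> v x" "\<And>x. v x \<le> 1" "\<And>x. \<bar>v x\<bar> \<le> 1"
      using UA by (auto simp: v_def indicator_def)
    note cm = C1_continuous[OF C1_mollifier] and vm = mollifier_bounds(2)[OF e, where 'a='a]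
    have cf: "continuous_on UNIV f" unfolding f_def by (rule conv_continuous[OF u(1) u1 cm vm])
    have cfv: "continuous_on UNIV fv" unfolding fv_def by (rule conv_continuous[OF v(1,4) cm vm])
    have f0: "f x \<ge> 0" for x unfolding f_def by (rule conv_mollifier_nonneg[OF e u(2)])
    have fv0: "fv x \<ge> 0" for x unfolding fv_def by (rule conv_mollifier_nonneg[OF e v(2)])
    have vi: "integrable lborel v" unfolding v_def using UAm UA
      by (intro integrable_real_indicator) (auto intro: order.strict_trans simp: less_top[symmetric])
    have vI: "(\<integral>x. v x \<partial>lborel) \<le> \<tau>"
    proof -
      have "(\<integral>x. v x \<partial>lborel) = measure lborel (U - A)" unfolding v_def using UA by simp
      also have "\<dots> \<le> \<tau>" using UAm t by (simp add: measure_def enn2real_leI less_imp_le)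
      finally show ?thesis .
    qed
    have ivb: "(\<integral>x. fv x * bump R x \<partial>lborel) \<le> \<tau>"
      unfolding fv_def
    proof (rule conv_mollifier_integral_le[OF e v(1-3) C1_continuous[OF C1_bump] bb(3)])
      fix z
      have le: "v x * bump R (x + z) \<le> v x" for x using bb(1,2)[of "x + z"] v(2)[of x] by (simp add: mult_left_le)
      have [measurable]: "bump R \<in> borel_measurable (borel :: 'a measure)"
        using C1_continuous[OF C1_bump] by (rule borel_measurable_continuous_onI)
      note [measurable] = v(1)
      have "integrable lborel (\<lambda>x. v x * bump R (x + z))"
      proof (rule Bochner_Integration.integrable_bound[OF vi])
        show "AE x in lborel. norm (v x * bump R (x + z)) \<le> norm (v x)"
          using le v(2) bb(1) by (intro AE_I2) (simp add: abs_mult)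
      qed measurable
      then have "(\<integral>x. v x * bump R (x + z) \<partial>lborel) \<le> (\<integral>x. v x \<partial>lborel)"
        by (rule Bochner_Integration.integral_mono[OF _ vi le])
      then show "(\<integral>x. v x * bump R (x + z) \<partial>lborel) \<le> \<tau>" using vI by linarith
    qed
    have ifv: "integrable lborel (\<lambda>x. fv x * bump R x)"
    proof (rule integrable_continuous_vanishing)
      show "continuous_on UNIV (\<lambda>x. fv x * bump R x)" using cfv C1_continuous[OF C1_bump] by (intro continuous_intros)
      show "vanishes_outside R (\<lambda>x. fv x * bump R x)" using bb(3) by (simp add: vanishes_outside_def)
    qed
    define S where "S = A' j \<inter> {x. f x \<le> 1 - \<delta>}"
    have Ss: "S \<in> sets lborel"
    proof -
      have "closed {x. f x \<le> 1 - \<delta>}" using cf by (intro closed_Collect_le) (auto intro: continuous_intros)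
      then show ?thesis using A's[of j] by (auto simp: S_def)
    qed
    have Sfv: "\<delta> \<le> fv x" if x: "x \<in> S" for x
    proof -
      have "1 = (\<integral>y. mollifier \<epsilon> (x - y) \<partial>lborel)"
        using integral_reflect[OF mollifier_bounds(6)[OF e], of x] mollifier_bounds(4)[OF e, where 'a='a] by simp
      also have "\<dots> \<le> (\<integral>y. u y *\<^sub>R mollifier \<epsilon> (x - y) + v y *\<^sub>R mollifier \<epsilon> (x - y) \<partial>lborel)"
      proof (rule Bochner_Integration.integral_mono)
        show "integrable lborel (\<lambda>y. mollifier \<epsilon> (x - y))"
          using conv_integrable[of "\<lambda>_. 1", OF _ _ cm vm, of x] by simp
        show "integrable lborel (\<lambda>y. u y *\<^sub>R mollifier \<epsilon> (x - y) + v y *\<^sub>R mollifier \<epsilon> (x - y))"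
          by (intro Bochner_Integration.integrable_add conv_integrable[OF u(1) u1 cm vm] conv_integrable[OF v(1,4) cm vm])
        fix y
        show "mollifier \<epsilon> (x - y) \<le> u y *\<^sub>R mollifier \<epsilon> (x - y) + v y *\<^sub>R mollifier \<epsilon> (x - y)"
        proof (cases "norm (x - y) \<le> \<epsilon>")
          case True
          then have "y \<in> U" using near[of x y] x by (simp add: S_def)
          then have "1 \<le> u y + v y" using A(2)[of y] u(2)[of y] by (cases "y \<in> A") (auto simp: v_def)
          then have "1 * mollifier \<epsilon> (x - y) \<le> (u y + v y) * mollifier \<epsilon> (x - y)"
            using mollifier_bounds(1)[OF e, of "x - y"] by (rule mult_right_mono)
          then show ?thesis by (simp add: distrib_right)
        next
          case False
          then have "mollifier \<epsilon> (x - y) = 0" using vm by (simp add: vanishes_outside_def)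
          then show ?thesis by simp
        qed
      qed
      also have "\<dots> = f x + fv x"
        unfolding f_def fv_def conv_def
        by (rule Bochner_Integration.integral_add[OF conv_integrable[OF u(1) u1 cm vm] conv_integrable[OF v(1,4) cm vm]])
      finally show ?thesis using x by (simp add: S_def)
    qed
    have Sfin: "emeasure lborel S < \<infinity>" 
      using emeasure_mono[of S A lborel] Afin A(1) by (auto simp: S_def A'_def intro: order.strict_trans1)
    \<comment> \<open>Markov's inequality for \<open>fv\<close>, weighted with the bump: on
      \<open>S\<close> the two factors are at least \<delta> and
      \<open>1 - \<delta>\<close>.\<close>
    have "\<delta> * (1 - \<delta>) * measure lborel S = (\<integral>x. \<delta> * (1 - \<delta>) * indicator S x \<partial>lborel)"
      using Ss by simp
    also have "\<dots> \<le> (\<integral>x. fv x * bump R x \<partial>lborel)"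
    proof (rule Bochner_Integration.integral_mono[OF _ ifv])
      show "integrable lborel (\<lambda>x. \<delta> * (1 - \<delta>) * indicator S x)" using Ss Sfin by (intro integrable_mult_right integrable_real_indicator) auto
      fix x
      show "\<delta> * (1 - \<delta>) * indicator S x \<le> fv x * bump R x"
      proof (cases "x \<in> S")
        case True
        then have "1 - \<delta> < bump R x" using R(2) by (simp add: S_def A'_def)
        then have "\<delta> * (1 - \<delta>) \<le> fv x * bump R x" using Sfv[OF True] d by (intro mult_mono) auto
        then show ?thesis using True by simp
      next
        case False then show ?thesis using fv0 bb(1) by simp
      qed
    qed
    also have "\<dots> \<le> \<tau>" by (rule ivb)
    finally have Sm: "measure lborel S \<le> \<tau> / (\<delta> * (1 - \<delta>))" using d by (simp add: field_simps)
    obtain G where G: "C1 (\<lambda>x. bump R x *\<^sub>R f x) (\<lambda>x v. G x \<bullet> v)" "continuous_on UNIV G" "vanishes_outside R G"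
      "(\<integral>x. norm (G x) \<partial>lborel) \<le> M + 6 / R * I"
      using mollified_gradient_bound[OF u M e R(1)] unfolding f_def I_def by blast
    let ?g = "\<lambda>x. bump R x *\<^sub>R f x"
    have vg: "vanishes_outside R ?g" using bb(3) by (simp add: vanishes_outside_def)
    have g0: "?g x \<ge> 0" for x using bb(1) f0 by simp
    have T: "(1 - \<delta>)\<^sup>2 > 0" using d by simp
    have "(1 - \<delta>) * m \<le> measure lborel (A' j) - measure lborel S" using j tb Sm by (simp add: algebra_simps)
    also have "\<dots> = measure lborel (A' j - S)"
    proof (rule measure_Diff[symmetric])
      show "emeasure lborel (A' j) \<noteq> \<infinity>"
      proof -
        have "A' j \<subseteq> A" by (auto simp: A'_def)
        then have "emeasure lborel (A' j) \<le> emeasure lborel A" using A(1) by (intro emeasure_mono) auto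
        then show ?thesis using Afin by (auto simp: top_unique)
      qed
      show "S \<subseteq> A' j" by (auto simp: S_def)
    qed (use A's Ss in auto)
    also have "\<dots> \<le> measure lborel {x. (1 - \<delta>)\<^sup>2 < ?g x}"
    proof (rule content_mono_bounded)
      show "A' j - S \<subseteq> {x. (1 - \<delta>)\<^sup>2 < ?g x}"
      proof
        fix x assume x: "x \<in> A' j - S"
        then have "1 - \<delta> < bump R x" "1 - \<delta> < f x" using R(2) by (auto simp: S_def A'_def)
        then have "(1 - \<delta>) * (1 - \<delta>) < bump R x * f x" using d by (intro mult_strict_mono) auto
        then show "x \<in> {x. (1 - \<delta>)\<^sup>2 < ?g x}" by (simp add: power2_eq_square)
      qed
      show "A' j - S \<in> sets borel" using A's[of j] Ss by auto
      show "{x. (1 - \<delta>)\<^sup>2 < ?g x} \<in> sets borel" by (intro borel_open open_superlevel_set C1_continuous[OF G(1)])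
      show "bounded {x. (1 - \<delta>)\<^sup>2 < ?g x}" using T by (intro bounded_superlevel_set[OF vg]) simp
    qed
    finally have lev: "(1 - \<delta>) * m \<le> measure lborel {x. (1 - \<delta>)\<^sup>2 < ?g x}" .
    have "(1 - \<delta>)\<^sup>2 * ?c * ((1 - \<delta>) * m) powr ?a \<le> (\<integral>x. norm (G x) \<partial>lborel)"
      using d m by (intro gradient_lower_bound[OF G(1) vg g0 G(2,3) T _ lev]) simp
    then show ?thesis using G(4) R(3) by linarith
  qed
  have l1: "((\<lambda>\<delta>. (1 - \<delta>)\<^sup>2 * ?c * ((1 - \<delta>) * m) powr ?a) \<longlongrightarrow> (1 - 0)\<^sup>2 * ?c * ((1 - 0) * m) powr ?a) (at_right 0)"
    using m by (intro tendsto_intros) auto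
  have l2: "((\<lambda>\<delta>. M + \<delta>) \<longlongrightarrow> M + 0) (at_right (0::real))" by (intro tendsto_intros)
  have ev: "\<forall>\<^sub>F \<delta> in at_right 0. (1 - \<delta>)\<^sup>2 * ?c * ((1 - \<delta>) * m) powr ?a \<le> M + \<delta>"
    unfolding eventually_at_right_field by (intro exI[of _ 1]) (use claim in auto)
  have "(1 - 0)\<^sup>2 * ?c * ((1 - 0) * m) powr ?a \<le> M + 0"
    by (rule tendsto_le[OF trivial_limit_at_right_real l2 l1 ev])
  then show ?thesis by (simp add: m_def)
qed

section \<open>The perimeter of sets\<close>

abbreviation competitors :: "('a::euclidean_space \<Rightarrow> 'a) set" where
  "competitors \<equiv> {\<phi>. C1_compact_support \<phi> \<and> (\<forall>x. norm (\<phi> x) \<le> 1)}"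

lemma perimeter_null_cong:
  fixes E F :: "'a::euclidean_space set"
  assumes "E \<in> sets lebesgue" "F \<in> sets lebesgue" and N: "AE x in lebesgue. x \<in> E \<longleftrightarrow> x \<in> F"
  shows "perimeter E = perimeter F"
proof -
  have "set_lebesgue_integral lebesgue E (divergence \<phi>) = set_lebesgue_integral lebesgue F (divergence \<phi>)"
    if "\<phi> \<in> competitors" for \<phi>
  proof -
    have "divergence \<phi> \<in> borel_measurable lborel" using divergence_measurable that by auto
    then have [measurable]: "divergence \<phi> \<in> borel_measurable lebesgue" by (rule measurable_completion)
    note [measurable] = assms(1,2)
    show ?thesis unfolding set_lebesgue_integral_def
    proof (rule integral_cong_AE)
      show "AE x in lebesgue. indicat_real E x *\<^sub>R divergence \<phi> x = indicat_real F x *\<^sub>R divergence \<phi> x"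
        using N by (rule eventually_mono) (auto simp: indicator_def)
    qed measurable
  qed
  then show ?thesis unfolding perimeter_def by (intro SUP_cong) auto
qed

text \<open>With a Borel set the tested integrals can be taken over \<open>lborel\<close>, where the
  inequality for functions is stated.\<close>

lemma borel_representative:
  fixes E :: "'a::euclidean_space set"
  assumes "E \<in> sets lebesgue"
  obtains E' where "E' \<in> sets borel" "AE x in lebesgue. x \<in> E \<longleftrightarrow> x \<in> E'" "emeasure lborel E' = emeasure lebesgue E"
proof -
  obtain S N N' where S: "E = S \<union> N" "N \<subseteq> N'" "N' \<in> null_sets lborel" "S \<in> sets lborel"
    using sets_completionE[OF assms] .
  have ae: "AE x in lebesgue. x \<in> E \<longleftrightarrow> x \<in> S"
  proof (rule AE_I')
    show "N' \<in> null_sets lebesgue" using S(3) by (rule null_sets_completionI)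
    show "{x \<in> space lebesgue. \<not> (x \<in> E \<longleftrightarrow> x \<in> S)} \<subseteq> N'" using S by auto
  qed
  have S': "S \<in> sets lebesgue" using S(4) by simp
  then have "emeasure lebesgue E = emeasure lebesgue S" using ae assms by (intro emeasure_eq_AE) auto
  then show ?thesis using that[of S] S(4) ae by simp
qed

lemma competitor_integral:
  fixes E :: "'a::euclidean_space set"
  assumes "E \<in> sets borel" "\<phi> \<in> competitors"
  shows "set_lebesgue_integral lebesgue E (divergence \<phi>) = (\<integral>x. indicator E x * divergence \<phi> x \<partial>lborel)"
proof -
  have [measurable]: "divergence \<phi> \<in> borel_measurable borel" using divergence_measurable assms(2) by auto
  note [measurable] = assms(1)
  show ?thesis unfolding set_lebesgue_integral_def by (subst integral_completion) auto
qed

lemma competitor_integrable: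
  assumes "E \<in> sets borel" "\<phi> \<in> competitors"
  shows "integrable lborel (\<lambda>x. indicator E x * divergence \<phi> x)"
  using integrable_mult_indicator[of E lborel "divergence \<phi>"] divergence_integrable assms by auto

text \<open>The inequality for functions with \<open>u\<close> the indicator of a Borel
  representative and that set as the plateau; the perimeter bounds all tested integrals.\<close>

theorem isoperimetric_inequality:
  fixes E :: "'a::euclidean_space set"
  assumes E: "E \<in> sets lebesgue" "emeasure lebesgue E = ennreal m" "m \<ge> 0"
  shows "ennreal (iso_const TYPE('a) * m powr ((real DIM('a) - 1) / real DIM('a))) \<le> perimeter E"
proof (cases "perimeter E = \<infinity>")
  case False
  obtain E' where E': "E' \<in> sets borel" "AE x in lebesgue. x \<in> E \<longleftrightarrow> x \<in> E'" "emeasure lborel E' = emeasure lebesgue E"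
    using borel_representative[OF E(1)] .
  have P: "perimeter E = perimeter E'"
    using E' E(1) by (intro perimeter_null_cong) auto
  define M where "M = enn2real (perimeter E')"
  have PM: "perimeter E' = ennreal M" using False P unfolding M_def by (simp add: less_top)
  have m: "measure lborel E' = m" using E' E by (simp add: measure_def)
  have "iso_const TYPE('a) * measure lborel E' powr ((real DIM('a) - 1) / real DIM('a)) \<le> M"
  proof (rule isoperimetric_function[where u="indicator E'"])
    show "integrable lborel (indicator E' :: 'a \<Rightarrow> real)"
      using E' E by (intro integrable_real_indicator) auto
    fix \<phi> :: "'a \<Rightarrow> 'a" assume "C1_compact_support \<phi>" "\<And>x. norm (\<phi> x) \<le> 1"
    then have c: "\<phi> \<in> competitors" by simp
    have "ennreal (set_lebesgue_integral lebesgue E' (divergence \<phi>)) \<le> ennreal M"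
      unfolding PM[symmetric] perimeter_def by (rule SUP_upper[OF c])
    then show "(\<integral>x. indicator E' x * divergence \<phi> x \<partial>lborel) \<le> M"
      unfolding competitor_integral[OF E'(1) c] by (simp add: M_def ennreal_le_iff)
  qed (use E' in \<open>auto simp: indicator_def\<close>)
  then show ?thesis unfolding P PM m by (rule ennreal_leI)
qed simp

text \<open>Subadditivity of the positive part: a tested integral over one of two disjoint sets may
  be negative.\<close>

lemma ennreal_add_le: "ennreal (a + b) \<le> ennreal a + ennreal b"
proof -
  have "ennreal (a + b) \<le> ennreal (max 0 a + max 0 b)" by (rule ennreal_leI) simp
  also have "\<dots> = ennreal (max 0 a) + ennreal (max 0 b)" by (rule ennreal_plus) auto
  also have "\<dots> = ennreal a + ennreal b" by (simp add: max_def ennreal_neg)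
  finally show ?thesis .
qed

text \<open>A field that tests the union tests both parts, and over disjoint sets the integrals
  add.\<close>

lemma perimeter_Un_le:
  fixes E F :: "'a::euclidean_space set"
  assumes E: "E \<in> sets borel" "F \<in> sets borel" and disj: "E \<inter> F = {}"
  shows "perimeter (E \<union> F) \<le> perimeter E + perimeter F"
  unfolding perimeter_def[of "E \<union> F"]
proof (rule SUP_least)
  fix \<phi> :: "'a \<Rightarrow> 'a" assume c: "\<phi> \<in> competitors"
  have EF: "E \<union> F \<in> sets borel" using E by simp
  have ind: "(\<lambda>x. indicator (E \<union> F) x * divergence \<phi> x) = (\<lambda>x. indicator E x * divergence \<phi> x + indicator F x * divergence \<phi> x)"
  proof
    fix x
    show "indicator (E \<union> F) x * divergence \<phi> x = indicator E x * divergence \<phi> x + indicator F x * divergence \<phi> x"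
      using disj by (cases "x \<in> E"; cases "x \<in> F") auto
  qed
  have "set_lebesgue_integral lebesgue (E \<union> F) (divergence \<phi>)
      = (\<integral>x. indicator E x * divergence \<phi> x \<partial>lborel) + (\<integral>x. indicator F x * divergence \<phi> x \<partial>lborel)"
    unfolding competitor_integral[OF EF c] ind
    by (rule Bochner_Integration.integral_add[OF competitor_integrable[OF E(1) c] competitor_integrable[OF E(2) c]])
  also have "\<dots> = set_lebesgue_integral lebesgue E (divergence \<phi>) + set_lebesgue_integral lebesgue F (divergence \<phi>)"
    by (simp only: competitor_integral[OF E(1) c] competitor_integral[OF E(2) c])
  finally have eq: "set_lebesgue_integral lebesgue (E \<union> F) (divergence \<phi>)
    = set_lebesgue_integral lebesgue E (divergence \<phi>) + set_lebesgue_integral lebesgue F (divergence \<phi>)" .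
  have "ennreal (set_lebesgue_integral lebesgue (E \<union> F) (divergence \<phi>))
    \<le> ennreal (set_lebesgue_integral lebesgue E (divergence \<phi>)) + ennreal (set_lebesgue_integral lebesgue F (divergence \<phi>))"
    unfolding eq by (rule ennreal_add_le)
  also have "\<dots> \<le> perimeter E + perimeter F"
    unfolding perimeter_def by (intro add_mono SUP_upper c)
  finally show "ennreal (set_lebesgue_integral lebesgue (E \<union> F) (divergence \<phi>)) \<le> perimeter E + perimeter F" .
qed

lemma perimeter_UN_le:
  fixes E :: "nat \<Rightarrow> 'a::euclidean_space set"
  assumes E: "\<And>i. E i \<in> sets borel" and disj: "disjoint_family E" and P: "\<And>i. perimeter (E i) \<le> p"
  shows "perimeter (\<Union>i<N. E i) \<le> of_nat N * p"
proof (induction N)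
  case 0
  have "perimeter ({} :: 'a set) = 0"
    unfolding perimeter_def by (intro antisym SUP_least) (auto simp: set_lebesgue_integral_def)
  then show ?case by simp
next
  case (Suc N)
  have eq: "(\<Union>i<Suc N. E i) = (\<Union>i<N. E i) \<union> E N" by (auto simp: lessThan_Suc)
  have "E i \<inter> E N = {}" if "i < N" for i
    using disj that unfolding disjoint_family_on_def by simp
  then have "(\<Union>i<N. E i) \<inter> E N = {}" by blast
  then have "perimeter (\<Union>i<Suc N. E i) \<le> perimeter (\<Union>i<N. E i) + perimeter (E N)"
    unfolding eq using E by (intro perimeter_Un_le) auto
  also have "\<dots> \<le> of_nat N * p + p" by (intro add_mono Suc.IH P)
  finally show ?case by (simp add: algebra_simps)
qed

section \<open>Upper bound for the perimeter of a ball\<close>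

definition radial_cut :: "'a::euclidean_space \<Rightarrow> real \<Rightarrow> real \<Rightarrow> 'a \<Rightarrow> real" where
  "radial_cut c r k x = (max 0 (1 - k * (max 0 (- quad r (x - c)))\<^sup>2))\<^sup>2"

definition radial_cut_coeff :: "'a::euclidean_space \<Rightarrow> real \<Rightarrow> real \<Rightarrow> 'a \<Rightarrow> real" where
  "radial_cut_coeff c r k x = 8 * k / r\<^sup>2 * max 0 (1 - k * (max 0 (- quad r (x - c)))\<^sup>2) * max 0 (- quad r (x - c))"

text \<open>For \<open>k \<ge> 0\<close> the cut-off does not increase with the distance from
  \<open>c\<close>, so its gradient is a nonpositive multiple of \<open>x - c\<close>; this sign
  decides the estimate for balls.\<close>

lemma C1_radial_cut:
  "C1 (radial_cut c r k) (\<lambda>x v. ((- radial_cut_coeff c r k x) *\<^sub>R (x - c)) \<bullet> v)"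
  unfolding C1_def
proof (intro conjI allI)
  fix x
  have "((\<lambda>x. quad r (x - c)) has_derivative (\<lambda>v. - (2 / r\<^sup>2) * ((x - c) \<bullet> v))) (at x)"
    by (rule has_derivative_compose[OF _ quad_derivative]) (auto intro!: derivative_eq_intros)
  then have "((\<lambda>x. - quad r (x - c)) has_derivative (\<lambda>v. - (- (2 / r\<^sup>2) * ((x - c) \<bullet> v)))) (at x)"
    by (rule has_derivative_minus)
  then have "((\<lambda>x. 1 - k * (max 0 (- quad r (x - c)))\<^sup>2) has_derivative
     (\<lambda>v. 0 - k * (2 * max 0 (- quad r (x - c)) * (- (- (2 / r\<^sup>2) * ((x - c) \<bullet> v)))))) (at x)"
    by (intro has_derivative_diff has_derivative_const has_derivative_mult_right has_derivative_max_0_square)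
  from has_derivative_max_0_square[OF this]
  show "(radial_cut c r k has_derivative (\<lambda>v. ((- radial_cut_coeff c r k x) *\<^sub>R (x - c)) \<bullet> v)) (at x)"
    by (simp add: radial_cut_def[abs_def] radial_cut_coeff_def mult_ac)
  fix v
  have "continuous_on UNIV (\<lambda>x. quad r (x - c))"
    by (rule continuous_on_compose2[OF quad_continuous[of UNIV]]) (auto intro!: continuous_intros)
  then show "continuous_on UNIV (\<lambda>x. ((- radial_cut_coeff c r k x) *\<^sub>R (x - c)) \<bullet> v)"
    unfolding radial_cut_coeff_def by (intro continuous_intros)
qed

lemma radial_cut_bounds:
  fixes x c :: "'a::euclidean_space"
  assumes "r > 0" "k \<ge> 1"
  shows "0 \<le> radial_cut c r k x" "radial_cut c r k x \<le> 1" "x \<in> cball c r \<Longrightarrow> radial_cut c r k x = 1"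
    "vanishes_outside (norm c + 2 * r) (radial_cut c r k)"
    "radial_cut_coeff c r k x \<ge> 0" "x \<in> cball c r \<Longrightarrow> radial_cut_coeff c r k x = 0"
proof -
  have q: "- quad r y = (norm y / r)\<^sup>2 - 1" for y :: 'a by (simp add: quad_def power_divide dot_square_norm)
  show "0 \<le> radial_cut c r k x" by (simp add: radial_cut_def)
  have "max 0 (1 - k * (max 0 (- quad r (x - c)))\<^sup>2) \<le> 1" using assms by simp
  then show "radial_cut c r k x \<le> 1" unfolding radial_cut_def by (intro power_le_one) auto
  have in0: "max 0 (- quad r (x - c)) = 0" if "x \<in> cball c r"
  proof -
    have "norm (x - c) / r \<le> 1" using that assms by (simp add: dist_norm norm_minus_commute)
    then have "(norm (x - c) / r)\<^sup>2 \<le> 1" using assms by (intro power_le_one) auto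
    then show ?thesis by (simp add: q)
  qed
  then show "x \<in> cball c r \<Longrightarrow> radial_cut c r k x = 1" by (simp add: radial_cut_def)
  show "x \<in> cball c r \<Longrightarrow> radial_cut_coeff c r k x = 0" using in0 by (simp add: radial_cut_coeff_def)
  show "radial_cut_coeff c r k x \<ge> 0" using assms by (simp add: radial_cut_coeff_def)
  show "vanishes_outside (norm c + 2 * r) (radial_cut c r k)"
    unfolding vanishes_outside_def
  proof (intro allI impI)
    fix y :: 'a assume y: "norm c + 2 * r < norm y"
    have "norm y \<le> norm (y - c) + norm c" by (metis diff_add_cancel norm_triangle_ineq)
    then have "2 \<le> norm (y - c) / r" using y assms by (simp add: field_simps)
    then have "2\<^sup>2 \<le> (norm (y - c) / r)\<^sup>2" by (intro power_mono) auto
    then have w: "1 \<le> - quad r (y - c)" by (simp add: q)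
    then have "1 \<le> (max 0 (- quad r (y - c)))\<^sup>2" by (intro one_le_power) auto
    then have "1 * 1 \<le> k * (max 0 (- quad r (y - c)))\<^sup>2" using assms by (intro mult_mono) auto
    then show "radial_cut c r k y = 0" by (simp add: radial_cut_def)
  qed
qed

lemma radial_cut_tendsto:
  fixes x c :: "'a::euclidean_space"
  assumes "r > 0" "x \<notin> cball c r"
  shows "\<forall>\<^sub>F n in sequentially. radial_cut c r (real (Suc n)) x = 0"
proof -
  define w where "w = - quad r (x - c)"
  have "1 < norm (x - c) / r" using assms by (simp add: dist_norm norm_minus_commute)
  then have "1 < (norm (x - c) / r)\<^sup>2" by (simp add: one_less_power)
  then have w: "w > 0" by (simp add: w_def quad_def power_divide dot_square_norm)
  obtain N :: nat where N: "1 / w\<^sup>2 < real N" using reals_Archimedean2 by blast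
  have "radial_cut c r (real (Suc n)) x = 0" if "n \<ge> N" for n
  proof -
    have "1 / w\<^sup>2 \<le> real (Suc n)" using N that by linarith
    then have "1 \<le> real (Suc n) * w\<^sup>2" using w by (simp add: divide_le_eq)
    then show ?thesis using w by (simp add: radial_cut_def w_def[symmetric])
  qed
  then show ?thesis by (auto simp: eventually_sequentially)
qed

text \<open>Testing with the position vector: \<open>div (r \<phi> - (x - c)) = r div \<phi> - d\<close>, and \<open>r \<phi> - (x - c)\<close> points
  inwards where the radial cut-off decreases.\<close>

lemma perimeter_cball_le:
  fixes c :: "'a::euclidean_space"
  assumes r: "r > 0"
  shows "perimeter (cball c r) \<le> ennreal (real DIM('a) * unit_ball_vol (real DIM('a)) * r ^ (DIM('a) - 1))"
  unfolding perimeter_def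
proof (rule SUP_least)
  fix \<phi> :: "'a \<Rightarrow> 'a" assume c: "\<phi> \<in> competitors"
  then have S: "C1_compact_support \<phi>" and n1: "norm (\<phi> x) \<le> 1" for x by auto
  obtain D R where D: "C1 \<phi> D" using C1_compact_supportE[OF S] by metis
  let ?n = "real DIM('a)"
  define \<psi> where "\<psi> x = r *\<^sub>R \<phi> x + (c - x)" for x
  have C1m: "C1 (\<lambda>x. c - x) (\<lambda>x v. - v)"
    unfolding C1_def by (auto intro!: derivative_eq_intros)
  note D\<psi>0 = C1_add[OF C1_scaleR_const[OF D, of r] C1m]
  have D\<psi>: "C1 \<psi> (\<lambda>x v. r *\<^sub>R D x v + - v)" unfolding \<psi>_def[abs_def] by (rule D\<psi>0)
  have div\<psi>: "divergence \<psi> x = r * divergence \<phi> x - ?n" for x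
    by (simp add: divergence_C1[OF D\<psi>] divergence_C1[OF D] inner_diff_left sum_subtractf sum_distrib_left)
  obtain B where B: "B > 0" "\<And>x. norm (divergence \<phi> x) \<le> B" using divergence_bounded[OF S] by metis
  let ?\<eta> = "\<lambda>k. radial_cut c r (real (Suc k))"
  have k1: "real (Suc k) \<ge> 1" for k by simp
  have rb1: "0 \<le> ?\<eta> k x" "?\<eta> k x \<le> 1" for k x by (rule radial_cut_bounds(1,2)[OF r k1])+
  have rb3: "?\<eta> k x = 1" if "x \<in> cball c r" for k x by (rule radial_cut_bounds(3)[OF r k1 that])
  have rb4: "vanishes_outside (norm c + 2 * r) (?\<eta> k)" for k by (rule radial_cut_bounds(4)[OF r k1])
  have rb5: "radial_cut_coeff c r (real (Suc k)) x \<ge> 0" for k x by (rule radial_cut_bounds(5)[OF r k1])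
  have rb6: "radial_cut_coeff c r (real (Suc k)) x = 0" if "x \<in> cball c r" for k x by (rule radial_cut_bounds(6)[OF r k1 that])
  have [measurable]: "divergence \<phi> \<in> borel_measurable borel" using divergence_measurable[OF S] .
  have m\<eta>: "?\<eta> k \<in> borel_measurable lborel" for k
    unfolding measurable_lborel2 by (rule borel_measurable_continuous_onI[OF C1_continuous[OF C1_radial_cut]])
  have le: "(\<integral>x. ?\<eta> k x * divergence \<psi> x \<partial>lborel) \<le> 0" for k
  proof -
    let ?N = "\<lambda>x. (- radial_cut_coeff c r (real (Suc k)) x) *\<^sub>R (x - c)"
    have v: "vanishes_outside (norm c + 2 * r) (\<lambda>x. ?\<eta> k x *\<^sub>R \<psi> x)"
      using rb4[of k] by (simp add: vanishes_outside_def)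
    have C: "C1_compact_support (\<lambda>x. ?\<eta> k x *\<^sub>R \<psi> x)"
      by (rule C1_compact_supportI[OF C1_scaleR[OF C1_radial_cut D\<psi>] v])
    have dv: "divergence (\<lambda>x. ?\<eta> k x *\<^sub>R \<psi> x) x = ?\<eta> k x * divergence \<psi> x + ?N x \<bullet> \<psi> x" for x
      by (rule divergence_scaleR[OF C1_radial_cut D\<psi>])
    have N: "?N x \<bullet> \<psi> x \<ge> 0" for x
    proof (cases "x \<in> cball c r")
      case True then show ?thesis using rb6 by simp
    next
      case False
      then have rx: "r \<le> norm (x - c)" by (simp add: dist_norm norm_minus_commute)
      have "(x - c) \<bullet> \<phi> x \<le> norm (x - c) * norm (\<phi> x)" by (rule norm_cauchy_schwarz)
      also have "\<dots> \<le> norm (x - c) * 1" using n1 by (intro mult_left_mono) auto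
      finally have "r * ((x - c) \<bullet> \<phi> x) \<le> r * norm (x - c)" using r by simp
      also have "\<dots> \<le> norm (x - c) * norm (x - c)" using rx by (intro mult_right_mono) auto
      also have "\<dots> = (x - c) \<bullet> (x - c)" by (simp add: dot_square_norm power2_eq_square)
      finally have "(x - c) \<bullet> \<psi> x \<le> 0" by (simp add: \<psi>_def inner_add_right inner_diff_right inner_diff_left)
      then show ?thesis using rb5[of k x] by (simp add: mult_nonneg_nonpos)
    qed
    have "(\<integral>x. ?\<eta> k x * divergence \<psi> x \<partial>lborel) \<le> (\<integral>x. divergence (\<lambda>x. ?\<eta> k x *\<^sub>R \<psi> x) x \<partial>lborel)"
    proof (rule Bochner_Integration.integral_mono)
      show "integrable lborel (\<lambda>x. ?\<eta> k x * divergence \<psi> x)"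
      proof (rule integrable_continuous_vanishing)
        show "continuous_on UNIV (\<lambda>x. ?\<eta> k x * divergence \<psi> x)"
          using C1_continuous[OF C1_radial_cut] divergence_continuous[OF D\<psi>] by (intro continuous_intros)
        show "vanishes_outside (norm c + 2 * r) (\<lambda>x. ?\<eta> k x * divergence \<psi> x)"
          using rb4[of k] by (simp add: vanishes_outside_def)
      qed
      show "integrable lborel (divergence (\<lambda>x. ?\<eta> k x *\<^sub>R \<psi> x))" by (rule divergence_integrable[OF C])
      show "?\<eta> k x * divergence \<psi> x \<le> divergence (\<lambda>x. ?\<eta> k x *\<^sub>R \<psi> x) x" for x
        using N[of x] dv[of x] by linarith
    qed
    then show ?thesis using integral_divergence[OF C] by simp
  qed
  \<comment> \<open>The cut-offs tend to the indicator of the closed ball, so the integral of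
    \<open>divergence \<psi>\<close> over the ball is nonpositive; this compares \<open>r\<close>
    times the tested integral with \<open>d\<close> times the volume.\<close>
  have "(\<lambda>k. \<integral>x. ?\<eta> k x * divergence \<psi> x \<partial>lborel) \<longlonglongrightarrow> (\<integral>x. indicator (cball c r) x * divergence \<psi> x \<partial>lborel)"
  proof (rule integral_dominated_convergence[where w="\<lambda>x. (r * B + ?n) * indicator (cball 0 (norm c + 2 * r)) x"])
    have m\<psi>: "divergence \<psi> \<in> borel_measurable lborel"
      using divergence_continuous[OF D\<psi>] by (simp add: borel_measurable_continuous_onI)
    show "(\<lambda>x. indicator (cball c r) x * divergence \<psi> x) \<in> borel_measurable lborel"
      by (intro borel_measurable_times borel_measurable_indicator m\<psi>) simp
    show "(\<lambda>x. ?\<eta> k x * divergence \<psi> x) \<in> borel_measurable lborel" for k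
      by (rule borel_measurable_times[OF m\<eta> m\<psi>])
    show "integrable lborel (\<lambda>x. (r * B + ?n) * indicator (cball 0 (norm c + 2 * r)) x)"
      by (rule integrable_mult_right[OF integrable_indicator_cball])
    show "AE x in lborel. (\<lambda>k. ?\<eta> k x * divergence \<psi> x) \<longlonglongrightarrow> indicator (cball c r) x * divergence \<psi> x"
    proof (rule AE_I2)
      fix x
      show "(\<lambda>k. ?\<eta> k x * divergence \<psi> x) \<longlonglongrightarrow> indicator (cball c r) x * divergence \<psi> x"
      proof (cases "x \<in> cball c r")
        case True
        then show ?thesis using rb3[OF True] by simp
      next
        case False
        have "\<forall>\<^sub>F k in sequentially. 0 = ?\<eta> k x * divergence \<psi> x"
          using radial_cut_tendsto[OF r False] by (rule eventually_mono) simp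
        then show ?thesis using False by (simp add: tendsto_eventually eventually_mono[OF \<open>\<forall>\<^sub>F k in sequentially. 0 = ?\<eta> k x * divergence \<psi> x\<close>])
      qed
    qed
    show "AE x in lborel. norm (?\<eta> k x * divergence \<psi> x) \<le> (r * B + ?n) * indicator (cball 0 (norm c + 2 * r)) x" for k
    proof (rule AE_I2)
      fix x :: 'a
      show "norm (?\<eta> k x * divergence \<psi> x) \<le> (r * B + ?n) * indicator (cball 0 (norm c + 2 * r)) x"
      proof (cases "x \<in> cball 0 (norm c + 2 * r)")
        case True
        have "\<bar>divergence \<psi> x\<bar> \<le> r * \<bar>divergence \<phi> x\<bar> + ?n" unfolding div\<psi>
          using r abs_triangle_ineq4[of "r * divergence \<phi> x" ?n] by (simp add: abs_mult)
        also have "\<dots> \<le> r * B + ?n" using B(2)[of x] r by simp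
        finally have "\<bar>?\<eta> k x\<bar> * \<bar>divergence \<psi> x\<bar> \<le> 1 * (r * B + ?n)"
          using rb1[of k x] by (intro mult_mono) auto
        then show ?thesis using True by (simp add: abs_mult)
      next
        case False
        then show ?thesis using rb4[of k] by (simp add: vanishes_outside_def)
      qed
    qed
  qed
  then have I: "(\<integral>x. indicator (cball c r) x * divergence \<psi> x \<partial>lborel) \<le> 0"
    using le by (intro LIMSEQ_le_const2) auto
  have cb: "cball c r \<in> sets borel" by simp
  have i1: "integrable lborel (\<lambda>x. indicator (cball c r) x * divergence \<phi> x)" by (rule competitor_integrable[OF cb c])
  have "(\<lambda>x. indicator (cball c r) x * divergence \<psi> x) = (\<lambda>x. r * (indicator (cball c r) x * divergence \<phi> x) - ?n * indicator (cball c r) x)"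
    by (auto simp: div\<psi> indicator_def)
  then have "(\<integral>x. indicator (cball c r) x * divergence \<psi> x \<partial>lborel)
    = r * (\<integral>x. indicator (cball c r) x * divergence \<phi> x \<partial>lborel) - ?n * measure lborel (cball c r)"
    using i1 by simp
  then have "r * (\<integral>x. indicator (cball c r) x * divergence \<phi> x \<partial>lborel) \<le> ?n * (unit_ball_vol ?n * r ^ DIM('a))"
    using I r by (simp add: content_cball)
  moreover have "r ^ DIM('a) = r * r ^ (DIM('a) - 1)" using power_minus_mult[of "DIM('a)" r] by (simp add: mult.commute)
  ultimately have "r * (\<integral>x. indicator (cball c r) x * divergence \<phi> x \<partial>lborel) \<le> r * (?n * unit_ball_vol ?n * r ^ (DIM('a) - 1))"
    by (simp only: mult_ac)
  then have "(\<integral>x. indicator (cball c r) x * divergence \<phi> x \<partial>lborel) \<le> ?n * unit_ball_vol ?n * r ^ (DIM('a) - 1)"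
    by (rule mult_left_le_imp_le[OF _ r])
  then show "ennreal (set_lebesgue_integral lebesgue (cball c r) (divergence \<phi>)) \<le> ennreal (?n * unit_ball_vol ?n * r ^ (DIM('a) - 1))"
    unfolding competitor_integral[OF cb c] by (rule ennreal_leI)
qed

section \<open>Open minimisers of the perimeter are bounded\<close>

text \<open>A C1 step across the slab between the levels \<open>t\<close> and \<open>t + w\<close>
  of \<open>x \<bullet> e\<close>: the inner square makes it flat at the upper face, the outer
  square at the lower face.\<close>

definition slab_cut :: "'a::euclidean_space \<Rightarrow> real \<Rightarrow> real \<Rightarrow> 'a \<Rightarrow> real" where
  "slab_cut e t w x = (max 0 (1 - (max 0 (1 - (x \<bullet> e - t) / w))\<^sup>2))\<^sup>2"

definition slab_cut_coeff :: "'a::euclidean_space \<Rightarrow> real \<Rightarrow> real \<Rightarrow> 'a \<Rightarrow> real" where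
  "slab_cut_coeff e t w x = 4 / w * max 0 (1 - (max 0 (1 - (x \<bullet> e - t) / w))\<^sup>2) * max 0 (1 - (x \<bullet> e - t) / w)"

lemma C1_slab_cut: "C1 (slab_cut e t w) (\<lambda>x v. (slab_cut_coeff e t w x *\<^sub>R e) \<bullet> v)"
  unfolding C1_def
proof (intro conjI allI)
  fix x :: 'a
  have "((\<lambda>x. 1 - (x \<bullet> e - t) / w) has_derivative (\<lambda>v. - ((v \<bullet> e) / w))) (at x)"
    by (auto intro!: derivative_eq_intros simp: divide_inverse)
  then have "((\<lambda>x. 1 - (max 0 (1 - (x \<bullet> e - t) / w))\<^sup>2) has_derivative
     (\<lambda>v. 0 - 2 * max 0 (1 - (x \<bullet> e - t) / w) * (- ((v \<bullet> e) / w)))) (at x)"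
    by (intro has_derivative_diff has_derivative_const has_derivative_max_0_square)
  from has_derivative_max_0_square[OF this]
  show "(slab_cut e t w has_derivative (\<lambda>v. (slab_cut_coeff e t w x *\<^sub>R e) \<bullet> v)) (at x)"
    by (simp add: slab_cut_def[abs_def] slab_cut_coeff_def mult_ac inner_commute)
  fix v :: 'a
  show "continuous_on UNIV (\<lambda>x. (slab_cut_coeff e t w x *\<^sub>R e) \<bullet> v)"
    unfolding slab_cut_coeff_def divide_inverse by (intro continuous_intros)
qed

lemma slab_cut_bounds:
  fixes x e :: "'a::euclidean_space"
  assumes w: "w > 0"
  shows "0 \<le> slab_cut e t w x" "slab_cut e t w x \<le> 1"
    "x \<bullet> e \<le> t \<Longrightarrow> slab_cut e t w x = 0" "t + w \<le> x \<bullet> e \<Longrightarrow> slab_cut e t w x = 1"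
    "0 \<le> slab_cut_coeff e t w x" "slab_cut_coeff e t w x \<le> 4 / w"
    "x \<bullet> e \<le> t \<Longrightarrow> slab_cut_coeff e t w x = 0"
proof -
  define y where "y = (x \<bullet> e - t) / w"
  have le1: "max 0 (1 - (max 0 (1 - y))\<^sup>2) \<le> 1" by simp
  show "0 \<le> slab_cut e t w x" by (simp add: slab_cut_def)
  show "slab_cut e t w x \<le> 1" unfolding slab_cut_def y_def[symmetric] using le1 by (intro power_le_one) auto
  have neg: "max 0 (1 - (max 0 (1 - y))\<^sup>2) = 0" if "x \<bullet> e \<le> t"
  proof -
    have "y \<le> 0" using that w by (simp add: y_def divide_nonpos_pos)
    then have "1 \<le> (max 0 (1 - y))\<^sup>2" by (intro one_le_power) auto
    then show ?thesis by simp
  qed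
  show "x \<bullet> e \<le> t \<Longrightarrow> slab_cut e t w x = 0" using neg by (simp add: slab_cut_def y_def)
  show "x \<bullet> e \<le> t \<Longrightarrow> slab_cut_coeff e t w x = 0" using neg by (simp add: slab_cut_coeff_def y_def)
  show "t + w \<le> x \<bullet> e \<Longrightarrow> slab_cut e t w x = 1" using w by (simp add: slab_cut_def field_simps)
  show "0 \<le> slab_cut_coeff e t w x" using w by (simp add: slab_cut_coeff_def)
  show "slab_cut_coeff e t w x \<le> 4 / w"
  proof (cases "x \<bullet> e \<le> t")
    case True then show ?thesis using neg w by (simp add: slab_cut_coeff_def y_def)
  next
    case False
    then have "y \<ge> 0" using w by (simp add: y_def)
    then have "max 0 (1 - (max 0 (1 - y))\<^sup>2) * max 0 (1 - y) \<le> 1 * 1" using le1 by (intro mult_mono) auto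
    then have "4 / w * (max 0 (1 - (max 0 (1 - y))\<^sup>2) * max 0 (1 - y)) \<le> 4 / w * 1"
      using w by (intro mult_left_mono) auto
    then show ?thesis by (simp add: slab_cut_coeff_def y_def mult.assoc)
  qed
qed

definition tail_measure :: "'a::euclidean_space set \<Rightarrow> 'a \<Rightarrow> real \<Rightarrow> real" where
  "tail_measure E e s = measure lborel (E \<inter> {x. s < x \<bullet> e})"

lemma halfspace_borel [measurable]: "{x::'a::euclidean_space. s < x \<bullet> e} \<in> sets borel"
  by (intro borel_open open_Collect_less continuous_intros)

text \<open>A fixed pair of competitors, one on each side of the slab, is glued into one competitor for \<open>E\<close>.\<close>

lemma perimeter_split:
  fixes E :: "'a::euclidean_space set"
  assumes E: "open E" "emeasure lborel E = ennreal m" "m \<ge> 0"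
    and P: "perimeter E \<le> ennreal P" "P \<ge> 0" and w: "w > 0" and e: "norm e = 1"
  shows "iso_const TYPE('a) * tail_measure E e (t + w) powr ((real DIM('a) - 1) / real DIM('a))
      + iso_const TYPE('a) * (m - tail_measure E e t) powr ((real DIM('a) - 1) / real DIM('a))
    \<le> P + 8 / w * tail_measure E e t"
proof -
  let ?a = "(real DIM('a) - 1) / real DIM('a)" and ?c = "iso_const TYPE('a)"
  let ?\<eta> = "slab_cut e t w" and ?H = "E \<inter> {x. t < x \<bullet> e}"
  note sb = slab_cut_bounds[OF w, where e=e and t=t]
  have Eb [measurable]: "E \<in> sets borel" using E(1) by simp
  have cont: "continuous_on UNIV ?\<eta>" by (rule C1_continuous[OF C1_slab_cut])
  then have [measurable]: "?\<eta> \<in> borel_measurable borel" by (rule borel_measurable_continuous_onI)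
  have Efin: "emeasure lborel E < \<infinity>" using E(2) by simp
  have fin: "emeasure lborel (E \<inter> S) < \<infinity>" if "S \<in> sets borel" for S
    using emeasure_mono[of "E \<inter> S" E lborel] Efin Eb that by (auto intro: order.strict_trans1)
  have indE: "integrable lborel (indicator E :: 'a \<Rightarrow> real)" using Efin by (intro integrable_real_indicator) auto
  define u1 u2 where "u1 x = indicator E x * ?\<eta> x" and "u2 x = indicator E x * (1 - ?\<eta> x)" for x
  have [measurable]: "u1 \<in> borel_measurable borel" "u2 \<in> borel_measurable borel"
    unfolding u1_def u2_def by measurable
  have ub: "0 \<le> u1 x" "u1 x \<le> 1" "0 \<le> u2 x" "u2 x \<le> 1" for x
    using sb(1,2)[of x] by (auto simp: u1_def u2_def indicator_def)
  have ule: "u1 x \<le> indicator E x" "u2 x \<le> indicator E x" for x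
    using sb(1,2)[of x] by (auto simp: u1_def u2_def indicator_def)
  have ui: "integrable lborel u1" "integrable lborel u2"
  proof -
    show "integrable lborel u1"
      by (rule Bochner_Integration.integrable_bound[OF indE]) (use ule ub in auto)
    show "integrable lborel u2"
      by (rule Bochner_Integration.integrable_bound[OF indE]) (use ule ub in auto)
  qed
  have main: "(\<integral>x. u1 x * divergence \<phi>1 x \<partial>lborel) + (\<integral>x. u2 x * divergence \<phi>2 x \<partial>lborel) \<le> P + 8 / w * tail_measure E e t"
    if c1: "C1_compact_support \<phi>1" "\<And>x. norm (\<phi>1 x) \<le> 1" and c2: "C1_compact_support \<phi>2" "\<And>x. norm (\<phi>2 x) \<le> 1" for \<phi>1 \<phi>2
  proof -
    obtain D1 R1 where D1: "C1 \<phi>1 D1" "vanishes_outside R1 \<phi>1" using C1_compact_supportE[OF c1(1)] by metis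
    obtain D2 R2 where D2: "C1 \<phi>2 D2" "vanishes_outside R2 \<phi>2" using C1_compact_supportE[OF c2(1)] by metis
    \<comment> \<open>The glued field \<open>\<eta> \<phi>1 + (1 - \<eta>) \<phi>2\<close> is
      written as \<open>\<eta> \<theta> + \<phi>2\<close>, so that one product rule gives its
      divergence.\<close>
    define \<theta> where "\<theta> x = \<phi>1 x + (-1) *\<^sub>R \<phi>2 x" for x
    have D\<theta>: "C1 \<theta> (\<lambda>x v. D1 x v + (-1) *\<^sub>R D2 x v)"
      unfolding \<theta>_def[abs_def] by (rule C1_add[OF D1(1) C1_scaleR_const[OF D2(1)]])
    define \<psi> where "\<psi> x = ?\<eta> x *\<^sub>R \<theta> x + \<phi>2 x" for x
    note D\<psi> = C1_add[OF C1_scaleR[OF C1_slab_cut D\<theta>] D2(1), of e t w, folded \<psi>_def]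
    have v\<psi>: "vanishes_outside (max R1 R2) \<psi>"
      using D1(2) D2(2) by (simp add: \<psi>_def \<theta>_def vanishes_outside_def)
    have S\<psi>: "C1_compact_support \<psi>" by (rule C1_compact_supportI[OF D\<psi> v\<psi>])
    have n\<psi>: "norm (\<psi> x) \<le> 1" for x
    proof -
      have "\<psi> x = ?\<eta> x *\<^sub>R \<phi>1 x + (1 - ?\<eta> x) *\<^sub>R \<phi>2 x" by (simp add: \<psi>_def \<theta>_def algebra_simps)
      then have "norm (\<psi> x) \<le> ?\<eta> x * norm (\<phi>1 x) + (1 - ?\<eta> x) * norm (\<phi>2 x)"
        using norm_triangle_ineq[of "?\<eta> x *\<^sub>R \<phi>1 x" "(1 - ?\<eta> x) *\<^sub>R \<phi>2 x"] sb(1,2)[of x] by simp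
      also have "\<dots> \<le> ?\<eta> x * 1 + (1 - ?\<eta> x) * 1"
        using c1(2) c2(2) sb(1,2)[of x] by (intro add_mono mult_left_mono) auto
      finally show ?thesis by simp
    qed
    define k where "k x = (slab_cut_coeff e t w x *\<^sub>R e) \<bullet> \<theta> x" for x
    have div\<theta>: "divergence \<theta> x = divergence \<phi>1 x - divergence \<phi>2 x" for x
      by (simp add: divergence_C1[OF D\<theta>] divergence_C1[OF D1(1)] divergence_C1[OF D2(1)] inner_diff_left sum_subtractf)
    have div\<psi>: "divergence \<psi> x = ?\<eta> x * divergence \<theta> x + k x + divergence \<phi>2 x" for x
    proof -
      have "divergence \<psi> x = divergence (\<lambda>x. ?\<eta> x *\<^sub>R \<theta> x) x + divergence \<phi>2 x"
        by (simp add: divergence_C1[OF D\<psi>] divergence_C1[OF C1_scaleR[OF C1_slab_cut D\<theta>]] divergence_C1[OF D2(1)]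
          inner_add_left sum.distrib)
      then show ?thesis by (simp add: divergence_scaleR[OF C1_slab_cut D\<theta>] k_def)
    qed
    \<comment> \<open>The slope of the cut-off is at most \<open>4 / w\<close> and \<theta> has norm
      at most 2. This gives the constant 8, charged only to the part of \<open>E\<close> beyond
      level \<open>t\<close>.\<close>
    have kb: "- indicator E x * k x \<le> 8 / w * indicator ?H x" for x
    proof (cases "x \<in> ?H")
      case True
      have "norm (\<theta> x) \<le> 2" using norm_triangle_ineq4[of "\<phi>1 x" "\<phi>2 x"] c1(2)[of x] c2(2)[of x] by (simp add: \<theta>_def)
      then have "\<bar>e \<bullet> \<theta> x\<bar> \<le> 2" using Cauchy_Schwarz_ineq2[of e "\<theta> x"] e by simp
      then have "slab_cut_coeff e t w x * \<bar>e \<bullet> \<theta> x\<bar> \<le> 4 / w * 2"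
        using sb(5,6)[of x] w by (intro mult_mono) auto
      then have "\<bar>k x\<bar> \<le> 8 / w" using sb(5)[of x] by (simp add: k_def abs_mult)
      then show ?thesis using True by simp
    next
      case False
      then show ?thesis using sb(7)[of x] by (auto simp: k_def indicator_def)
    qed
    have ck: "continuous_on UNIV k"
    proof -
      have "continuous_on UNIV (slab_cut_coeff e t w)"
        unfolding slab_cut_coeff_def divide_inverse by (intro continuous_intros)
      then show ?thesis unfolding k_def using C1_continuous[OF D\<theta>] by (intro continuous_intros)
    qed
    have vk: "vanishes_outside (max R1 R2) k"
      using D1(2) D2(2) by (simp add: k_def \<theta>_def vanishes_outside_def)
    have ik: "integrable lborel (\<lambda>x. indicator E x * k x)"
      using integrable_mult_indicator[of E lborel k] integrable_continuous_vanishing[OF ck vk] Eb by auto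
    have iu: "integrable lborel (\<lambda>x. u x * divergence \<phi> x)"
      if u: "u \<in> borel_measurable borel" "\<And>x. 0 \<le> u x" "\<And>x. u x \<le> 1" and c: "C1_compact_support \<phi>" for u :: "'a \<Rightarrow> real" and \<phi> :: "'a \<Rightarrow> 'a"
    proof (rule Bochner_Integration.integrable_bound[OF divergence_integrable[OF c]])
      have [measurable]: "divergence \<phi> \<in> borel_measurable borel" by (rule divergence_measurable[OF c])
      note [measurable] = u(1)
      show "(\<lambda>x. u x * divergence \<phi> x) \<in> borel_measurable lborel" by measurable
      have "norm (u x * divergence \<phi> x) \<le> norm (divergence \<phi> x)" for x
        using mult_right_mono[OF u(3)[of x], of "\<bar>divergence \<phi> x\<bar>"] u(2)[of x] by (simp add: abs_mult)
      then show "AE x in lborel. norm (u x * divergence \<phi> x) \<le> norm (divergence \<phi> x)" by (intro AE_I2)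
    qed
    have i1: "integrable lborel (\<lambda>x. u1 x * divergence \<phi>1 x)" by (intro iu c1(1) ub) measurable
    have i2: "integrable lborel (\<lambda>x. u2 x * divergence \<phi>2 x)" by (intro iu c2(1) ub) measurable
    have pw: "indicator E x * divergence \<psi> x = u1 x * divergence \<phi>1 x + u2 x * divergence \<phi>2 x + indicator E x * k x" for x
      by (simp add: div\<psi> div\<theta> u1_def u2_def algebra_simps)
    have "\<psi> \<in> competitors" using S\<psi> n\<psi> by simp
    then have "ennreal (\<integral>x. indicator E x * divergence \<psi> x \<partial>lborel) \<le> perimeter E"
      unfolding perimeter_def competitor_integral[OF Eb \<open>\<psi> \<in> competitors\<close>, symmetric] by (rule SUP_upper)
    then have "ennreal (\<integral>x. indicator E x * divergence \<psi> x \<partial>lborel) \<le> ennreal P" using P(1) by (rule order_trans)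
    then have "(\<integral>x. indicator E x * divergence \<psi> x \<partial>lborel) \<le> P" using P(2) by (simp add: ennreal_le_iff)
    then have "(\<integral>x. u1 x * divergence \<phi>1 x \<partial>lborel) + (\<integral>x. u2 x * divergence \<phi>2 x \<partial>lborel) + (\<integral>x. indicator E x * k x \<partial>lborel) \<le> P"
      unfolding pw using i1 i2 ik by simp
    moreover have "- (\<integral>x. indicator E x * k x \<partial>lborel) \<le> 8 / w * tail_measure E e t"
    proof -
      have iH: "integrable lborel (\<lambda>x. 8 / w * indicator ?H x :: real)"
        by (intro integrable_mult_right integrable_real_indicator fin halfspace_borel) measurable
      have "- (\<integral>x. indicator E x * k x \<partial>lborel) = (\<integral>x. - (indicator E x * k x) \<partial>lborel)" by simp
      also have "\<dots> \<le> (\<integral>x. 8 / w * indicator ?H x \<partial>lborel)"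
      proof (rule Bochner_Integration.integral_mono[OF integrable_minus[OF ik] iH])
        show "- (indicator E x * k x) \<le> 8 / w * indicator ?H x" for x using kb[of x] by simp
      qed
      also have "\<dots> = 8 / w * tail_measure E e t" by (simp add: tail_measure_def)
      finally show ?thesis .
    qed
    ultimately show ?thesis by linarith
  qed
  let ?K = "P + 8 / w * tail_measure E e t"
  let ?A1 = "E \<inter> {x. t + w < x \<bullet> e}" and ?A2 = "E - {x. t < x \<bullet> e}"
  \<comment> \<open>The supremum over pairs is taken one field at a time. With
    \<open>\<phi>2\<close> fixed, the tests of \<open>u1\<close> are bounded by \<open>?K\<close>
    minus the test of \<open>u2\<close>; the resulting inequality, rearranged, bounds all tests of
    \<open>u2\<close>.\<close>
  have A1: "?c * measure lborel ?A1 powr ?a \<le> ?K - (\<integral>x. u2 x * divergence \<phi>2 x \<partial>lborel)"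
    if o1: "C1_compact_support \<phi>2" and o2: "\<And>x. norm (\<phi>2 x) \<le> 1" for \<phi>2
  proof (rule isoperimetric_function[where u=u1])
    show "u1 x = 1" if "x \<in> ?A1" for x using that sb(4)[of x] by (simp add: u1_def)
    show "(\<integral>x. u1 x * divergence \<phi>1 x \<partial>lborel) \<le> ?K - (\<integral>x. u2 x * divergence \<phi>2 x \<partial>lborel)"
      if "C1_compact_support \<phi>1" "\<And>x. norm (\<phi>1 x) \<le> 1" for \<phi>1
      using main[OF that o1 o2] by linarith
    show "?A1 \<in> sets borel" by measurable
  qed (use ub ui in auto)
  have "?c * measure lborel ?A2 powr ?a \<le> ?K - ?c * measure lborel ?A1 powr ?a"
  proof (rule isoperimetric_function[where u=u2])
    show "u2 x = 1" if "x \<in> ?A2" for x using that sb(3)[of x] by (simp add: u2_def)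
    show "(\<integral>x. u2 x * divergence \<phi>2 x \<partial>lborel) \<le> ?K - ?c * measure lborel ?A1 powr ?a"
      if "C1_compact_support \<phi>2" "\<And>x. norm (\<phi>2 x) \<le> 1" for \<phi>2
      using A1[OF that] by linarith
    show "?A2 \<in> sets borel" by measurable
  qed (use ub ui in auto)
  moreover have "measure lborel ?A2 = m - tail_measure E e t"
  proof -
    have "?A2 = E - ?H" by auto
    also have "measure lborel \<dots> = measure lborel E - measure lborel ?H"
      using fin[OF halfspace_borel, of t e] Efin by (intro measure_Diff) auto
    also have "measure lborel E = m" using E(2,3) by (simp add: measure_def)
    finally show ?thesis by (simp add: tail_measure_def)
  qed
  ultimately show ?thesis by (simp add: tail_measure_def)
qed

text \<open>Along levels increasing to \<open>t0 + 1\<close> with halving widths, each step costs a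
  factor 2 but raises to the power \<open>1 / a > 1\<close>. From a small enough start
  \<open>V\<close> decays like \<open>q ^ k\<close>, and monotonicity gives zero at
  \<open>t0 + 1\<close>.\<close>

lemma de_giorgi_iteration:
  fixes V :: "real \<Rightarrow> real"
  assumes a: "0 < a" "a < 1" and C: "C > 0" and V0: "\<And>t. V t \<ge> 0" and mono: "\<And>s t. s \<le> t \<Longrightarrow> V t \<le> V s"
    and small: "\<And>d. d > 0 \<Longrightarrow> \<exists>t. V t < d"
    and step: "\<And>t w. \<lbrakk>0 < w; w \<le> 1\<rbrakk> \<Longrightarrow> V (t + w) powr a \<le> C / w * V t"
  shows "\<exists>t. V t = 0"
proof -
  \<comment> \<open>Chosen with \<open>2 * q powr (1 - a) = 1\<close>: the decay pays exactly for
    the doubling of \<open>C / w\<close> at each step.\<close>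
  define q where "q = 2 powr (- 1 / (1 - a))"
  have q: "0 < q" "q < 1" using a by (auto simp: q_def powr_less_one field_simps)
  have q2: "2 * q powr (1 - a) = 1"
  proof -
    have "q powr (1 - a) = 2 powr (- 1)" unfolding q_def powr_powr using a by simp
    then show ?thesis by (simp add: powr_minus)
  qed
  \<comment> \<open>The threshold solves \<open>2 * C * d powr (1 - a) = q powr a\<close>, which
    closes the induction step.\<close>
  define d where "d = (q powr a / (2 * C)) powr (1 / (1 - a))"
  have d: "d > 0" using q C by (simp add: d_def)
  obtain t0 where t0: "V t0 < d" using small[OF d] by blast
  show ?thesis
  proof (cases "V t0 = 0")
    case False
    then have p: "V t0 > 0" using V0[of t0] by linarith
    define t where "t k = t0 + 1 - (1 / 2) ^ k" for k :: nat
    have base: "2 * C * V t0 powr (1 - a) \<le> q powr a"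
    proof -
      have "V t0 powr (1 - a) \<le> d powr (1 - a)" using t0 p a by (intro powr_mono2) auto
      also have "\<dots> = q powr a / (2 * C)" using a q C by (simp add: d_def powr_powr)
      finally show ?thesis using C by (simp add: field_simps)
    qed
    have claim: "V (t k) \<le> V t0 * q ^ k" for k
    proof (induction k)
      case 0 then show ?case by (simp add: t_def)
    next
      case (Suc k)
      let ?w = "(1 / 2) ^ Suc k :: real"
      have w: "0 < ?w" by simp
      have w1: "?w \<le> 1" by (rule power_le_one) auto
      have "V (t (Suc k)) powr a = V (t k + ?w) powr a" by (simp add: t_def)
      also have "\<dots> \<le> C / ?w * V (t k)" by (rule step[OF w w1])
      also have "\<dots> \<le> C / ?w * (V t0 * q ^ k)" using C w by (intro mult_left_mono Suc.IH) auto
      also have "\<dots> = (2 * C * V t0 powr (1 - a)) * V t0 powr a * (2 * q powr (1 - a)) ^ k * (q powr a) ^ k"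
      proof -
        have "V t0 = V t0 powr (1 - a) * V t0 powr a" using p by (simp add: powr_add[symmetric])
        moreover have "q ^ k = (q powr (1 - a)) ^ k * (q powr a) ^ k"
          using q by (simp add: power_mult_distrib[symmetric] powr_add[symmetric])
        ultimately have "C / ?w * (V t0 * q ^ k) = C / ?w * ((V t0 powr (1 - a) * V t0 powr a) * ((q powr (1 - a)) ^ k * (q powr a) ^ k))"
          by metis
        then show ?thesis by (simp add: power_divide power_mult_distrib mult_ac)
      qed
      also have "\<dots> = (2 * C * V t0 powr (1 - a)) * (V t0 powr a * (q powr a) ^ k)" by (simp add: q2)
      also have "\<dots> \<le> q powr a * (V t0 powr a * (q powr a) ^ k)" using base by (intro mult_right_mono) auto
      also have "\<dots> = (V t0 * q ^ Suc k) powr a"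
      proof -
        have "(q ^ Suc k) powr a = (q powr a) ^ Suc k" using q by (simp add: powr_realpow[symmetric] powr_powr mult.commute del: power_Suc)
        then show ?thesis using p q by (simp add: powr_mult mult_ac)
      qed
      finally have le: "V (t (Suc k)) powr a \<le> (V t0 * q ^ Suc k) powr a" .
      show ?case
      proof (rule ccontr)
        assume "\<not> ?thesis"
        then have "(V t0 * q ^ Suc k) powr a < V (t (Suc k)) powr a"
          using a p q by (intro powr_less_mono2) auto
        then show False using le by linarith
      qed
    qed
    have "V (t0 + 1) \<le> V t0 * q ^ k" for k
    proof -
      have "V (t0 + 1) \<le> V (t k)" by (rule mono) (simp add: t_def)
      then show ?thesis using claim[of k] by linarith
    qed
    moreover have "(\<lambda>k. V t0 * q ^ k) \<longlonglongrightarrow> V t0 * 0"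
      using q by (intro tendsto_mult_left LIMSEQ_realpow_zero) auto
    ultimately have "V (t0 + 1) \<le> 0" by (intro LIMSEQ_le_const[of "\<lambda>k. V t0 * q ^ k"]) auto
    then show ?thesis using V0[of "t0 + 1"] by (intro exI[of _ "t0 + 1"]) linarith
  qed blast
qed

text \<open>Optimality leaves little room for a cut. The pieces beyond \<open>t + w\<close> and
  before \<open>t\<close> both obey the isoperimetric inequality, and the term of the second falls
  short of that of the whole set by at most a multiple of \<open>?V t\<close>. What remains is the
  hypothesis of De Giorgi's iteration.\<close>

lemma minimiser_halfspace_bounded:
  fixes E :: "'a::euclidean_space set"
  assumes E: "open E" "emeasure lborel E = ennreal m" "m > 0" and n: "DIM('a) \<ge> 2"
    and P: "perimeter E \<le> ennreal (iso_const TYPE('a) * m powr ((real DIM('a) - 1) / real DIM('a)))"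
    and e: "norm e = 1"
  shows "\<exists>t. \<forall>x\<in>E. x \<bullet> e \<le> t"
proof -
  let ?a = "(real DIM('a) - 1) / real DIM('a)" and ?c = "iso_const TYPE('a)"
  let ?V = "tail_measure E e"
  have c: "?c > 0" by (rule iso_const_pos)
  have a: "0 < ?a" "?a < 1" using n by auto
  have Eb [measurable]: "E \<in> sets borel" using E(1) by simp
  have Efin: "emeasure lborel E < \<infinity>" using E(2) by simp
  have fin: "emeasure lborel (E \<inter> S) < \<infinity>" if "S \<in> sets borel" for S
    using emeasure_mono[of "E \<inter> S" E lborel] Efin Eb that by (auto intro: order.strict_trans1)
  have mono: "?V t \<le> ?V s" if "s \<le> t" for s t
    unfolding tail_measure_def using that fin[OF halfspace_borel, of s e]
    by (intro measure_mono_fmeasurable) (auto simp: fmeasurable_def)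
  have Vm: "?V t \<le> m" for t
  proof -
    have "?V t \<le> measure lborel E"
      unfolding tail_measure_def using Efin by (intro measure_mono_fmeasurable) (auto simp: fmeasurable_def)
    then show ?thesis using E(2,3) by (simp add: measure_def)
  qed
  have V0: "?V t \<ge> 0" for t by (simp add: tail_measure_def)
  have small: "\<exists>t. ?V t < d" if d: "d > 0" for d
  proof -
    have "(\<lambda>k. measure lborel (E \<inter> {x. real k < x \<bullet> e})) \<longlonglongrightarrow> measure lborel (\<Inter>k. E \<inter> {x. real k < x \<bullet> e})"
    proof (rule Lim_measure_decseq)
      show "range (\<lambda>k. E \<inter> {x. real k < x \<bullet> e}) \<subseteq> sets lborel" by auto
      show "decseq (\<lambda>k. E \<inter> {x. real k < x \<bullet> e})" by (auto simp: decseq_def)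
      show "emeasure lborel (E \<inter> {x. real k < x \<bullet> e}) \<noteq> \<infinity>" for k
        using fin[OF halfspace_borel, of "real k" e] by simp
    qed
    moreover have "(\<Inter>k. E \<inter> {x. real k < x \<bullet> e}) = {}"
    proof -
      have "\<exists>k. \<not> real k < x \<bullet> e" for x :: 'a using reals_Archimedean2[of "x \<bullet> e"] by (meson less_asym)
      then show ?thesis by auto
    qed
    ultimately have "(\<lambda>k. ?V (real k)) \<longlonglongrightarrow> 0" by (simp add: tail_measure_def)
    then have "\<forall>\<^sub>F k in sequentially. ?V (real k) < d" using d by (rule order_tendstoD(2))
    then show ?thesis by (auto simp: eventually_sequentially)
  qed
  \<comment> \<open>The linear term lost by the second piece, enlarged by
    \<open>1 / w \<ge> 1\<close>, plus the slab term \<open>8 / w\<close>, over the isoperimetric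
    constant.\<close>
  define C where "C = (?c * m powr (?a - 1) + 8) / ?c"
  have C: "C > 0" using c by (simp add: C_def add_nonneg_pos)
  have step: "?V (t + w) powr ?a \<le> C / w * ?V t" if w: "0 < w" "w \<le> 1" for t w
  proof -
    have "?c * ?V (t + w) powr ?a + ?c * (m - ?V t) powr ?a \<le> ?c * m powr ?a + 8 / w * ?V t"
      using c E(3) by (intro perimeter_split[OF E(1,2) _ P _ w(1) e]) auto
    moreover have "m powr ?a - m powr (?a - 1) * ?V t \<le> (m - ?V t) powr ?a"
    proof -
      define s where "s = 1 - ?V t / m"
      have s: "0 \<le> s" "s \<le> 1" using Vm[of t] V0[of t] E(3) by (auto simp: s_def)
      \<comment> \<open>For an exponent below 1 the power lies above the identity on
        \<open>[0, 1]\<close>; scaling by \<open>m powr ?a\<close> gives a lower bound linear in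
        \<open>?V t\<close>.\<close>
      have "s \<le> s powr ?a" using s a powr_mono'[of ?a 1 s] by (cases "s = 0") auto
      then have "m powr ?a * s \<le> m powr ?a * s powr ?a" by (intro mult_left_mono) auto
      also have "\<dots> = (m * s) powr ?a" using s E(3) by (simp add: powr_mult)
      also have "m * s = m - ?V t" using E(3) by (simp add: s_def field_simps)
      finally have "m powr ?a * s \<le> (m - ?V t) powr ?a" .
      moreover have "m powr ?a * s = m powr ?a - m powr (?a - 1) * ?V t"
        using E(3) by (simp add: s_def powr_diff algebra_simps)
      ultimately show ?thesis by simp
    qed
    then have "?c * (m powr ?a - m powr (?a - 1) * ?V t) \<le> ?c * (m - ?V t) powr ?a"
      using c by (intro mult_left_mono) auto
    ultimately have "?c * ?V (t + w) powr ?a \<le> (?c * m powr (?a - 1)) * ?V t + 8 / w * ?V t"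
      by (simp add: algebra_simps)
    also have "\<dots> \<le> (?c * m powr (?a - 1)) / w * ?V t + 8 / w * ?V t"
    proof -
      have "(?c * m powr (?a - 1)) * 1 \<le> (?c * m powr (?a - 1)) * (1 / w)"
        using w c by (intro mult_left_mono) auto
      then show ?thesis using V0[of t] by (intro add_right_mono mult_right_mono) auto
    qed
    also have "\<dots> = ?c * (C / w * ?V t)" using c by (simp add: C_def add_divide_distrib algebra_simps)
    finally show ?thesis by (rule mult_left_le_imp_le) (rule c)
  qed
  obtain t where t: "?V t = 0" using de_giorgi_iteration[OF a C V0 mono small step] by blast
  have op: "open (E \<inter> {x. t < x \<bullet> e})" using E(1) by (intro open_Int open_Collect_less continuous_intros)
  \<comment> \<open>The tail is open, so being null it is empty: measure zero becomes a pointwise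
    bound.\<close>
  have "E \<inter> {x. t < x \<bullet> e} = {}"
  proof (rule ccontr)
    assume ne: "E \<inter> {x. t < x \<bullet> e} \<noteq> {}"
    have "emeasure lborel (E \<inter> {x. t < x \<bullet> e}) = 0"
      using t fin[OF halfspace_borel, of t e] by (simp add: tail_measure_def emeasure_eq_ennreal_measure less_top)
    then have "negligible (E \<inter> {x. t < x \<bullet> e})"
      using op by (simp add: negligible_iff_null_sets null_sets_completionI null_setsI)
    then show False using open_not_negligible[OF op ne] by simp
  qed
  then show ?thesis by (intro exI[of _ t]) (force simp: not_less)
qed

theorem minimiser_bounded:
  fixes E :: "'a::euclidean_space set"
  assumes E: "open E" "emeasure lborel E = ennreal m" "m > 0" and n: "DIM('a) \<ge> 2"
    and P: "perimeter E \<le> ennreal (iso_const TYPE('a) * m powr ((real DIM('a) - 1) / real DIM('a)))"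
  shows "bounded E"
proof -
  have "\<exists>t. \<forall>x\<in>E. x \<bullet> e \<le> t" if "norm e = 1" for e
    by (rule minimiser_halfspace_bounded[OF E n P that])
  then obtain t where t: "\<And>e x. norm e = 1 \<Longrightarrow> x \<in> E \<Longrightarrow> x \<bullet> e \<le> t e" by metis
  have "E \<subseteq> cbox (\<Sum>b\<in>Basis. (- t (- b)) *\<^sub>R b) (\<Sum>b\<in>Basis. t b *\<^sub>R b)"
  proof
    fix x assume x: "x \<in> E"
    have "- t (- b) \<le> x \<bullet> b \<and> x \<bullet> b \<le> t b" if "b \<in> Basis" for b
      using t[of b x] t[of "- b" x] x that by simp
    then show "x \<in> cbox (\<Sum>b\<in>Basis. (- t (- b)) *\<^sub>R b) (\<Sum>b\<in>Basis. t b *\<^sub>R b)"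
      by (simp add: mem_box del: scaleR_minus_left)
  qed
  then show ?thesis using bounded_cbox bounded_subset by blast
qed

text \<open>Inside a ball of radius \<open>R\<close> the kernel is at least
  \<open>(2 * R) powr (- \<alpha>)\<close> for every pair of points, and the charge on
  \<open>A\<close> has mass 1; small energy therefore requires charges far apart.\<close>

lemma riesz_energy_bounded_pos:
  fixes A :: "'a::euclidean_space set"
  assumes A: "A \<in> sets borel" "bounded A" and \<alpha>: "\<alpha> > 0"
  shows "riesz_energy \<alpha> A > 0"
proof -
  obtain R where R: "R > 0" "\<And>x. x \<in> A \<Longrightarrow> norm x \<le> R" using A(2) bounded_pos by metis
  define c where "c = inverse (ennreal ((2 * R) powr \<alpha>))"
  have c: "c > 0" by (simp add: c_def zero_less_iff_neq_zero)
  have ker: "c \<le> 1 / ennreal (norm (x - y) powr \<alpha>)" if "x \<in> A" "y \<in> A" for x y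
  proof -
    have "norm (x - y) \<le> 2 * R" using R(2)[OF that(1)] R(2)[OF that(2)] norm_triangle_ineq4[of x y] by linarith
    then have "norm (x - y) powr \<alpha> \<le> (2 * R) powr \<alpha>" using \<alpha> by (intro powr_mono2) auto
    then have "inverse (ennreal ((2 * R) powr \<alpha>)) \<le> inverse (ennreal (norm (x - y) powr \<alpha>))"
    proof (cases "norm (x - y) powr \<alpha> = 0")
      case False
      then have "norm (x - y) powr \<alpha> > 0" by (simp add: less_le)
      moreover from this have "inverse ((2 * R) powr \<alpha>) \<le> inverse (norm (x - y) powr \<alpha>)"
        using \<open>norm (x - y) powr \<alpha> \<le> (2 * R) powr \<alpha>\<close> by (intro le_imp_inverse_le)
      ultimately show ?thesis using R(1) by (simp add: inverse_ennreal ennreal_leI)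
    qed simp
    then show ?thesis by (simp add: c_def divide_ennreal_def)
  qed
  have "c \<le> riesz_energy \<alpha> A"
    unfolding riesz_energy_def
  proof (rule INF_greatest)
    fix \<mu> :: "'a measure" assume "\<mu> \<in> {\<mu>. sets \<mu> = sets borel \<and> emeasure \<mu> A = 1}"
    then have \<mu>: "A \<in> sets \<mu>" "emeasure \<mu> A = 1" using A by auto
    have "c = (\<integral>\<^sup>+x. c * indicator A x \<partial>\<mu>)" using \<mu> by (simp add: nn_integral_cmult)
    also have "\<dots> \<le> (\<integral>\<^sup>+ x. (\<integral>\<^sup>+ y. 1 / ennreal (norm (x - y) powr \<alpha>) \<partial>\<mu>) \<partial>\<mu>)"
    proof (rule nn_integral_mono)
      fix x
      show "c * indicator A x \<le> (\<integral>\<^sup>+ y. 1 / ennreal (norm (x - y) powr \<alpha>) \<partial>\<mu>)"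
      proof (cases "x \<in> A")
        case True
        have "c = (\<integral>\<^sup>+y. c * indicator A y \<partial>\<mu>)" using \<mu> by (simp add: nn_integral_cmult)
        also have "\<dots> \<le> (\<integral>\<^sup>+ y. 1 / ennreal (norm (x - y) powr \<alpha>) \<partial>\<mu>)"
          using ker[OF True] by (intro nn_integral_mono) (auto simp: indicator_def)
        finally show ?thesis using True by simp
      qed simp
    qed
    finally show "c \<le> (\<integral>\<^sup>+ x. (\<integral>\<^sup>+ y. 1 / ennreal (norm (x - y) powr \<alpha>) \<partial>\<mu>) \<partial>\<mu>)" .
  qed
  then show ?thesis using c by (rule less_le_trans[rotated])
qed

section \<open>The energy of dispersed charges\<close>

abbreviation riesz_kernel :: "real \<Rightarrow> 'a::euclidean_space \<Rightarrow> ennreal" where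
  "riesz_kernel \<alpha> z \<equiv> 1 / ennreal (norm z powr \<alpha>)"

text \<open>For a unit vector \<open>e\<close>, the orthogonal projection onto its complement. It
  maps the ball to the flat disc, so charges on the disc arise as images of charges on the
  ball.\<close>

definition drop_coord :: "'a::euclidean_space \<Rightarrow> 'a \<Rightarrow> 'a" where
  "drop_coord e x = x - (x \<bullet> e) *\<^sub>R e"

lemma drop_coord_measurable [measurable]: "drop_coord e \<in> borel_measurable borel"
  unfolding drop_coord_def by measurable

lemma drop_coord_diff: "drop_coord e x - drop_coord e y = drop_coord e (x - y)"
  by (simp add: drop_coord_def inner_diff_left algebra_simps)

lemma norm_drop_coord_le:
  assumes "e \<in> Basis"
  shows "norm (drop_coord e x) \<le> norm x"
proof (rule norm_le_componentwise)
  fix b :: 'a assume "b \<in> Basis"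
  then show "\<bar>drop_coord e x \<bullet> b\<bar> \<le> \<bar>x \<bullet> b\<bar>"
    using assms by (auto simp: drop_coord_def inner_diff_left inner_Basis)
qed

text \<open>The two vectors may lie in different spaces, so that a vector can be compared with a
  real radius; for \<open>x = 0\<close> the right-hand kernel is infinite.\<close>

lemma riesz_kernel_mono:
  fixes x :: "'a::euclidean_space" and y :: "'b::euclidean_space"
  assumes "norm x \<le> norm y" "\<alpha> > 0"
  shows "riesz_kernel \<alpha> y \<le> riesz_kernel \<alpha> x"
proof (cases "x = 0")
  case True then show ?thesis by (simp add: divide_ennreal_def)
next
  case False
  then have x: "norm x powr \<alpha> > 0" by simp
  have le: "norm x powr \<alpha> \<le> norm y powr \<alpha>" using assms by (intro powr_mono2) auto
  then have "inverse (norm y powr \<alpha>) \<le> inverse (norm x powr \<alpha>)" using x by (intro le_imp_inverse_le)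
  moreover have "norm y powr \<alpha> > 0" using x le by linarith
  ultimately show ?thesis using x by (simp only: divide_ennreal_def inverse_ennreal ennreal_leI mult_1)
qed

lemma riesz_kernel_le:
  fixes x :: "'a::euclidean_space"
  assumes "0 < D" "D \<le> norm x" "\<alpha> > 0"
  shows "riesz_kernel \<alpha> x \<le> ennreal (1 / D powr \<alpha>)"
proof -
  have "riesz_kernel \<alpha> x \<le> riesz_kernel \<alpha> D" using assms by (intro riesz_kernel_mono) auto
  also have "\<dots> = ennreal (1 / D powr \<alpha>)" using assms by (simp add: divide_ennreal[symmetric])
  finally show ?thesis .
qed

lemma riesz_kernel_scaleR:
  fixes x :: "'a::euclidean_space"
  assumes "r > 0"
  shows "riesz_kernel \<alpha> (r *\<^sub>R x) = ennreal (1 / r powr \<alpha>) * riesz_kernel \<alpha> x"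
proof (cases "x = 0")
  case True
  then show ?thesis using assms by (simp add: divide_ennreal_def ennreal_mult_top ennreal_top_mult)
next
  case False
  then have "norm x powr \<alpha> > 0" "r powr \<alpha> > 0" using assms by auto
  then show ?thesis using assms
    by (simp add: powr_mult divide_ennreal_def inverse_ennreal ennreal_mult[symmetric] divide_inverse)
qed

text \<open>The cylinder fits into a box of half-length 2 along \<open>e\<close> and
  \<open>s\<close> across. The power \<open>s ^ (d - 1)\<close> is the origin of the condition
  \<open>\<alpha> < d - 1\<close>.\<close>

lemma slab_cylinder_measure:
  fixes e :: "'a::euclidean_space"
  assumes e: "e \<in> Basis" and s: "s \<ge> 0"
  shows "emeasure lborel {z \<in> ball 0 2. norm (drop_coord e z) < s} \<le> ennreal (4 * (2 * s) ^ (DIM('a) - 1))"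
proof -
  define u :: 'a where "u = (\<Sum>b\<in>Basis. (if b = e then 2 else s) *\<^sub>R b)"
  have u: "u \<bullet> b = (if b = e then 2 else s)" if "b \<in> Basis" for b
    using that by (simp add: u_def)
  have "{z \<in> ball 0 2. norm (drop_coord e z) < s} \<subseteq> cbox (- u) u"
  proof
    fix z assume z: "z \<in> {z \<in> ball (0::'a) 2. norm (drop_coord e z) < s}"
    have "\<bar>z \<bullet> b\<bar> \<le> u \<bullet> b" if b: "b \<in> Basis" for b
    proof (cases "b = e")
      case True
      then show ?thesis using Basis_le_norm[OF b, of z] z u[OF b] by simp
    next
      case False
      then have "drop_coord e z \<bullet> b = z \<bullet> b" using e b by (simp add: drop_coord_def inner_diff_left inner_Basis)
      then show ?thesis using Basis_le_norm[OF b, of "drop_coord e z"] z u[OF b] False by simp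
    qed
    then show "z \<in> cbox (- u) u" by (force simp: mem_box abs_le_iff)
  qed
  then have "emeasure lborel {z \<in> ball 0 2. norm (drop_coord e z) < s} \<le> emeasure lborel (cbox (- u) u)"
    by (intro emeasure_mono) auto
  also have "\<dots> = ennreal (\<Prod>b\<in>Basis. 2 * (u \<bullet> b))"
  proof -
    have "(- u) \<bullet> b \<le> u \<bullet> b" if "b \<in> Basis" for b using u[OF that] s by simp
    then have "emeasure lborel (cbox (- u) u) = ennreal (\<Prod>b\<in>Basis. (u - (- u)) \<bullet> b)" by (rule emeasure_lborel_cbox)
    moreover have "(u - (- u)) \<bullet> b = 2 * (u \<bullet> b)" for b by (simp add: inner_add_left)
    ultimately show ?thesis by (simp only:)
  qed
  also have "(\<Prod>b\<in>Basis. 2 * (u \<bullet> b)) = 4 * (2 * s) ^ (DIM('a) - 1)"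
  proof -
    have "(\<Prod>b\<in>Basis. 2 * (u \<bullet> b)) = 2 * (u \<bullet> e) * (\<Prod>b\<in>Basis - {e}. 2 * (u \<bullet> b))"
      using e by (simp add: prod.remove)
    also have "(\<Prod>b\<in>Basis - {e}. 2 * (u \<bullet> b)) = (\<Prod>b\<in>Basis - {e}. 2 * s)"
      using u by (intro prod.cong) auto
    finally show ?thesis using u[OF e] e by (simp add: card_Diff_singleton)
  qed
  finally show ?thesis .
qed

text \<open>Dyadic decomposition by the distance from the axis along \<open>e\<close>: at distance
  about \<open>2 powr (- k)\<close> the kernel is of order \<open>2 powr (k * \<alpha>)\<close>, on
  a volume of order \<open>2 powr (- k * (d - 1))\<close>, and the geometric series converges.
  Radius 2 covers all differences of points of the unit ball.\<close>

lemma drop_coord_kernel_integral: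
  fixes e :: "'a::euclidean_space"
  assumes e: "e \<in> Basis" and n: "DIM('a) \<ge> 2" and \<alpha>: "0 < \<alpha>" "\<alpha> < real DIM('a) - 1"
  shows "(\<integral>\<^sup>+z\<in>ball 0 2. riesz_kernel \<alpha> (drop_coord e z) \<partial>lborel) < \<infinity>"
proof -
  define S where "S k = {z \<in> ball (0::'a) 2. norm (drop_coord e z) < 2 * (1/2) ^ k}" for k :: nat
  have Sm [measurable]: "S k \<in> sets borel" for k unfolding S_def by measurable
  have pt: "riesz_kernel \<alpha> (drop_coord e z) * indicator (ball 0 2) z \<le> (\<Sum>k. ennreal ((2 ^ k) powr \<alpha>) * indicator (S k) z)"
    if z: "drop_coord e z \<noteq> 0" for z
  proof (cases "z \<in> ball 0 2")
    case True
    let ?p = "norm (drop_coord e z)"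
    have p: "?p > 0" "?p < 2" using z True norm_drop_coord_le[OF e, of z] by auto
    \<comment> \<open>The first dyadic radius not above the distance; its minimality is matched by
      the factor 2 in the definition of \<open>S\<close>.\<close>
    define k where "k = (LEAST k. (1/2::real) ^ k \<le> ?p)"
    have "\<exists>k. (1/2::real) ^ k < ?p" using p(1) by (intro real_arch_pow_inv) auto
    then have "\<exists>k. (1/2::real) ^ k \<le> ?p" using less_imp_le by blast
    then have k1: "(1/2::real) ^ k \<le> ?p" unfolding k_def by (rule LeastI_ex)
    have k2: "?p < 2 * (1/2) ^ k"
    proof (cases k)
      case 0 then show ?thesis using p by simp
    next
      case (Suc j)
      then have "\<not> (1/2::real) ^ j \<le> ?p" using not_less_Least[of j "\<lambda>k. (1/2::real) ^ k \<le> ?p"] by (simp add: k_def)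
      then show ?thesis using Suc by simp
    qed
    have "riesz_kernel \<alpha> (drop_coord e z) \<le> ennreal (1 / ((1/2) ^ k) powr \<alpha>)"
      using k1 \<alpha> by (intro riesz_kernel_le) auto
    also have "1 / ((1/2::real) ^ k) powr \<alpha> = (2 ^ k) powr \<alpha>"
      by (simp add: power_divide powr_divide)
    also have "ennreal ((2 ^ k) powr \<alpha>) \<le> (\<Sum>j. ennreal ((2 ^ j) powr \<alpha>) * indicator (S j) z)"
    proof -
      define F where "F j = ennreal ((2 ^ j) powr \<alpha>) * indicator (S j) z" for j
      have "F k \<le> suminf F" using sum_le_suminf[of F "{k}"] by simp
      moreover have "F k = ennreal ((2 ^ k) powr \<alpha>)" using True k2 by (simp add: F_def S_def)
      ultimately show ?thesis by (simp add: F_def[abs_def])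
    qed
    finally show ?thesis using True by simp
  qed simp
  \<comment> \<open>In dimension at least 2 there is a second basis vector \<open>b\<close>, and the
    axis lies in the null hyperplane \<open>z \<bullet> b = 0\<close>.\<close>
  have ae: "AE z in lborel. drop_coord e z \<noteq> 0"
  proof -
    have "\<not> (Basis :: 'a set) \<subseteq> {e}"
    proof
      assume "(Basis :: 'a set) \<subseteq> {e}"
      then have "DIM('a) \<le> card {e}" by (intro card_mono) auto
      then show False using n by simp
    qed
    then obtain b :: 'a where b: "b \<in> Basis" "b \<noteq> e" by blast
    have "AE z in lborel. z \<notin> {z::'a. z \<bullet> b = 0}" using null_hyperplane_Basis[OF b(1)] by (rule AE_not_in)
    then show ?thesis
    proof (rule eventually_mono)
      fix z assume "z \<notin> {z::'a. z \<bullet> b = 0}"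
      moreover have "drop_coord e z \<bullet> b = z \<bullet> b" using e b by (simp add: drop_coord_def inner_diff_left inner_Basis)
      ultimately show "drop_coord e z \<noteq> 0" by auto
    qed
  qed
  have "(\<integral>\<^sup>+z\<in>ball 0 2. riesz_kernel \<alpha> (drop_coord e z) \<partial>lborel) \<le> (\<integral>\<^sup>+z. (\<Sum>k. ennreal ((2 ^ k) powr \<alpha>) * indicator (S k) z) \<partial>lborel)"
    by (rule nn_integral_mono_AE, rule eventually_mono[OF ae]) (rule pt)
  also have "\<dots> = (\<Sum>k. \<integral>\<^sup>+z. ennreal ((2 ^ k) powr \<alpha>) * indicator (S k) z \<partial>lborel)"
    by (rule nn_integral_suminf) measurable
  also have "\<dots> = (\<Sum>k. ennreal ((2 ^ k) powr \<alpha>) * emeasure lborel (S k))"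
    by (simp add: nn_integral_cmult_indicator)
  also have "\<dots> \<le> (\<Sum>k. ennreal (4 ^ DIM('a) * (2 powr (\<alpha> - (real DIM('a) - 1))) ^ k))"
  proof (rule suminf_le)
    fix k
    have n1: "real (DIM('a) - 1) = real DIM('a) - 1" using n by simp
    have le: "ennreal ((2 ^ k) powr \<alpha>) * emeasure lborel (S k) \<le> ennreal ((2 ^ k) powr \<alpha>) * ennreal (4 * (2 * (2 * (1/2) ^ k)) ^ (DIM('a) - 1))"
      unfolding S_def by (intro mult_left_mono slab_cylinder_measure e) auto
    have eq: "(2 ^ k) powr \<alpha> * (4 * (2 * (2 * (1/2) ^ k)) ^ (DIM('a) - 1)) = 4 ^ DIM('a) * (2 powr (\<alpha> - (real DIM('a) - 1))) ^ k"
    proof -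
      have 1: "(2 * (2 * (1/2::real) ^ k)) ^ (DIM('a) - 1) = 4 ^ (DIM('a) - 1) * ((1/2) ^ k) ^ (DIM('a) - 1)"
      proof -
        have "2 * (2 * x) = 4 * x" for x :: real by simp
        then show ?thesis by (simp only: power_mult_distrib)
      qed
      have 2: "4 * 4 ^ (DIM('a) - 1) = (4::real) ^ DIM('a)" using power_minus_mult[of "DIM('a)" "4::real"] by simp
      have 3: "((1/2::real) ^ k) ^ (DIM('a) - 1) = (2 powr (- (real DIM('a) - 1))) ^ k"
      proof -
        have "2 powr (- (real DIM('a) - 1)) = (1/2::real) ^ (DIM('a) - 1)"
          unfolding n1[symmetric] powr_minus powr_realpow[OF zero_less_numeral]
          by (simp only: power_one_over inverse_eq_divide)
        moreover have "(x ^ k) ^ l = (x ^ l) ^ k" for x :: real and l by (metis power_mult mult.commute)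
        ultimately show ?thesis by metis
      qed
      have 4: "(2 ^ k) powr \<alpha> = (2 powr \<alpha>) ^ k" by (simp add: powr_realpow[symmetric] powr_powr mult.commute)
      have 5: "2 powr (\<alpha> - (real DIM('a) - 1)) = 2 powr \<alpha> * 2 powr (- (real DIM('a) - 1))"
        by (simp only: diff_conv_add_uminus powr_add)
      have "(2 ^ k) powr \<alpha> * (4 * (2 * (2 * (1/2) ^ k)) ^ (DIM('a) - 1))
          = (4 * 4 ^ (DIM('a) - 1)) * ((2 powr \<alpha>) ^ k * (2 powr (- (real DIM('a) - 1))) ^ k)"
        unfolding 1 3 4 by (simp only: mult_ac)
      then show ?thesis unfolding 2 5 power_mult_distrib .
    qed
    show "ennreal ((2 ^ k) powr \<alpha>) * emeasure lborel (S k) \<le> ennreal (4 ^ DIM('a) * (2 powr (\<alpha> - (real DIM('a) - 1))) ^ k)"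
      using le unfolding eq[symmetric] by (subst ennreal_mult) auto
  qed auto
  also have "\<dots> < \<infinity>"
  proof -
    have "2 powr (\<alpha> - (real DIM('a) - 1)) < 1" using \<alpha> by (intro powr_less_one) auto
    then have "summable (\<lambda>k. 4 ^ DIM('a) * (2 powr (\<alpha> - (real DIM('a) - 1))) ^ k)"
      by (intro summable_mult summable_geometric) auto
    then show ?thesis by (subst suminf_ennreal2) auto
  qed
  finally show ?thesis .
qed

lemma nn_integral_reflect:
  fixes f :: "'a::euclidean_space \<Rightarrow> ennreal"
  assumes "f \<in> borel_measurable borel"
  shows "(\<integral>\<^sup>+y. f (x - y) \<partial>lborel) = (\<integral>\<^sup>+y. f y \<partial>lborel)"
proof -
  have *: "(lborel :: 'a measure) = distr lborel borel (\<lambda>y::'a. x - y)"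
    using lborel_affine[of "-1" x] by (simp add: density_1)
  have "(\<integral>\<^sup>+y. f y \<partial>lborel) = (\<integral>\<^sup>+y. f y \<partial>(distr lborel borel (\<lambda>y::'a. x - y)))" using * by simp
  also have "\<dots> = (\<integral>\<^sup>+y. f (x - y) \<partial>lborel)" using assms by (intro nn_integral_distr) auto
  finally show ?thesis by simp
qed

section \<open>The uniform charge on the unit ball\<close>

definition unit_charge :: "'a::euclidean_space measure" where
  "unit_charge = uniform_measure lborel (ball 0 1)"

lemma unit_charge_basic:
  shows "prob_space (unit_charge :: 'a::euclidean_space measure)" "sets (unit_charge :: 'a measure) = sets borel"
    "e \<in> Basis \<Longrightarrow> AE x in (unit_charge :: 'a measure). x \<in> ball 0 1 \<and> x \<bullet> e \<noteq> 0"
proof -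
  have b: "emeasure lborel (ball (0::'a) 1) = ennreal (unit_ball_vol (real DIM('a)))" by (simp add: emeasure_ball)
  have p: "emeasure lborel (ball (0::'a) 1) \<noteq> 0"
    using unit_ball_vol_pos[of "real DIM('a)"] by (simp add: b ennreal_eq_0_iff not_le)
  show "prob_space (unit_charge :: 'a measure)" unfolding unit_charge_def by (rule prob_space_uniform_measure[OF p]) (simp add: b)
  show "sets (unit_charge :: 'a measure) = sets borel" by (simp add: unit_charge_def)
  assume e: "e \<in> (Basis :: 'a set)"
  have "AE x in lborel. x \<notin> {x::'a. x \<bullet> e = 0}" using null_hyperplane_Basis[OF e] by (rule AE_not_in)
  then show "AE x in (unit_charge :: 'a measure). x \<in> ball 0 1 \<and> x \<bullet> e \<noteq> 0"
    unfolding unit_charge_def by (intro AE_uniform_measureI) (auto elim: eventually_mono)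
qed

text \<open>Differences of points of the unit ball lie in the ball of radius 2, so the potential at
  every such point is at most the kernel integral \<open>K\<close> over that ball divided by the
  volume \<open>v\<close>.\<close>

lemma unit_charge_energy:
  fixes e :: "'a::euclidean_space"
  assumes e: "e \<in> Basis" and n: "DIM('a) \<ge> 2" and \<alpha>: "0 < \<alpha>" "\<alpha> < real DIM('a) - 1"
  shows "(\<integral>\<^sup>+x. (\<integral>\<^sup>+y. riesz_kernel \<alpha> (drop_coord e x - drop_coord e y) \<partial>unit_charge) \<partial>unit_charge) < \<infinity>"
proof -
  let ?B = "ball (0::'a) 1" and ?k = "\<lambda>z. riesz_kernel \<alpha> (drop_coord e z)"
  define v where "v = emeasure lborel ?B"
  have vb: "v = ennreal (unit_ball_vol (real DIM('a)))" by (simp add: v_def emeasure_ball)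
  have v0: "v \<noteq> 0" using unit_ball_vol_pos[of "real DIM('a)"] by (simp add: vb ennreal_eq_0_iff not_le)
  have [measurable]: "ball (0::'a) 2 \<in> sets borel" by simp
  have km [measurable]: "?k \<in> borel_measurable borel" by measurable
  define K where "K = (\<integral>\<^sup>+z\<in>ball 0 2. ?k z \<partial>lborel)"
  have K: "K < \<infinity>" unfolding K_def by (rule drop_coord_kernel_integral[OF e n \<alpha>])
  have inner: "(\<integral>\<^sup>+y. riesz_kernel \<alpha> (drop_coord e x - drop_coord e y) \<partial>unit_charge) \<le> K / v" if x: "x \<in> ?B" for x
  proof -
    have "(\<integral>\<^sup>+y. riesz_kernel \<alpha> (drop_coord e x - drop_coord e y) \<partial>unit_charge) = (\<integral>\<^sup>+y\<in>?B. ?k (x - y) \<partial>lborel) / v"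
      unfolding unit_charge_def v_def drop_coord_diff by (rule nn_integral_uniform_measure) auto
    also have "\<dots> \<le> K / v"
    proof (rule divide_right_mono_ennreal)
      have "(\<integral>\<^sup>+y\<in>?B. ?k (x - y) \<partial>lborel) \<le> (\<integral>\<^sup>+y. ?k (x - y) * indicator (ball 0 2) (x - y) \<partial>lborel)"
      proof (rule nn_integral_mono)
        fix y
        have "norm (x - y) < 2" if "y \<in> ?B" using norm_triangle_ineq4[of x y] x that by simp
        then show "?k (x - y) * indicator ?B y \<le> ?k (x - y) * indicator (ball 0 2) (x - y)"
          by (auto simp: indicator_def)
      qed
      also have "\<dots> = K" unfolding K_def by (rule nn_integral_reflect) measurable
      finally show "(\<integral>\<^sup>+y\<in>?B. ?k (x - y) \<partial>lborel) \<le> K" .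
    qed
    finally show ?thesis .
  qed
  interpret prob_space "unit_charge :: 'a measure" by (rule unit_charge_basic(1))
  have "(\<integral>\<^sup>+x. (\<integral>\<^sup>+y. riesz_kernel \<alpha> (drop_coord e x - drop_coord e y) \<partial>unit_charge) \<partial>unit_charge) \<le> (\<integral>\<^sup>+x. K / v \<partial>(unit_charge :: 'a measure))"
    by (rule nn_integral_mono_AE, rule eventually_mono[OF unit_charge_basic(3)[OF e]]) (use inner in auto)
  also have "\<dots> = K / v" by (simp add: emeasure_space_1)
  also have "\<dots> < \<infinity>" using K v0 by (simp add: ennreal_divide_eq_top_iff less_top[symmetric])
  finally show ?thesis .
qed

text \<open>The charge is shared equally among \<open>N\<close> small pieces at mutual distance at least \<open>D\<close>:
  the self-energies contribute \<open>N N\<^sup>-\<^sup>2 r\<^sup>-\<^sup>\<alpha> J\<close>, the interactions at most \<open>D\<^sup>-\<^sup>\<alpha>\<close>.\<close>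

lemma riesz_energy_dispersed:
  fixes c :: "nat \<Rightarrow> 'a::euclidean_space" and q :: "'a \<Rightarrow> 'a"
  assumes e: "e \<in> Basis" and \<alpha>: "\<alpha> > 0" and N: "N > 0" and r: "0 < r" "r \<le> 1" and D: "D > 0"
    and c: "\<And>i j. \<lbrakk>i < N; j < N; i \<noteq> j\<rbrakk> \<Longrightarrow> norm (c i - c j) \<ge> D + 2"
    and q [measurable]: "q \<in> borel_measurable borel" and q1: "\<And>x. norm (q x) \<le> norm x"
    and q2: "\<And>x y. norm (drop_coord e x - drop_coord e y) \<le> norm (q x - q y)"
    and A [measurable]: "A \<in> sets borel" and in_A: "\<And>i x. \<lbrakk>i < N; norm x < 1; x \<bullet> e \<noteq> 0\<rbrakk> \<Longrightarrow> c i + r *\<^sub>R q x \<in> A"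
  shows "riesz_energy \<alpha> A \<le> ennreal (1 / (real N * r powr \<alpha>))
      * (\<integral>\<^sup>+x. (\<integral>\<^sup>+y. riesz_kernel \<alpha> (drop_coord e x - drop_coord e y) \<partial>unit_charge) \<partial>unit_charge)
    + ennreal (1 / D powr \<alpha>)"
proof -
  let ?\<nu> = "unit_charge :: 'a measure"
  \<comment> \<open>An index \<open>i\<close> drawn uniformly and an independent point
    \<open>x\<close> of the unit ball: \<open>\<mu>\<close> is the law of
    \<open>c i + r *\<^sub>R q x\<close>, a unit charge shared equally among the pieces.\<close>
  define P where "P = measure_pmf (pmf_of_set {..<N})"
  have ne: "{..<N} \<noteq> {}" using N by auto
  have nnP: "(\<integral>\<^sup>+i. f i \<partial>P) = (\<Sum>i<N. f i) / of_nat N" for f :: "nat \<Rightarrow> ennreal"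
    using nn_integral_pmf_of_set[OF ne finite_lessThan, of f] by (simp add: P_def ennreal_of_nat_eq_real_of_nat)
  have setsnu [measurable_cong]: "sets ?\<nu> = sets borel" by (rule unit_charge_basic(2))
  have setsP [measurable_cong]: "sets P = sets (count_space UNIV)" by (simp add: P_def)
  interpret nu: prob_space ?\<nu> by (rule unit_charge_basic(1))
  define T where "T = (\<lambda>(i, x). c i + r *\<^sub>R q x)"
  have Tm [measurable]: "T \<in> borel_measurable (P \<Otimes>\<^sub>M ?\<nu>)"
    unfolding T_def by measurable
  define \<mu> where "\<mu> = distr (P \<Otimes>\<^sub>M ?\<nu>) borel T"
  have int\<mu>: "(\<integral>\<^sup>+z. f z \<partial>\<mu>) = (\<Sum>i<N. \<integral>\<^sup>+x. f (c i + r *\<^sub>R q x) \<partial>?\<nu>) / of_nat N"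
    if [measurable]: "f \<in> borel_measurable borel" for f
  proof -
    have "(\<integral>\<^sup>+z. f z \<partial>\<mu>) = (\<integral>\<^sup>+p. f (T p) \<partial>(P \<Otimes>\<^sub>M ?\<nu>))" unfolding \<mu>_def by (rule nn_integral_distr) measurable
    also have "\<dots> = (\<integral>\<^sup>+i. \<integral>\<^sup>+x. f (T (i, x)) \<partial>?\<nu> \<partial>P)" by (rule nu.nn_integral_fst[symmetric]) measurable
    also have "\<dots> = (\<Sum>i<N. \<integral>\<^sup>+x. f (c i + r *\<^sub>R q x) \<partial>?\<nu>) / of_nat N" by (simp add: nnP T_def)
    finally show ?thesis .
  qed
  note ae = unit_charge_basic(3)[OF e]
  have N1: "of_nat N / of_nat N = (1::ennreal)" using N by (intro ennreal_divide_self) (auto simp: ennreal_of_nat_eq_real_of_nat)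
  have \<mu>A: "emeasure \<mu> A = 1"
  proof -
    have sm: "sets \<mu> = sets borel" by (simp add: \<mu>_def)
    have "emeasure \<mu> A = (\<integral>\<^sup>+z. indicator A z \<partial>\<mu>)" using A sm by simp
    also have "\<dots> = (\<Sum>i<N. \<integral>\<^sup>+x. indicator A (c i + r *\<^sub>R q x) \<partial>?\<nu>) / of_nat N" by (rule int\<mu>) measurable
    also have "(\<Sum>i<N. \<integral>\<^sup>+x. indicator A (c i + r *\<^sub>R q x) \<partial>?\<nu>) = (\<Sum>i<N. \<integral>\<^sup>+x. 1 \<partial>?\<nu>)"
    proof (rule sum.cong[OF refl])
      fix i assume "i \<in> {..<N}"
      then show "(\<integral>\<^sup>+x. indicator A (c i + r *\<^sub>R q x) \<partial>?\<nu>) = (\<integral>\<^sup>+x. 1 \<partial>?\<nu>)"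
        using in_A by (intro nn_integral_cong_AE eventually_mono[OF ae]) auto
    qed
    also have "\<dots> = of_nat N" by (simp add: nu.emeasure_space_1)
    finally show ?thesis using N1 by simp
  qed
  have \<mu>prob: "prob_space \<mu>"
  proof -
    have "emeasure \<mu> (space \<mu>) = (\<integral>\<^sup>+z. 1 \<partial>\<mu>)" by simp
    also have "\<dots> = (\<Sum>i<N. \<integral>\<^sup>+x. 1 \<partial>?\<nu>) / of_nat N" by (rule int\<mu>) measurable
    also have "\<dots> = 1" using N1 by (simp add: nu.emeasure_space_1)
    finally show ?thesis by (rule prob_spaceI)
  qed
  interpret mu: prob_space \<mu> by (rule \<mu>prob)
  have sets\<mu> [measurable_cong]: "sets \<mu> = sets borel" by (simp add: \<mu>_def)
  let ?k = "\<lambda>x y. riesz_kernel \<alpha> (x - y)"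
  define X where "X x = (\<integral>\<^sup>+y. riesz_kernel \<alpha> (drop_coord e x - drop_coord e y) \<partial>?\<nu>)" for x
  have Xm [measurable]: "X \<in> borel_measurable borel" unfolding X_def by measurable
  define X' where "X' x = ennreal (1 / r powr \<alpha>) * X x" for x
  let ?Y = "ennreal (1 / D powr \<alpha>)"
  define h where "h z = (\<integral>\<^sup>+y. ?k z y \<partial>\<mu>)" for z
  have hm [measurable]: "h \<in> borel_measurable borel" unfolding h_def by measurable
  have inner: "h (c i + r *\<^sub>R q x) \<le> X' x / of_nat N + ?Y" if i: "i < N" and x: "norm x < 1" for i x
  proof -
    \<comment> \<open>\<open>X' x\<close> bounds the potential of the own piece, by scaling, and
      \<open>?Y\<close> that of any other piece. Adding \<open>?Y\<close> also for
      \<open>j = i\<close> makes the average over \<open>j\<close> exactly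
      \<open>X' x / N + ?Y\<close>.\<close>
    have jb: "(\<integral>\<^sup>+y. ?k (c i + r *\<^sub>R q x) (c j + r *\<^sub>R q y) \<partial>?\<nu>) \<le> (if j = i then X' x else 0) + ?Y" if j: "j < N" for j
    proof (cases "j = i")
      case True
      have "?k (c i + r *\<^sub>R q x) (c i + r *\<^sub>R q y) \<le> ennreal (1 / r powr \<alpha>) * riesz_kernel \<alpha> (drop_coord e x - drop_coord e y)" for y
      proof -
        have "c i + r *\<^sub>R q x - (c i + r *\<^sub>R q y) = r *\<^sub>R (q x - q y)" by (simp add: scaleR_diff_right)
        then have "?k (c i + r *\<^sub>R q x) (c i + r *\<^sub>R q y) = ennreal (1 / r powr \<alpha>) * riesz_kernel \<alpha> (q x - q y)"
          by (simp only: riesz_kernel_scaleR[OF r(1)])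
        also have "\<dots> \<le> ennreal (1 / r powr \<alpha>) * riesz_kernel \<alpha> (drop_coord e x - drop_coord e y)"
          by (intro mult_left_mono riesz_kernel_mono q2 \<alpha>) auto
        finally show ?thesis .
      qed
      then have "(\<integral>\<^sup>+y. ?k (c i + r *\<^sub>R q x) (c i + r *\<^sub>R q y) \<partial>?\<nu>) \<le> (\<integral>\<^sup>+y. ennreal (1 / r powr \<alpha>) * riesz_kernel \<alpha> (drop_coord e x - drop_coord e y) \<partial>?\<nu>)"
        by (intro nn_integral_mono)
      also have "\<dots> = X' x" unfolding X'_def X_def by (rule nn_integral_cmult) measurable
      finally show ?thesis using True by (simp add: add_increasing2)
    next
      case False
      have "(\<integral>\<^sup>+y. ?k (c i + r *\<^sub>R q x) (c j + r *\<^sub>R q y) \<partial>?\<nu>) \<le> (\<integral>\<^sup>+y. ?Y \<partial>?\<nu>)"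
      proof (rule nn_integral_mono_AE, rule eventually_mono[OF ae])
        fix y assume "y \<in> ball (0::'a) 1 \<and> y \<bullet> e \<noteq> 0"
        then have y: "norm y < 1" by simp
        \<comment> \<open>Each displacement from a centre has length at most 1; the 2 in
          \<open>D + 2\<close> absorbs two of them.\<close>
        have "norm (r *\<^sub>R q x) \<le> 1 * 1" "norm (r *\<^sub>R q y) \<le> 1 * 1"
          using q1[of x] q1[of y] x y r unfolding norm_scaleR by (intro mult_mono; simp)+
        moreover have "norm (c i - c j) \<le> norm (c i + r *\<^sub>R q x - (c j + r *\<^sub>R q y)) + norm (r *\<^sub>R q x - r *\<^sub>R q y)"
          using norm_triangle_ineq4[of "c i + r *\<^sub>R q x - (c j + r *\<^sub>R q y)" "r *\<^sub>R q x - r *\<^sub>R q y"] by (simp add: algebra_simps)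
        moreover have "norm (r *\<^sub>R q x - r *\<^sub>R q y) \<le> norm (r *\<^sub>R q x) + norm (r *\<^sub>R q y)" by (rule norm_triangle_ineq4)
        moreover have "norm (c i - c j) \<ge> D + 2" using c[OF i j] False by simp
        ultimately have "D \<le> norm (c i + r *\<^sub>R q x - (c j + r *\<^sub>R q y))" by linarith
        then show "?k (c i + r *\<^sub>R q x) (c j + r *\<^sub>R q y) \<le> ?Y" using D \<alpha> by (intro riesz_kernel_le)
      qed
      also have "\<dots> = ?Y" by (simp add: nu.emeasure_space_1)
      finally show ?thesis using False by simp
    qed
    have "h (c i + r *\<^sub>R q x) = (\<Sum>j<N. \<integral>\<^sup>+y. ?k (c i + r *\<^sub>R q x) (c j + r *\<^sub>R q y) \<partial>?\<nu>) / of_nat N"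
      unfolding h_def by (rule int\<mu>) measurable
    also have "\<dots> \<le> (\<Sum>j<N. (if j = i then X' x else 0) + ?Y) / of_nat N"
      using jb by (intro divide_right_mono_ennreal sum_mono) auto
    also have "\<dots> = (X' x + of_nat N * ?Y) / of_nat N" using i by (simp add: sum.distrib)
    also have "\<dots> = X' x / of_nat N + ?Y"
      using N by (simp add: add_divide_distrib_ennreal mult_divide_eq_ennreal mult.commute[of "of_nat N"])
    finally show ?thesis .
  qed
  have "riesz_energy \<alpha> A \<le> (\<integral>\<^sup>+x. h x \<partial>\<mu>)"
    unfolding riesz_energy_def h_def using \<mu>A by (intro INF_lower) (simp add: \<mu>_def)
  also have "\<dots> = (\<Sum>i<N. \<integral>\<^sup>+x. h (c i + r *\<^sub>R q x) \<partial>?\<nu>) / of_nat N" by (rule int\<mu>) measurable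
  also have "\<dots> \<le> (\<Sum>i<N. \<integral>\<^sup>+x. X' x / of_nat N + ?Y \<partial>?\<nu>) / of_nat N"
  proof (intro divide_right_mono_ennreal sum_mono)
    fix i assume "i \<in> {..<N}"
    then show "(\<integral>\<^sup>+x. h (c i + r *\<^sub>R q x) \<partial>?\<nu>) \<le> (\<integral>\<^sup>+x. X' x / of_nat N + ?Y \<partial>?\<nu>)"
      using inner by (intro nn_integral_mono_AE eventually_mono[OF ae]) auto
  qed
  also have "\<dots> = (\<integral>\<^sup>+x. X' x / of_nat N + ?Y \<partial>?\<nu>)"
    using N by (simp add: mult_divide_eq_ennreal mult.commute[of "of_nat N"])
  also have "\<dots> = (\<integral>\<^sup>+x. X' x / of_nat N \<partial>?\<nu>) + (\<integral>\<^sup>+x. ?Y \<partial>?\<nu>)"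
    unfolding X'_def by (rule nn_integral_add) measurable
  also have "(\<integral>\<^sup>+x. ?Y \<partial>?\<nu>) = ?Y" by (simp add: nu.emeasure_space_1)
  also have "(\<integral>\<^sup>+x. X' x / of_nat N \<partial>?\<nu>) = ennreal (1 / (real N * r powr \<alpha>)) * (\<integral>\<^sup>+x. X x \<partial>?\<nu>)"
  proof -
    have "X' x / of_nat N = ennreal (1 / (real N * r powr \<alpha>)) * X x" for x
    proof -
      have "X' x / of_nat N = (ennreal (1 / r powr \<alpha>) * inverse (of_nat N)) * X x"
        by (simp add: X'_def divide_ennreal_def mult_ac)
      also have "inverse (of_nat N) = ennreal (1 / real N)"
        using N by (simp add: ennreal_of_nat_eq_real_of_nat inverse_ennreal inverse_eq_divide)
      finally show ?thesis by (simp add: ennreal_mult[symmetric] mult.commute)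
    qed
    then show ?thesis by (simp add: nn_integral_cmult)
  qed
  finally show ?thesis unfolding X_def .
qed

section \<open>Dispersed competitors and the theorem\<close>

text \<open>Balls give equality: at the volume of a ball, the isoperimetric bound is the value that
  the test with the position vector gives from above.\<close>

lemma iso_const_ball:
  assumes "r > 0"
  shows "iso_const TYPE('a::euclidean_space) * (unit_ball_vol (real DIM('a)) * r ^ DIM('a)) powr ((real DIM('a) - 1) / real DIM('a))
    = real DIM('a) * unit_ball_vol (real DIM('a)) * r ^ (DIM('a) - 1)"
proof -
  let ?n = "real DIM('a)" and ?\<omega> = "unit_ball_vol (real DIM('a))"
  have w: "?\<omega> > 0" by (simp add: unit_ball_vol_pos)
  have n1: "real (DIM('a) - 1) = ?n - 1" by (simp add: of_nat_diff Suc_leI)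
  have "(r ^ DIM('a)) powr ((?n - 1) / ?n) = (r powr ?n) powr ((?n - 1) / ?n)" using assms by (simp add: powr_realpow)
  also have "\<dots> = r powr (real (DIM('a) - 1))" unfolding powr_powr n1 by simp
  also have "\<dots> = r ^ (DIM('a) - 1)" using assms by (rule powr_realpow)
  finally have 1: "(r ^ DIM('a)) powr ((?n - 1) / ?n) = r ^ (DIM('a) - 1)" .
  have "?\<omega> powr (1 / ?n) * ?\<omega> powr ((?n - 1) / ?n) = ?\<omega> powr 1"
    unfolding powr_add[symmetric] by (simp add: add_divide_distrib[symmetric])
  then have 2: "?\<omega> powr (1 / ?n) * ?\<omega> powr ((?n - 1) / ?n) = ?\<omega>" using w by simp
  have "iso_const TYPE('a) * (?\<omega> * r ^ DIM('a)) powr ((?n - 1) / ?n)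
    = ?n * (?\<omega> powr (1 / ?n) * ?\<omega> powr ((?n - 1) / ?n)) * (r ^ DIM('a)) powr ((?n - 1) / ?n)"
    using w assms by (simp add: iso_const_def powr_mult)
  then show ?thesis unfolding 1 2 .
qed

lemma perimeter_ball_le:
  fixes c :: "'a::euclidean_space"
  assumes r: "r > 0"
  shows "perimeter (ball c r) \<le> ennreal (real DIM('a) * unit_ball_vol (real DIM('a)) * r ^ (DIM('a) - 1))"
proof -
  have "AE x in lebesgue. x \<notin> sphere c r"
    by (rule AE_not_in) (use negligible_sphere[of c r] in \<open>simp add: negligible_iff_null_sets\<close>)
  then have "AE x in lebesgue. x \<in> ball c r \<longleftrightarrow> x \<in> cball c r"
    by (rule eventually_mono) auto
  then have "perimeter (ball c r) = perimeter (cball c r)" by (intro perimeter_null_cong) auto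
  then show ?thesis using perimeter_cball_le[OF r, of c] by simp
qed

text \<open>The upper half comes from the test with the position vector, the lower half from the
  isoperimetric inequality.\<close>

lemma perimeter_ball:
  fixes c :: "'a::euclidean_space"
  assumes r: "r > 0"
  shows "perimeter (ball c r) = ennreal (real DIM('a) * unit_ball_vol (real DIM('a)) * r ^ (DIM('a) - 1))"
proof (rule antisym[OF perimeter_ball_le[OF r]])
  have "emeasure lebesgue (ball c r) = ennreal (unit_ball_vol (real DIM('a)) * r ^ DIM('a))"
    using r by (simp add: emeasure_ball)
  then have "ennreal (iso_const TYPE('a) * (unit_ball_vol (real DIM('a)) * r ^ DIM('a)) powr ((real DIM('a) - 1) / real DIM('a))) \<le> perimeter (ball c r)"
    using r unit_ball_vol_pos[of "real DIM('a)"] by (intro isoperimetric_inequality) auto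
  then show "ennreal (real DIM('a) * unit_ball_vol (real DIM('a)) * r ^ (DIM('a) - 1)) \<le> perimeter (ball c r)"
    unfolding iso_const_ball[OF r] .
qed

text \<open>\<open>Suc i\<close> keeps the origin free for the large ball.\<close>

definition centre :: "'a::euclidean_space \<Rightarrow> real \<Rightarrow> nat \<Rightarrow> 'a" where
  "centre e L i = (L * real (Suc i)) *\<^sub>R e"

definition split_ball :: "'a::euclidean_space \<Rightarrow> 'a \<Rightarrow> real \<Rightarrow> 'a set" where
  "split_ball e c r = ball c r - {x. x \<bullet> e = c \<bullet> e}"

definition dispersed_set :: "'a::euclidean_space \<Rightarrow> real \<Rightarrow> real \<Rightarrow> nat \<Rightarrow> real \<Rightarrow> 'a set" where
  "dispersed_set e L r0 N r = ball 0 r0 \<union> (\<Union>i<N. split_ball e (centre e L i) r)"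

lemma open_split_ball: "open (split_ball e c r)"
  unfolding split_ball_def by (intro open_Diff open_ball closed_Collect_eq continuous_intros)

lemma open_dispersed_set: "open (dispersed_set e L r0 N r)"
  unfolding dispersed_set_def by (intro open_Un open_ball open_UN ballI open_split_ball)

lemma centre_dist:
  assumes e: "norm e = 1" and L: "L > 0"
  shows "i \<noteq> j \<Longrightarrow> L \<le> norm (centre e L i - centre e L j)" "L \<le> norm (centre e L i)"
proof -
  assume "i \<noteq> j"
  then have "1 \<le> \<bar>real i - real j\<bar>" by linarith
  then have "L * 1 \<le> L * \<bar>real i - real j\<bar>" using L by (intro mult_left_mono) auto
  also have "\<dots> = norm (centre e L i - centre e L j)"
  proof -
    have "centre e L i - centre e L j = (L * (real i - real j)) *\<^sub>R e"
      by (simp add: centre_def algebra_simps)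
    then show ?thesis using e L by (simp add: abs_mult)
  qed
  finally show "L \<le> norm (centre e L i - centre e L j)" by simp
next
  have "L * 1 \<le> L * real (Suc i)" using L by (intro mult_left_mono) auto
  then show "L \<le> norm (centre e L i)" using e L by (simp add: centre_def abs_mult)
qed

lemma split_ball_null:
  fixes c e :: "'a::euclidean_space"
  assumes e: "e \<in> Basis"
  shows "emeasure lborel (split_ball e c r) = emeasure lborel (ball c r)"
    "perimeter (split_ball e c r) = perimeter (ball c r)"
proof -
  have N: "{x. x \<bullet> e = c \<bullet> e} \<in> null_sets lborel" by (rule null_hyperplane_Basis[OF e])
  show "emeasure lborel (split_ball e c r) = emeasure lborel (ball c r)"
    unfolding split_ball_def by (rule emeasure_Diff_null_set[OF N]) simp
  have "AE x in lebesgue. x \<notin> {x. x \<bullet> e = c \<bullet> e}"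
    using N by (intro AE_not_in null_sets_completionI)
  then have "AE x in lebesgue. x \<in> split_ball e c r \<longleftrightarrow> x \<in> ball c r"
    by (rule eventually_mono) (auto simp: split_ball_def)
  then show "perimeter (split_ball e c r) = perimeter (ball c r)"
    using open_split_ball[of e c r] by (intro perimeter_null_cong) (auto intro: borel_open)
qed

lemma dispersed_set_disjoint:
  fixes e :: "'a::euclidean_space"
  assumes e: "norm e = 1" and L: "L \<ge> r0 + 2" and r: "0 < r" "r \<le> 1" and r0: "r0 > 0"
  shows "disjoint_family (\<lambda>i. split_ball e (centre e L i) r)"
    "ball 0 r0 \<inter> (\<Union>i<N. split_ball e (centre e L i) r) = {}"
proof -
  have L0: "L > 0" using L r0 by linarith
  show "disjoint_family (\<lambda>i. split_ball e (centre e L i) r)"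
    unfolding disjoint_family_on_def
  proof (intro ballI impI)
    fix i j :: nat assume "i \<noteq> j"
    then have "L \<le> dist (centre e L i) (centre e L j)" using centre_dist(1)[OF e L0] by (simp add: dist_norm)
    then have "ball (centre e L i) r \<inter> ball (centre e L j) r = {}" using L r r0 by (intro disjoint_ballI) linarith
    then show "split_ball e (centre e L i) r \<inter> split_ball e (centre e L j) r = {}" by (auto simp: split_ball_def)
  qed
  have "ball 0 r0 \<inter> ball (centre e L i) r = {}" for i
    using centre_dist(2)[OF e L0, of i] L r by (intro disjoint_ballI) (simp add: dist_norm)
  then show "ball 0 r0 \<inter> (\<Union>i<N. split_ball e (centre e L i) r) = {}" unfolding split_ball_def by blast
qed

lemma dispersed_set_measure_perimeter:
  fixes e :: "'a::euclidean_space"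
  assumes e: "e \<in> Basis" and L: "L \<ge> r0 + 2" and r: "0 < r" "r \<le> 1" and r0: "r0 > 0"
  shows "emeasure lborel (dispersed_set e L r0 N r)
      = ennreal (unit_ball_vol (real DIM('a)) * r0 ^ DIM('a) + real N * (unit_ball_vol (real DIM('a)) * r ^ DIM('a)))"
    "perimeter (dispersed_set e L r0 N r)
      \<le> ennreal (real DIM('a) * unit_ball_vol (real DIM('a)) * r0 ^ (DIM('a) - 1) + real N * (real DIM('a) * unit_ball_vol (real DIM('a)) * r ^ (DIM('a) - 1)))"
proof -
  let ?S = "\<lambda>i. split_ball e (centre e L i) r" and ?\<omega> = "unit_ball_vol (real DIM('a))"
  have w: "?\<omega> > 0" by (simp add: unit_ball_vol_pos)
  have e1: "norm e = 1" using e by simp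
  note dj = dispersed_set_disjoint[OF e1 L r r0]
  have Sb: "?S i \<in> sets borel" for i by (intro borel_open open_split_ball)
  have "emeasure lborel (\<Union>i<N. ?S i) = (\<Sum>i<N. emeasure lborel (?S i))"
    using Sb dj(1) by (intro sum_emeasure[symmetric]) (auto simp: disjoint_family_on_def)
  also have "\<dots> = (\<Sum>i<N. ennreal (?\<omega> * r ^ DIM('a)))"
    using r by (simp add: split_ball_null[OF e] emeasure_ball)
  also have "\<dots> = ennreal (real N * (?\<omega> * r ^ DIM('a)))"
    using r w by (simp add: ennreal_of_nat_eq_real_of_nat ennreal_mult)
  finally have U: "emeasure lborel (\<Union>i<N. ?S i) = ennreal (real N * (?\<omega> * r ^ DIM('a)))" .
  have "emeasure lborel (dispersed_set e L r0 N r) = emeasure lborel (ball (0::'a) r0) + emeasure lborel (\<Union>i<N. ?S i)"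
    unfolding dispersed_set_def using Sb dj(2) by (intro plus_emeasure[symmetric]) auto
  then show "emeasure lborel (dispersed_set e L r0 N r) = ennreal (?\<omega> * r0 ^ DIM('a) + real N * (?\<omega> * r ^ DIM('a)))"
    using r0 r w by (simp add: U emeasure_ball ennreal_plus)
  let ?p = "real DIM('a) * ?\<omega> * r ^ (DIM('a) - 1)"
  have "perimeter (dispersed_set e L r0 N r) \<le> perimeter (ball (0::'a) r0) + perimeter (\<Union>i<N. ?S i)"
    unfolding dispersed_set_def using Sb dj(2) by (intro perimeter_Un_le) auto
  also have "\<dots> \<le> ennreal (real DIM('a) * ?\<omega> * r0 ^ (DIM('a) - 1)) + of_nat N * ennreal ?p"
    using perimeter_ball_le[OF r(1), where 'a='a]
    by (intro add_mono perimeter_ball_le[OF r0] perimeter_UN_le Sb dj(1)) (simp add: split_ball_null[OF e])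
  also have "\<dots> = ennreal (real DIM('a) * ?\<omega> * r0 ^ (DIM('a) - 1) + real N * ?p)"
    using r0 r w by (simp add: ennreal_of_nat_eq_real_of_nat ennreal_mult[symmetric] ennreal_plus[symmetric] del: ennreal_plus)
  finally show "perimeter (dispersed_set e L r0 N r) \<le> ennreal (real DIM('a) * ?\<omega> * r0 ^ (DIM('a) - 1) + real N * ?p)" .
qed

text \<open>The projected point lies on the hyperplane removed from its own ball, and all other
  balls are too far away, so it is outside the set; an arbitrarily small shift along
  \<open>e\<close> brings it into a half-ball.\<close>

lemma drop_coord_in_frontier:
  fixes e :: "'a::euclidean_space"
  assumes e: "e \<in> Basis" and L: "L \<ge> r0 + 2" and r: "0 < r" "r \<le> 1" and r0: "r0 > 0"
    and i: "i < N" and x: "norm x < 1"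
  shows "centre e L i + r *\<^sub>R drop_coord e x \<in> frontier (dispersed_set e L r0 N r)"
proof -
  let ?E = "dispersed_set e L r0 N r" and ?c = "centre e L i"
  define y where "y = ?c + r *\<^sub>R drop_coord e x"
  have e1: "norm e = 1" using e by simp
  have ee: "e \<bullet> e = 1" using e by simp
  have L0: "L > 0" using L r0 by linarith
  have de: "drop_coord e x \<bullet> e = 0" by (simp add: drop_coord_def inner_diff_left ee)
  have ye: "y \<bullet> e = ?c \<bullet> e" by (simp add: y_def inner_add_left de)
  have yc: "dist ?c y < r"
  proof -
    have "dist ?c y = r * norm (drop_coord e x)" using r by (simp add: y_def dist_norm)
    also have "\<dots> < r * 1" using r norm_drop_coord_le[OF e, of x] x by (intro mult_strict_left_mono) linarith+
    finally show ?thesis by simp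
  qed
  have "y \<in> closure ?E"
    unfolding closure_approachable
  proof (intro allI impI)
    fix d :: real assume d: "d > 0"
    define s where "s = min d (r - dist ?c y) / 2"
    have s: "0 < s" "s < d" "s < r - dist ?c y" using d yc by (auto simp: s_def)
    let ?z = "y + s *\<^sub>R e"
    have dz: "dist ?z y = s" using s e1 by (simp add: dist_norm)
    have "dist ?c ?z \<le> dist ?c y + dist y ?z" by (rule dist_triangle)
    then have "dist ?c ?z < r" using s dz by (simp add: dist_commute)
    moreover have "?z \<bullet> e \<noteq> ?c \<bullet> e" using s ye by (simp add: inner_add_left ee)
    ultimately have "?z \<in> split_ball e ?c r" by (simp add: split_ball_def)
    then have "?z \<in> ?E" using i unfolding dispersed_set_def by blast
    then show "\<exists>z\<in>?E. dist z y < d" using dz s by (intro bexI[of _ ?z]) auto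
  qed
  moreover have "y \<notin> ?E"
  proof
    assume "y \<in> ?E"
    then consider "y \<in> ball 0 r0" | j where "y \<in> split_ball e (centre e L j) r" unfolding dispersed_set_def by blast
    then show False
    proof cases
      case 1
      have "norm ?c \<le> dist ?c y + norm y" using dist_triangle[of ?c 0 y] by (simp add: dist_norm)
      then show False using 1 yc centre_dist(2)[OF e1 L0, of i] L r by simp
    next
      case 2
      show False
      proof (cases "j = i")
        case True then show False using 2 ye by (simp add: split_ball_def)
      next
        case False
        have "dist ?c (centre e L j) \<le> dist ?c y + dist y (centre e L j)" by (rule dist_triangle)
        moreover have "dist y (centre e L j) < r" using 2 by (simp add: split_ball_def dist_commute)
        moreover have "L \<le> dist ?c (centre e L j)" using centre_dist(1)[OF e1 L0, of i j] False by (simp add: dist_norm)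
        ultimately show False using yc L r r0 by linarith
      qed
    qed
  qed
  ultimately show ?thesis
    unfolding y_def[symmetric] frontier_def by (simp add: interior_open[OF open_dispersed_set])
qed

text \<open>The identity charges the small solid balls, the projection \<open>drop_coord e\<close>
  charges their discs in the frontier, and the large ball carries no charge. Neither map brings
  points closer than the projection does, so both energies have the same bound.\<close>

lemma dispersed_set_energy:
  fixes e :: "'a::euclidean_space"
  assumes e: "e \<in> Basis" and \<alpha>: "\<alpha> > 0" and N: "N > 0" and r: "0 < r" "r \<le> 1" and r0: "r0 > 0" and D: "D > 0"
    and L: "L = D + r0 + 2"
    and A: "A = dispersed_set e L r0 N r \<or> A = frontier (dispersed_set e L r0 N r)"
  shows "riesz_energy \<alpha> A \<le> ennreal (1 / (real N * r powr \<alpha>))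
      * (\<integral>\<^sup>+x. (\<integral>\<^sup>+y. riesz_kernel \<alpha> (drop_coord e x - drop_coord e y) \<partial>unit_charge) \<partial>unit_charge)
    + ennreal (1 / D powr \<alpha>)"
proof -
  have e1: "norm e = 1" using e by simp
  have L2: "L \<ge> r0 + 2" and L0: "L > 0" using L D r0 by linarith+
  have c: "norm (centre e L i - centre e L j) \<ge> D + 2" if "i < N" "j < N" "i \<noteq> j" for i j
    using centre_dist(1)[OF e1 L0 that(3)] L r0 by linarith
  have dd: "norm (drop_coord e x - drop_coord e y) \<le> norm (x - y)" for x y
    unfolding drop_coord_diff by (rule norm_drop_coord_le[OF e])
  from A show ?thesis
  proof
    assume A: "A = dispersed_set e L r0 N r"
    show ?thesis
    proof (rule riesz_energy_dispersed[OF e \<alpha> N r D c, where q="\<lambda>x. x"])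
      show "A \<in> sets borel" unfolding A by (intro borel_open open_dispersed_set)
      fix i x assume i: "i < N" and x: "norm (x::'a) < 1" "x \<bullet> e \<noteq> 0"
      have "r * norm x < r * 1" using x r by (intro mult_strict_left_mono)
      then have "centre e L i + r *\<^sub>R x \<in> split_ball e (centre e L i) r"
        using x r by (simp add: split_ball_def dist_norm inner_add_left)
      then show "centre e L i + r *\<^sub>R x \<in> A" unfolding A dispersed_set_def using i by blast
    qed (use dd in auto)
  next
    assume A: "A = frontier (dispersed_set e L r0 N r)"
    show ?thesis
    proof (rule riesz_energy_dispersed[OF e \<alpha> N r D c, where q="drop_coord e"])
      show "A \<in> sets borel" unfolding A by (intro borel_closed frontier_closed)
      show "centre e L i + r *\<^sub>R drop_coord e x \<in> A" if "i < N" "norm x < 1" "x \<bullet> e \<noteq> 0" for i x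
        unfolding A by (rule drop_coord_in_frontier[OF e L2 r r0 that(1,2)])
    qed (use norm_drop_coord_le[OF e] in auto)
  qed
qed

text \<open>With \<open>r = N powr (-2 / (s + \<alpha>))\<close> both quantities equal \<open>N powr (-(s - \<alpha>) / (s + \<alpha>))\<close>.\<close>

lemma number_and_radius:
  fixes \<alpha> \<delta> :: real and s :: nat
  assumes \<alpha>: "0 < \<alpha>" "\<alpha> < real s" and \<delta>: "\<delta> > 0"
  obtains N :: nat and r :: real where "N > 0" "0 < r" "r \<le> 1" "real N * r ^ s \<le> \<delta>" "1 / (real N * r powr \<alpha>) \<le> \<delta>"
proof -
  define \<gamma> where "\<gamma> = (real s - \<alpha>) / (real s + \<alpha>)"
  have g: "\<gamma> > 0" using \<alpha> by (simp add: \<gamma>_def)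
  obtain N :: nat where N0: "max 1 ((1 / \<delta>) powr (1 / \<gamma>)) < real N" using reals_Archimedean2 by blast
  then have N: "1 < real N" "(1 / \<delta>) powr (1 / \<gamma>) \<le> real N" by auto
  \<comment> \<open>The exponent \<open>2 / (s + \<alpha>)\<close> lies strictly between
    \<open>1 / s\<close> and \<open>1 / \<alpha>\<close>.\<close>
  define r where "r = real N powr (- 2 / (real s + \<alpha>))"
  have r: "0 < r" using N by (simp add: r_def)
  have small: "real N powr (- \<gamma>) \<le> \<delta>"
  proof -
    have "((1 / \<delta>) powr (1 / \<gamma>)) powr \<gamma> \<le> real N powr \<gamma>" using N(2) g by (intro powr_mono2) auto
    then have "1 / \<delta> \<le> real N powr \<gamma>" using g \<delta> by (simp add: powr_powr)
    then show ?thesis using \<delta> N by (simp add: powr_minus field_simps)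
  qed
  have e1: "1 + (- 2 / (real s + \<alpha>)) * real s = - \<gamma>" using \<alpha> by (simp add: \<gamma>_def field_simps)
  have e2: "1 + (- 2 / (real s + \<alpha>)) * \<alpha> = \<gamma>" using \<alpha> by (simp add: \<gamma>_def field_simps)
  have "real N * r ^ s = real N powr 1 * (real N powr (- 2 / (real s + \<alpha>))) powr (real s)"
    using N r by (simp add: r_def powr_realpow)
  also have "\<dots> = real N powr (- \<gamma>)" unfolding powr_powr powr_add[symmetric] e1 ..
  finally have 1: "real N * r ^ s \<le> \<delta>" using small by simp
  have "real N * r powr \<alpha> = real N powr 1 * (real N powr (- 2 / (real s + \<alpha>))) powr \<alpha>"
    using N by (simp add: r_def)
  also have "\<dots> = real N powr \<gamma>" unfolding powr_powr powr_add[symmetric] e2 ..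
  finally have "1 / (real N * r powr \<alpha>) = real N powr (- \<gamma>)" by (simp add: powr_minus divide_inverse)
  then have 2: "1 / (real N * r powr \<alpha>) \<le> \<delta>" using small by simp
  have "r \<le> 1"
  proof -
    have "r \<le> real N powr 0" unfolding r_def using N \<alpha> by (intro powr_mono) (auto simp: divide_nonpos_pos)
    then show ?thesis using N by simp
  qed
  then show ?thesis using that[of N r] N r 1 2 by simp
qed

lemma near_optimal_set:
  fixes \<alpha> Q m \<epsilon> :: real
  assumes n: "DIM('a::euclidean_space) \<ge> 2" and m: "m > 0" and \<alpha>: "0 < \<alpha>" "\<alpha> < real DIM('a) - 1" and \<epsilon>: "\<epsilon> > 0"
  obtains E :: "'a::euclidean_space set" where "open E" "emeasure lborel E = ennreal m"
    "energy_F \<alpha> Q E \<le> ennreal (iso_const TYPE('a) * m powr ((real DIM('a) - 1) / real DIM('a)) + \<epsilon>)"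
    "energy_G \<alpha> Q E \<le> ennreal (iso_const TYPE('a) * m powr ((real DIM('a) - 1) / real DIM('a)) + \<epsilon>)"
proof -
  let ?n = "real DIM('a)" and ?\<omega> = "unit_ball_vol (real DIM('a))"
  let ?Pm = "iso_const TYPE('a) * m powr ((?n - 1) / ?n)"
  have w: "?\<omega> > 0" by (simp add: unit_ball_vol_pos)
  obtain e :: 'a where e: "e \<in> Basis" using nonempty_Basis by blast
  define J where "J = (\<integral>\<^sup>+x. (\<integral>\<^sup>+y. riesz_kernel \<alpha> (drop_coord e x - drop_coord e y) \<partial>unit_charge) \<partial>(unit_charge :: 'a measure))"
  have "J < \<infinity>" unfolding J_def by (rule unit_charge_energy[OF e n \<alpha>])
  then obtain j where j: "J = ennreal j" "j \<ge> 0" by (cases J) auto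
  \<comment> \<open>The coefficient of \<delta> in the total error: \<open>?n * ?\<omega>\<close>
    from the perimeters of the small balls, \<open>j\<close> from the self-energies and 1 from the
    mutual interaction, both weighted by the square of \<open>Q\<close>.\<close>
  define C where "C = ?n * ?\<omega> + Q\<^sup>2 * (j + 1)"
  have C: "C > 0" unfolding C_def using w j by (intro add_pos_nonneg) auto
  \<comment> \<open>The second entry keeps the total volume of the small balls below
    \<open>m\<close>.\<close>
  define \<delta> where "\<delta> = min (\<epsilon> / C) (m / (2 * ?\<omega>))"
  have d: "\<delta> > 0" "C * \<delta> \<le> \<epsilon>" "?\<omega> * \<delta> < m"
  proof -
    show "\<delta> > 0" using \<epsilon> C m w by (simp add: \<delta>_def)
    have "\<delta> \<le> \<epsilon> / C" by (simp add: \<delta>_def)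
    then show "C * \<delta> \<le> \<epsilon>" using C by (simp add: field_simps)
    have "\<delta> \<le> m / (2 * ?\<omega>)" by (simp add: \<delta>_def)
    then have "?\<omega> * \<delta> \<le> m / 2" using w by (simp add: field_simps)
    then show "?\<omega> * \<delta> < m" using m by linarith
  qed
  have s: "\<alpha> < real (DIM('a) - 1)" using \<alpha> n by (simp add: of_nat_diff)
  obtain N r where Nr: "N > 0" "0 < r" "r \<le> 1" "real N * r ^ (DIM('a) - 1) \<le> \<delta>" "1 / (real N * r powr \<alpha>) \<le> \<delta>"
    using number_and_radius[OF \<alpha>(1) s d(1)] .
  \<comment> \<open>The separation at which the bound \<open>1 / D powr \<alpha>\<close> for the
    mutual interaction is exactly \<delta>.\<close>
  define D where "D = (1 / \<delta>) powr (1 / \<alpha>)"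
  have D: "D > 0" "1 / D powr \<alpha> = \<delta>" using d(1) \<alpha> by (auto simp: D_def powr_powr)
  have rn: "real N * r ^ DIM('a) \<le> \<delta>"
  proof -
    have "r ^ DIM('a) \<le> r ^ (DIM('a) - 1)" using Nr by (intro power_decreasing) auto
    then have "real N * r ^ DIM('a) \<le> real N * r ^ (DIM('a) - 1)" by (intro mult_left_mono) auto
    then show ?thesis using Nr(4) by linarith
  qed
  \<comment> \<open>The large ball receives the remaining volume; as this is at most
    \<open>m\<close>, its perimeter is at most the optimal one.\<close>
  define v where "v = m - real N * (?\<omega> * r ^ DIM('a))"
  have v: "0 < v" "v \<le> m"
  proof -
    have "?\<omega> * (real N * r ^ DIM('a)) \<le> ?\<omega> * \<delta>" using rn w by (intro mult_left_mono) auto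
    moreover have "real N * (?\<omega> * r ^ DIM('a)) = ?\<omega> * (real N * r ^ DIM('a))" by simp
    ultimately show "0 < v" using d(3) unfolding v_def by linarith
    show "v \<le> m" using w Nr by (simp add: v_def)
  qed
  define r0 where "r0 = (v / ?\<omega>) powr (1 / ?n)"
  have w0: "?\<omega> \<noteq> 0" using w by linarith
  have "v / ?\<omega> > 0" using v w by (intro divide_pos_pos)
  then have r0: "r0 > 0" unfolding r0_def by (metis less_irrefl powr_gt_zero)
  have r0n: "?\<omega> * r0 ^ DIM('a) = v"
  proof -
    have "r0 ^ DIM('a) = r0 powr ?n" using r0 by (simp add: powr_realpow)
    also have "\<dots> = v / ?\<omega>" using v(1) w0 unfolding r0_def powr_powr by simp
    finally show ?thesis using w0 by simp
  qed
  define L where "L = D + r0 + 2"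
  have L2: "L \<ge> r0 + 2" using D by (simp add: L_def)
  define E where "E = dispersed_set e L r0 N r"
  note mp = dispersed_set_measure_perimeter[OF e L2 Nr(2,3) r0, where N=N, folded E_def]
  have Eo: "open E" unfolding E_def by (rule open_dispersed_set)
  have Em: "emeasure lborel E = ennreal m" unfolding mp(1) r0n by (simp add: v_def)
  have per: "perimeter E \<le> ennreal (?Pm + ?n * ?\<omega> * \<delta>)"
  proof (rule order_trans[OF mp(2)], rule ennreal_leI)
    have "?n * ?\<omega> * r0 ^ (DIM('a) - 1) = iso_const TYPE('a) * v powr ((?n - 1) / ?n)"
      using iso_const_ball[OF r0, where 'a='a] unfolding r0n by simp
    also have "\<dots> \<le> ?Pm" using v n iso_const_pos[where 'a='a] by (intro mult_left_mono powr_mono2) auto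
    finally have 1: "?n * ?\<omega> * r0 ^ (DIM('a) - 1) \<le> ?Pm" .
    have "?n * ?\<omega> * (real N * r ^ (DIM('a) - 1)) \<le> ?n * ?\<omega> * \<delta>" using Nr(4) w by (intro mult_left_mono) auto
    moreover have "real N * (?n * ?\<omega> * r ^ (DIM('a) - 1)) = ?n * ?\<omega> * (real N * r ^ (DIM('a) - 1))" by simp
    ultimately show "?n * ?\<omega> * r0 ^ (DIM('a) - 1) + real N * (?n * ?\<omega> * r ^ (DIM('a) - 1)) \<le> ?Pm + ?n * ?\<omega> * \<delta>"
      using 1 by linarith
  qed
  have en: "ennreal (Q\<^sup>2) * riesz_energy \<alpha> A \<le> ennreal (Q\<^sup>2 * (j + 1) * \<delta>)" if A: "A = E \<or> A = frontier E" for A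
  proof -
    have "riesz_energy \<alpha> A \<le> ennreal (1 / (real N * r powr \<alpha>)) * J + ennreal (1 / D powr \<alpha>)"
      unfolding J_def by (rule dispersed_set_energy[OF e \<alpha>(1) Nr(1,2,3) r0 D(1) L_def]) (use A E_def in simp)
    also have "\<dots> \<le> ennreal \<delta> * ennreal j + ennreal \<delta>"
      unfolding j(1) D(2) by (intro add_right_mono mult_right_mono ennreal_leI Nr(5)) simp
    also have "\<dots> = ennreal ((j + 1) * \<delta>)"
      using d(1) j(2) by (simp add: ennreal_mult[symmetric] ennreal_plus[symmetric] algebra_simps del: ennreal_plus)
    finally have "ennreal (Q\<^sup>2) * riesz_energy \<alpha> A \<le> ennreal (Q\<^sup>2) * ennreal ((j + 1) * \<delta>)" by (rule mult_left_mono) simp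
    also have "\<dots> = ennreal (Q\<^sup>2 * (j + 1) * \<delta>)" using d(1) j(2) by (simp add: ennreal_mult[symmetric] mult.assoc)
    finally show ?thesis .
  qed
  have tot: "perimeter E + ennreal (Q\<^sup>2) * riesz_energy \<alpha> A \<le> ennreal (?Pm + \<epsilon>)" if A: "A = E \<or> A = frontier E" for A
  proof -
    have nn: "?Pm + ?n * ?\<omega> * \<delta> \<ge> 0" "Q\<^sup>2 * (j + 1) * \<delta> \<ge> 0"
      using iso_const_pos[where 'a='a] w d(1) j(2) by auto
    have "perimeter E + ennreal (Q\<^sup>2) * riesz_energy \<alpha> A \<le> ennreal (?Pm + ?n * ?\<omega> * \<delta>) + ennreal (Q\<^sup>2 * (j + 1) * \<delta>)"
      by (intro add_mono per en A)
    also have "\<dots> = ennreal (?Pm + ?n * ?\<omega> * \<delta> + Q\<^sup>2 * (j + 1) * \<delta>)" by (rule ennreal_plus[OF nn, symmetric])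
    also have "\<dots> \<le> ennreal (?Pm + \<epsilon>)"
    proof (rule ennreal_leI)
      have "?n * ?\<omega> * \<delta> + Q\<^sup>2 * (j + 1) * \<delta> = C * \<delta>" by (simp add: C_def distrib_right)
      then show "?Pm + ?n * ?\<omega> * \<delta> + Q\<^sup>2 * (j + 1) * \<delta> \<le> ?Pm + \<epsilon>" using d(2) by linarith
    qed
    finally show ?thesis .
  qed
  show ?thesis
    by (rule that[OF Eo Em]) (use tot in \<open>simp_all add: energy_F_def energy_G_def\<close>)
qed

text \<open>One statement for both functionals: \<open>A\<close> is the set that carries the
  charge.\<close>

lemma no_minimiser:
  fixes A E :: "'a::euclidean_space set"
  assumes n: "DIM('a) \<ge> 2" and m: "m > 0" and Q: "Q > 0" and \<alpha>: "\<alpha> > 0"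
    and E: "open E" "emeasure lborel E = ennreal m" and A: "A = E \<or> A = frontier E"
    and le: "perimeter E + ennreal (Q\<^sup>2) * riesz_energy \<alpha> A
      \<le> ennreal (iso_const TYPE('a) * m powr ((real DIM('a) - 1) / real DIM('a)))"
  shows False
proof -
  let ?Pm = "ennreal (iso_const TYPE('a) * m powr ((real DIM('a) - 1) / real DIM('a)))"
  have low: "?Pm \<le> perimeter E" using E m by (intro isoperimetric_inequality) auto
  have "perimeter E \<le> perimeter E + ennreal (Q\<^sup>2) * riesz_energy \<alpha> A" by simp
  then have "perimeter E \<le> ?Pm" using le by (rule order_trans)
  then have bE: "bounded E" by (rule minimiser_bounded[OF E m n])
  then have bA: "bounded A" using A by (auto simp: frontier_def bounded_closure intro: bounded_subset)
  have "A \<in> sets borel" using A E(1) by auto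
  then have pos: "riesz_energy \<alpha> A > 0" using bA \<alpha> by (intro riesz_energy_bounded_pos)
  \<comment> \<open>The isoperimetric bound is finite and can be cancelled, which leaves no room for
    any energy.\<close>
  have "?Pm + ennreal (Q\<^sup>2) * riesz_energy \<alpha> A \<le> ?Pm + 0"
    using order_trans[OF add_right_mono[OF low] le] by simp
  then have "ennreal (Q\<^sup>2) * riesz_energy \<alpha> A \<le> 0" unfolding ennreal_add_left_cancel_le by simp
  then show False using pos Q by simp
qed

section \<open>Values of the infima and non-existence of minimisers\<close>

theorem theorem3p2:
  fixes \<alpha> Q m :: real
  assumes "CARD('n::finite) \<ge> 2" and "Q > 0" and "m > 0"
    and "0 < \<alpha>" and "\<alpha> < real CARD('n) - 1"
  shows
    "(INF E\<in>{E :: (real ^ 'n) set. open E \<and> emeasure lebesgue E = ennreal m}. energy_F \<alpha> Q E)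
       = (INF E\<in>{E :: (real ^ 'n) set. open E \<and> emeasure lebesgue E = ennreal m}. energy_G \<alpha> Q E)
     \<and> (INF E\<in>{E :: (real ^ 'n) set. open E \<and> emeasure lebesgue E = ennreal m}. energy_G \<alpha> Q E)
       = (INF E\<in>{E :: (real ^ 'n) set. E \<in> sets lebesgue \<and> emeasure lebesgue E = ennreal m}. perimeter E)
     \<and> (\<exists>E :: (real ^ 'n) set.
          is_arg_min perimeter (\<lambda>E. E \<in> sets lebesgue \<and> emeasure lebesgue E = ennreal m) E)
     \<and> (INF E\<in>{E :: (real ^ 'n) set. E \<in> sets lebesgue \<and> emeasure lebesgue E = ennreal m}. perimeter E)
       = ennreal ((m / measure lebesgue (ball (0 :: real ^ 'n) 1)) powr ((real CARD('n) - 1) / real CARD('n)))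
           * perimeter (ball (0 :: real ^ 'n) 1)
     \<and> \<not> (\<exists>E :: (real ^ 'n) set.
          is_arg_min (energy_F \<alpha> Q) (\<lambda>E. open E \<and> emeasure lebesgue E = ennreal m) E)
     \<and> \<not> (\<exists>E :: (real ^ 'n) set.
          is_arg_min (energy_G \<alpha> Q) (\<lambda>E. open E \<and> emeasure lebesgue E = ennreal m) E)"
proof -
  let ?n = "real CARD('n)" and ?\<omega> = "unit_ball_vol (real CARD('n))"
  \<comment> \<open>\<open>p\<close> is the common value of the three infima.\<close>
  define p where "p = iso_const TYPE(real ^ 'n) * m powr ((?n - 1) / ?n)"
  have dim: "DIM(real ^ 'n) = CARD('n)" by simp
  have n: "DIM(real ^ 'n) \<ge> 2" using assms(1) by simp
  have \<alpha>: "0 < \<alpha>" "\<alpha> < real DIM(real ^ 'n) - 1" using assms(4,5) by simp_all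
  have w: "?\<omega> > 0" by (simp add: unit_ball_vol_pos)
  have p0: "p \<ge> 0" using iso_const_pos[where 'a="real ^ 'n"] by (simp add: p_def)
  let ?O = "{E :: (real ^ 'n) set. open E \<and> emeasure lebesgue E = ennreal m}"
  let ?M = "{E :: (real ^ 'n) set. E \<in> sets lebesgue \<and> emeasure lebesgue E = ennreal m}"
  have low: "ennreal p \<le> perimeter E" if "E \<in> ?M" for E
    using that isoperimetric_inequality[of E m] assms(3) by (simp add: p_def)
  have OM: "E \<in> ?M" if "E \<in> ?O" for E using that by auto
  have near: "\<exists>E\<in>?O. energy_F \<alpha> Q E \<le> ennreal (p + \<epsilon>) \<and> energy_G \<alpha> Q E \<le> ennreal (p + \<epsilon>)"
    if e: "\<epsilon> > 0" for \<epsilon> :: real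
  proof -
    obtain E :: "(real ^ 'n) set" where E: "open E" "emeasure lborel E = ennreal m"
      "energy_F \<alpha> Q E \<le> ennreal (p + \<epsilon>)" "energy_G \<alpha> Q E \<le> ennreal (p + \<epsilon>)"
      using near_optimal_set[OF n assms(3) \<alpha> e, of Q] unfolding p_def dim by metis
    then show ?thesis by (intro bexI[of _ E]) auto
  qed
  have F: "(INF E\<in>?O. energy_F \<alpha> Q E) = ennreal p"
  proof (rule antisym)
    show "(INF E\<in>?O. energy_F \<alpha> Q E) \<le> ennreal p"
    proof (rule ennreal_le_epsilon)
      fix \<epsilon> :: real assume e: "0 < \<epsilon>"
      obtain E where "E \<in> ?O" "energy_F \<alpha> Q E \<le> ennreal (p + \<epsilon>)" using near[OF e] by blast
      then have "(INF E\<in>?O. energy_F \<alpha> Q E) \<le> ennreal (p + \<epsilon>)" by (rule INF_lower2)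
      then show "(INF E\<in>?O. energy_F \<alpha> Q E) \<le> ennreal p + ennreal \<epsilon>" using p0 e by (simp add: ennreal_plus)
    qed
    show "ennreal p \<le> (INF E\<in>?O. energy_F \<alpha> Q E)"
      by (rule INF_greatest) (use low[OF OM] in \<open>simp add: energy_F_def add_increasing2\<close>)
  qed
  have G: "(INF E\<in>?O. energy_G \<alpha> Q E) = ennreal p"
  proof (rule antisym)
    show "(INF E\<in>?O. energy_G \<alpha> Q E) \<le> ennreal p"
    proof (rule ennreal_le_epsilon)
      fix \<epsilon> :: real assume e: "0 < \<epsilon>"
      obtain E where "E \<in> ?O" "energy_G \<alpha> Q E \<le> ennreal (p + \<epsilon>)" using near[OF e] by blast
      then have "(INF E\<in>?O. energy_G \<alpha> Q E) \<le> ennreal (p + \<epsilon>)" by (rule INF_lower2)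
      then show "(INF E\<in>?O. energy_G \<alpha> Q E) \<le> ennreal p + ennreal \<epsilon>" using p0 e by (simp add: ennreal_plus)
    qed
    show "ennreal p \<le> (INF E\<in>?O. energy_G \<alpha> Q E)"
      by (rule INF_greatest) (use low[OF OM] in \<open>simp add: energy_G_def add_increasing2\<close>)
  qed
  \<comment> \<open>The radius of the ball of volume \<open>m\<close>.\<close>
  define r where "r = (m / ?\<omega>) powr (1 / ?n)"
  have w0: "?\<omega> \<noteq> 0" using w by linarith
  have mw: "m / ?\<omega> > 0" using assms(3) w by (intro divide_pos_pos)
  then have r: "r > 0" unfolding r_def by (metis less_irrefl powr_gt_zero)
  have rn: "?\<omega> * r ^ CARD('n) = m"
  proof -
    have "r ^ CARD('n) = r powr ?n" using r by (simp add: powr_realpow)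
    also have "\<dots> = m / ?\<omega>" using assms(3) w0 unfolding r_def powr_powr by simp
    finally show ?thesis using w0 by simp
  qed
  let ?B = "ball (0 :: real ^ 'n) r"
  \<comment> \<open>Here \<open>BM_ineq\<close> is only a local label for the admissibility of the
    ball, unrelated to the predicate of that name.\<close>
  have BM_ineq: "?B \<in> ?M" using r rn by (simp add: emeasure_ball)
  have PB: "perimeter ?B = ennreal p"
    using perimeter_ball[OF r, of "0 :: real ^ 'n"] iso_const_ball[OF r, where 'a="real ^ 'n"] rn by (simp add: p_def)
  have P: "(INF E\<in>?M. perimeter E) = ennreal p"
  proof (rule antisym)
    show "(INF E\<in>?M. perimeter E) \<le> ennreal p" unfolding PB[symmetric] by (rule INF_lower[OF BM_ineq])
    show "ennreal p \<le> (INF E\<in>?M. perimeter E)" by (rule INF_greatest[OF low])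
  qed
  have min: "is_arg_min perimeter (\<lambda>E. E \<in> sets lebesgue \<and> emeasure lebesgue E = ennreal m) ?B"
    unfolding is_arg_min_def
  proof (intro conjI notI)
    show "?B \<in> sets lebesgue" "emeasure lebesgue ?B = ennreal m" using BM_ineq by auto
    assume "\<exists>E :: (real ^ 'n) set. (E \<in> sets lebesgue \<and> emeasure lebesgue E = ennreal m) \<and> perimeter E < perimeter ?B"
    then obtain E :: "(real ^ 'n) set" where E: "E \<in> sets lebesgue" "emeasure lebesgue E = ennreal m" "perimeter E < perimeter ?B" by blast
    have "ennreal p \<le> perimeter E" by (rule low) (simp add: E)
    then show False using E(3) unfolding PB by (simp add: not_le[symmetric])
  qed
  \<comment> \<open>Equality for the unit ball turns its perimeter into \<open>iso_const\<close>
    times a power of its volume, which cancels against the denominator.\<close>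
  have val: "ennreal ((m / measure lebesgue (ball (0 :: real ^ 'n) 1)) powr ((?n - 1) / ?n)) * perimeter (ball (0 :: real ^ 'n) 1) = ennreal p"
  proof -
    have "measure lebesgue (ball (0 :: real ^ 'n) 1) = ?\<omega>" by (simp add: content_ball)
    moreover have "perimeter (ball (0 :: real ^ 'n) 1) = ennreal (iso_const TYPE(real ^ 'n) * ?\<omega> powr ((?n - 1) / ?n))"
      using perimeter_ball[of 1 "0 :: real ^ 'n"] iso_const_ball[of 1, where 'a="real ^ 'n"] by simp
    moreover have "(m / ?\<omega>) powr ((?n - 1) / ?n) * (iso_const TYPE(real ^ 'n) * ?\<omega> powr ((?n - 1) / ?n)) = p"
      using assms(3) w0 by (simp add: p_def powr_divide)
    ultimately show ?thesis using iso_const_pos[where 'a="real ^ 'n"] by (simp add: ennreal_mult[symmetric])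
  qed
  have noF: "\<not> is_arg_min (energy_F \<alpha> Q) (\<lambda>E. open E \<and> emeasure lebesgue E = ennreal m) E" for E :: "(real ^ 'n) set"
  proof
    assume a: "is_arg_min (energy_F \<alpha> Q) (\<lambda>E. open E \<and> emeasure lebesgue E = ennreal m) E"
    then have "energy_F \<alpha> Q E \<le> energy_F \<alpha> Q E'" if "E' \<in> ?O" for E'
      using that unfolding is_arg_min_def not_le[symmetric] by simp
    then have "energy_F \<alpha> Q E \<le> ennreal p" unfolding F[symmetric] by (rule INF_greatest)
    then have le: "perimeter E + ennreal (Q\<^sup>2) * riesz_energy \<alpha> E \<le> ennreal (iso_const TYPE(real ^ 'n) * m powr ((real DIM(real ^ 'n) - 1) / real DIM(real ^ 'n)))"
      by (simp add: energy_F_def p_def)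
    have "open E" "emeasure lborel E = ennreal m" using a by (auto simp: is_arg_min_def)
    from no_minimiser[OF n assms(3,2,4) this _ le] show False by simp
  qed
  have noG: "\<not> is_arg_min (energy_G \<alpha> Q) (\<lambda>E. open E \<and> emeasure lebesgue E = ennreal m) E" for E :: "(real ^ 'n) set"
  proof
    assume a: "is_arg_min (energy_G \<alpha> Q) (\<lambda>E. open E \<and> emeasure lebesgue E = ennreal m) E"
    then have "energy_G \<alpha> Q E \<le> energy_G \<alpha> Q E'" if "E' \<in> ?O" for E'
      using that unfolding is_arg_min_def not_le[symmetric] by simp
    then have "energy_G \<alpha> Q E \<le> ennreal p" unfolding G[symmetric] by (rule INF_greatest)
    then have le: "perimeter E + ennreal (Q\<^sup>2) * riesz_energy \<alpha> (frontier E) \<le> ennreal (iso_const TYPE(real ^ 'n) * m powr ((real DIM(real ^ 'n) - 1) / real DIM(real ^ 'n)))"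
      by (simp add: energy_G_def p_def)
    have "open E" "emeasure lborel E = ennreal m" using a by (auto simp: is_arg_min_def)
    from no_minimiser[OF n assms(3,2,4) this _ le] show False by simp
  qed
  show ?thesis unfolding F G P val using min noF noG by blast
qed

end
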